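(* Let $A\in L(X)$ be a bounded complex-linear operator, let $\mathcal E$ be an Archimedian generating set for the $\mathbb R$-cone $K_{\mathbb R}\subset X_{\mathbb R}$ and $\mathcal M$ a weak-$*$ generating set for the dual cone $K'_{\mathbb R}$. Let $\mathcal T(A)\subset M_2(\mathbb C)$ be the collection of all matrices $$\begin{pmatrix}\langle m_1,Ae_1\rangle & \langle m_2,Ae_1\rangle\\ \langle m_1,Ae_2\rangle & \langle m_2,Ae_2\rangle\end{pmatrix},\qquad e_1,e_2\in\mathcal E,\ m_1,m_2\in\mathcal M .$$ Assume that $K_{\mathbb R}$ is of $\kappa$-bounded sectional aperture (for some $\kappa>0$) and reproducing, and that $\mathcal T(A)\subset\Gamma_+(\theta)$ for some $\theta\in[0,1)$. For $x\in K_{\mathbb C}^*$ and $m_1,m_2\in\mathcal M$ put $$M_{m_1m_2}=M_{m_1m_2}(x)=\begin{pmatrix}\langle m_1,Ax\rangle&\langle m_2,Ax\rangle\\ \langle m_1,x\rangle&\langle m_2,x\rangle\end{pmatrix}.$$ Then $$r_{\rm sp}(A)=\sup_{x\in K_{\mathbb C}^*}\alpha(Ax,x)=\sup_{x\in K_{\mathbb C}^*}\ \inf_{m_1,m_2\in\mathcal M}\phi(M_{m_1m_2})$$ $$\phantom{r_{\rm sp}(A)}=\inf_{x\in K_{\mathbb C}^*}\beta(Ax,x)=\inf_{x\in K_{\mathbb C}^*}\ \sup_{m_1,m_2\in\mathcal M}\Phi(M_{m_1m_2}).$$ The extremal value is realized for the leading eigenvector $x=h\in K_{\mathbb C}^*$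 of $A$.
   Context: $X_{\mathbb R}$ is a real Banach space, $X_{\mathbb R}\ne\{0\}$, and $X=X_{\mathbb R}\oplus iX_{\mathbb R}$ is a complexification of it (a complex Banach space containing $X_{\mathbb R}$ as a closed real subspace with the restricted norm). $X'_{\mathbb R}$, $X'$ are the topological duals, $\langle\cdot,\cdot\rangle$ the canonical (bilinear) dualities, and real functionals are extended complex-linearly to $X$. An $\mathbb R$-cone $K_{\mathbb R}$ in $X_{\mathbb R}$ is a closed subset with $K_{\mathbb R}+K_{\mathbb R}=K_{\mathbb R}$, $\mathbb R_+K_{\mathbb R}=K_{\mathbb R}$, $K_{\mathbb R}\cap -K_{\mathbb R}=\{0\}$. Its dual cone is $K'_{\mathbb R}=\{\ell\in X'_{\mathbb R}:\langle\ell,x\rangle\ge 0\ \forall x\in K_{\mathbb R}\}$. Its canonical complexification and the complexified dual cone are $$K_{\mathbb C}=\{x\in X:\operatorname{Re}\langle\ell_1,x\rangle\overline{\langle\ell_2,x\rangle}\ge 0\ \ \forall\ell_1,\ell_2\in K'_{\mathbb R}\},\qquad K'_{\mathbb C}=\{\mu\in X':\operatorname{Re}\langle\mu,x_1\rangle\overline{\langle\mu,x_2\rangle}\ge 0\ \ \forall x_1,x_2\in K_{\mathbb R}\}.$$ A superscript $*$ on a cone denotes removal of the zero vector. For a set $S$, $\mathbb R_+(S)$ is the set of finite sums $\sum t_ku_k$, $t_k\ge 0$, $u_k\in S$. A generating set $\mathcal E$ for $K_{\mathbb R}$ is a subset of $K_{\mathbb R}^*$ with $K_{\mathbb R}=\overline{\mathbb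 R_+(\mathcal E)}$; it is Archimedian if for every $x\in K_{\mathbb R}^*$ there are $e\in\mathcal E$ and $t>0$ with $x-te\in K_{\mathbb R}$. A weak-$*$ generating set $\mathcal M$ for $K'_{\mathbb R}$ is a subset of $K'_{\mathbb R}\setminus\{0\}$ such that for every $\mu\in K'_{\mathbb R}$, all $y_1,\dots,y_p\in X$ and $\epsilon>0$ there is $\ell\in\mathbb R_+(\mathcal M)$ with $|\langle\ell,y_k\rangle-\langle\mu,y_k\rangle|<\epsilon$, $k=1,\dots,p$. $K_{\mathbb R}$ is of $\kappa$-bounded sectional aperture if for every two-dimensional plane $V=\operatorname{Span}\{x,y\}\subset X_{\mathbb R}$ there is a real linear functional $m$ of norm one with $\|\xi\|\le\kappa\langle m,\xi\rangle$ for all $\xi\in K_{\mathbb R}\cap V$. $K_{\mathbb R}$ is reproducing if there is $g<+\infty$ such that every $x\in X_{\mathbb R}$ can be written $x=y_1-y_2$ with $y_1,y_2\in K_{\mathbb R}$, $\|y_1\|+\|y_2\|\le g\|x\|$. For $x,y\in K_{\mathbb C}^*$ write $x\succeq y$ (equivalently $y\preceq x$) iff $|\langle\mu,x\rangle|\ge|\langle\mu,y\rangle|$ for all $\mu\in K'_{\mathbb C}$; $\alpha(x,y)=\sup\{t\ge0:x\succeq ty\}$ and $\beta(x,y)=\inf\{t\ge0:x\preceq ty\}$, with $\inf\emptyset=+\infty$. $\Gamma_+(\theta)$ is the set of $\begin{pmatrix}a&b\\c&d\end{pmatrix}\in M_2(\mathbb C)$ with $|ad-bc|<\operatorname{Re}(a\bar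 d+b\bar c)$, $\operatorname{Re}a\bar b,\operatorname{Re}a\bar c,\operatorname{Re}b\bar d,\operatorname{Re}c\bar d>0$ and $\frac{|ad-bc|}{\operatorname{Re}(a\bar d+b\bar c)}\le\theta$. The maps $\Phi,\phi$ with values in $[0,+\infty]$ are defined on complex matrices $M=\begin{pmatrix}a&b\\c&d\end{pmatrix}$ with $\operatorname{Re}a\bar b\ge0$, $\operatorname{Re}c\bar d\ge0$ by: if $\operatorname{rank}M=2$, $$\Phi(M)=\frac{|a\bar d+b\bar c|+|ad-bc|}{2\operatorname{Re}c\bar d},\qquad \phi(M)=\frac{2\operatorname{Re}a\bar b}{|a\bar d+b\bar c|+|ad-bc|};$$ if $\operatorname{rank}M=1$, $\Phi(M)=\phi(M)=|a/c|$ (or $|b/d|$ if $a=c=0$); if $M=0$, $\Phi(M)=0$ and $\phi(M)=+\infty$; convention $k/0=+\infty$ for $k>0$. $r_{\rm sp}$ is the spectral radius. Under the hypotheses $A$ has a spectral gap: a simple leading eigenvalue $\lambda\neq0$ with $|\lambda|=r_{\rm sp}(A)$ and one-dimensional spectral projection $P$ ($AP=PA=\lambda P$, $r_{\rm sp}(A-\lambda P)<|\lambda|$), given by $x\mapsto h\langle\nu,x\rangle$ with $h\in K_{\mathbb C}^*$, $\nu\in K'_{\mathbb C}$; the leading eigenvector is this $h$ (unique up to scaling), $Ah=\lambda h$. *)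

theory Defs
  imports "HOL-Analysis.Analysis"
begin

section \<open>Complex Banach spaces and complexifications\<close>

class complex_banach = banach +
  fixes scaleC :: "complex \<Rightarrow> 'a \<Rightarrow> 'a" (infixr \<open>*\<^sub>C\<close> 75)
  assumes scaleC_add_right: "c *\<^sub>C (x + y) = c *\<^sub>C x + c *\<^sub>C y"
    and scaleC_add_left: "(c + d) *\<^sub>C x = c *\<^sub>C x + d *\<^sub>C x"
    and scaleC_scaleC: "c *\<^sub>C d *\<^sub>C x = (c * d) *\<^sub>C x"
    and scaleC_of_real: "of_real r *\<^sub>C x = r *\<^sub>R x"
    and norm_scaleC: "norm (c *\<^sub>C x) = cmod c * norm x"

instantiation complex :: complex_banach
begin
definition scaleC_complex :: "complex \<Rightarrow> complex \<Rightarrow> complex"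
  where "scaleC_complex c x = c * x"
instance
  by standard (auto simp: scaleC_complex_def algebra_simps norm_mult scaleR_conv_of_real)
end

text \<open>Bounded complex-linear maps; for codomain \<open>complex\<close> these are the elements of the
  dual of \<open>'a\<close>.\<close>

definition bounded_clinear :: "('a::complex_banach \<Rightarrow> 'b::complex_banach) \<Rightarrow> bool"
  where "bounded_clinear f \<longleftrightarrow> bounded_linear f \<and> (\<forall>c x. f (c *\<^sub>C x) = c *\<^sub>C f x)"

text \<open>\<open>'x\<close> is a complexification of the real Banach space \<open>'r\<close>, which is identified with the
  range of the isometric embedding \<open>j\<close>. That range is automatically closed, since \<open>'r\<close> is
  complete.\<close>

definition complexification :: "('r::banach \<Rightarrow> 'x::complex_banach) \<Rightarrow> bool"
  where "complexification j \<longleftrightarrow>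
    linear j \<and> (\<forall>u. norm (j u) = norm u) \<and>
    bij (\<lambda>(u, v). j u + \<i> *\<^sub>C j v)"

text \<open>Complex-linear extension of a real functional:
  \<open>l (u + \<i> v) = l u + \<i> * l v\<close> for \<open>u\<close>, \<open>v\<close> in the real space.\<close>

definition cext ::
    "('r::banach \<Rightarrow> 'x::complex_banach) \<Rightarrow> ('r \<Rightarrow>\<^sub>L real) \<Rightarrow> 'x \<Rightarrow> complex"
  where "cext j l x =
    (let (u, v) = inv (\<lambda>(u, v). j u + \<i> *\<^sub>C j v) x
     in Complex (blinfun_apply l u) (blinfun_apply l v))"

section \<open>Real cones, generating sets, and their complexifications\<close>

definition real_cone :: "'r::real_normed_vector set \<Rightarrow> bool"
  where "real_cone K \<longleftrightarrow>
    closed K \<and>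
    {x + y | x y. x \<in> K \<and> y \<in> K} = K \<and>
    {t *\<^sub>R x | t x. 0 \<le> t \<and> x \<in> K} = K \<and>
    K \<inter> uminus ` K = {0}"

definition dual_cone :: "'r::real_normed_vector set \<Rightarrow> ('r \<Rightarrow>\<^sub>L real) set"
  where "dual_cone K = {l. \<forall>x\<in>K. 0 \<le> blinfun_apply l x}"

definition complexified_cone ::
    "('r::banach \<Rightarrow> 'x::complex_banach) \<Rightarrow> 'r set \<Rightarrow> 'x set"
  where "complexified_cone j K =
    {x. \<forall>l1\<in>dual_cone K. \<forall>l2\<in>dual_cone K. 0 \<le> Re (cext j l1 x * cnj (cext j l2 x))}"

definition complexified_dual_cone ::
    "('r::banach \<Rightarrow> 'x::complex_banach) \<Rightarrow> 'r set \<Rightarrow> ('x \<Rightarrow> complex) set"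
  where "complexified_dual_cone j K =
    {\<mu>. bounded_clinear \<mu> \<and> (\<forall>x1\<in>K. \<forall>x2\<in>K. 0 \<le> Re (\<mu> (j x1) * cnj (\<mu> (j x2))))}"

text \<open>Finite nonnegative combinations of elements of \<open>S\<close>.\<close>

definition nonneg_span :: "'a::real_vector set \<Rightarrow> 'a set"
  where "nonneg_span S =
    {\<Sum>u\<in>F. t u *\<^sub>R u | F t. finite F \<and> F \<subseteq> S \<and> (\<forall>u\<in>F. 0 \<le> t u)}"

definition generating_set :: "'r::real_normed_vector set \<Rightarrow> 'r set \<Rightarrow> bool"
  where "generating_set K E \<longleftrightarrow> E \<subseteq> K - {0} \<and> K = closure (nonneg_span E)"

definition archimedean_generating_set :: "'r::real_normed_vector set \<Rightarrow> 'r set \<Rightarrow> bool"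
  where "archimedean_generating_set K E \<longleftrightarrow>
    generating_set K E \<and> (\<forall>x\<in>K - {0}. \<exists>e\<in>E. \<exists>t>0. x - t *\<^sub>R e \<in> K)"

definition weak_star_generating_set ::
    "('r::banach \<Rightarrow> 'x::complex_banach) \<Rightarrow> 'r set \<Rightarrow> ('r \<Rightarrow>\<^sub>L real) set \<Rightarrow> bool"
  where "weak_star_generating_set j K M \<longleftrightarrow>
    M \<subseteq> dual_cone K - {0} \<and>
    (\<forall>\<mu>\<in>dual_cone K. \<forall>Y. finite Y \<longrightarrow> (\<forall>\<epsilon>>0. \<exists>l\<in>nonneg_span M.
       \<forall>y\<in>Y. cmod (cext j l y - cext j \<mu> y) < \<epsilon>))"

definition bounded_sectional_aperture :: "real \<Rightarrow> 'r::real_normed_vector set \<Rightarrow> bool"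
  where "bounded_sectional_aperture \<kappa> K \<longleftrightarrow>
    (\<forall>x y. x \<noteq> y \<and> independent {x, y} \<longrightarrow>
      (\<exists>m :: 'r \<Rightarrow>\<^sub>L real. norm m = 1 \<and>
         (\<forall>\<xi>\<in>K \<inter> span {x, y}. norm \<xi> \<le> \<kappa> * blinfun_apply m \<xi>)))"

definition reproducing :: "'r::real_normed_vector set \<Rightarrow> bool"
  where "reproducing K \<longleftrightarrow>
    (\<exists>g::real. \<forall>x. \<exists>y1\<in>K. \<exists>y2\<in>K. x = y1 - y2 \<and> norm y1 + norm y2 \<le> g * norm x)"

section \<open>The order on the complex cone and its gauges\<close>

definition dominates ::
    "('r::banach \<Rightarrow> 'x::complex_banach) \<Rightarrow> 'r set \<Rightarrow> 'x \<Rightarrow> 'x \<Rightarrow> bool"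
  where "dominates j K x y \<longleftrightarrow> (\<forall>\<mu>\<in>complexified_dual_cone j K. cmod (\<mu> y) \<le> cmod (\<mu> x))"

definition alpha ::
    "('r::banach \<Rightarrow> 'x::complex_banach) \<Rightarrow> 'r set \<Rightarrow> 'x \<Rightarrow> 'x \<Rightarrow> ennreal"
  where "alpha j K x y = Sup {ennreal t | t. 0 \<le> t \<and> dominates j K x (t *\<^sub>R y)}"

definition beta ::
    "('r::banach \<Rightarrow> 'x::complex_banach) \<Rightarrow> 'r set \<Rightarrow> 'x \<Rightarrow> 'x \<Rightarrow> ennreal"
  where "beta j K x y = Inf {ennreal t | t. 0 \<le> t \<and> dominates j K (t *\<^sub>R y) x}"

section \<open>Complex two-by-two matrices\<close>

definition mat2 :: "complex \<Rightarrow> complex \<Rightarrow> complex \<Rightarrow> complex \<Rightarrow> complex^2^2"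
  where "mat2 a b c d = vector [vector [a, b], vector [c, d]]"

definition Gamma_plus :: "real \<Rightarrow> (complex^2^2) set"
  where "Gamma_plus \<theta> = {mat2 a b c d | a b c d.
    cmod (a * d - b * c) < Re (a * cnj d + b * cnj c) \<and>
    0 < Re (a * cnj b) \<and> 0 < Re (a * cnj c) \<and> 0 < Re (b * cnj d) \<and> 0 < Re (c * cnj d) \<and>
    cmod (a * d - b * c) / Re (a * cnj d + b * cnj c) \<le> \<theta>}"

text \<open>The functions \<open>Phi\<close> and \<open>phi\<close> are only meant for matrices with
  \<open>Re (a * cnj b) \<ge> 0\<close> and \<open>Re (c * cnj d) \<ge> 0\<close>. Division is that of \<open>ennreal\<close>, so a positive
  number divided by zero is \<open>\<infinity>\<close>; the form \<open>0 / 0\<close> does not occur.\<close>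

definition Phi :: "complex^2^2 \<Rightarrow> ennreal"
  where "Phi M =
    (let a = M $ 1 $ 1; b = M $ 1 $ 2; c = M $ 2 $ 1; d = M $ 2 $ 2 in
     if rank M = 2 then
       ennreal (cmod (a * cnj d + b * cnj c) + cmod (a * d - b * c)) / ennreal (2 * Re (c * cnj d))
     else if rank M = 1 then
       (if a = 0 \<and> c = 0 then ennreal (cmod b) / ennreal (cmod d)
        else ennreal (cmod a) / ennreal (cmod c))
     else 0)"

definition phi :: "complex^2^2 \<Rightarrow> ennreal"
  where "phi M =
    (let a = M $ 1 $ 1; b = M $ 1 $ 2; c = M $ 2 $ 1; d = M $ 2 $ 2 in
     if rank M = 2 then
       ennreal (2 * Re (a * cnj b)) / ennreal (cmod (a * cnj d + b * cnj c) + cmod (a * d - b * c))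
     else if rank M = 1 then
       (if a = 0 \<and> c = 0 then ennreal (cmod b) / ennreal (cmod d)
        else ennreal (cmod a) / ennreal (cmod c))
     else \<infinity>)"

definition T_matrices ::
    "('r::banach \<Rightarrow> 'x::complex_banach) \<Rightarrow> 'r set \<Rightarrow> ('r \<Rightarrow>\<^sub>L real) set \<Rightarrow> ('x \<Rightarrow> 'x) \<Rightarrow> (complex^2^2) set"
  where "T_matrices j E M A =
    {mat2 (cext j m1 (A (j e1))) (cext j m2 (A (j e1)))
          (cext j m1 (A (j e2))) (cext j m2 (A (j e2)))
     | e1 e2 m1 m2. e1 \<in> E \<and> e2 \<in> E \<and> m1 \<in> M \<and> m2 \<in> M}"

definition quotient_matrix ::
    "('r::banach \<Rightarrow> 'x::complex_banach) \<Rightarrow> ('x \<Rightarrow> 'x) \<Rightarrow> ('r \<Rightarrow>\<^sub>L real) \<Rightarrow> ('r \<Rightarrow>\<^sub>L real) \<Rightarrow> 'x \<Rightarrow> complex^2^2"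
  where "quotient_matrix j A m1 m2 x =
    mat2 (cext j m1 (A x)) (cext j m2 (A x))
         (cext j m1 x)     (cext j m2 x)"

section \<open>Spectral notions\<close>

definition spectrum_op :: "('x::complex_banach \<Rightarrow> 'x) \<Rightarrow> complex set"
  where "spectrum_op A = {z. \<not> (\<exists>B. bounded_clinear B \<and>
    (\<forall>x. B (A x - z *\<^sub>C x) = x) \<and> (\<forall>x. A (B x) - z *\<^sub>C B x = x))}"

text \<open>For a bounded operator on a nonzero space the spectrum is nonempty and bounded, so the
  supremum is meaningful.\<close>

definition spectral_radius_op :: "('x::complex_banach \<Rightarrow> 'x) \<Rightarrow> real"
  where "spectral_radius_op A = Sup (cmod ` spectrum_op A)"

text \<open>\<open>h\<close> is a leading eigenvector for the leading eigenvalue \<open>lam\<close> of an operator with a spectral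
  gap: \<open>P x = \<langle>\<nu>, x\<rangle> h\<close> is the one-dimensional spectral projection (the condition \<open>\<nu> h = 1\<close> says
  that \<open>P\<close> is a nonzero projection), it satisfies \<open>A P = P A = lam P\<close>, and \<open>A - lam P\<close> has strictly
  smaller spectral radius. Given \<open>A\<close>, \<open>lam\<close> and \<open>P\<close> this fixes \<open>h\<close> up to a nonzero complex factor.\<close>

definition leading_eigendata ::
    "('r::banach \<Rightarrow> 'x::complex_banach) \<Rightarrow> 'r set \<Rightarrow> ('x \<Rightarrow> 'x) \<Rightarrow> complex \<Rightarrow> 'x \<Rightarrow> ('x \<Rightarrow> complex) \<Rightarrow> bool"
  where "leading_eigendata j K A lam h \<nu> \<longleftrightarrow>
    lam \<noteq> 0 \<and> cmod lam = spectral_radius_op A \<and>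
    h \<in> complexified_cone j K - {0} \<and> \<nu> \<in> complexified_dual_cone j K \<and> \<nu> h = 1 \<and>
    A h = lam *\<^sub>C h \<and>
    (let P = (\<lambda>x. \<nu> x *\<^sub>C h) in
      (\<forall>x. A (P x) = lam *\<^sub>C P x) \<and> (\<forall>x. P (A x) = lam *\<^sub>C P x) \<and>
      spectral_radius_op (\<lambda>x. A x - lam *\<^sub>C P x) < cmod lam)"

end

theory Submission
  imports Defs
begin

text \<open>The argument is Birkhoff's proof of the Perron--Frobenius theorem, carried out for the complex
  order given by \<open>\<bar>\<mu> x\<bar> \<ge> \<bar>\<mu> y\<bar>\<close>.

  The set of values that the real dual cone takes at a vector of the complexified cone lies within a
  right angle. Rotating it onto the first quadrant shows that the complexified cone consists of the
  complex multiples of \<open>u + \<i> v\<close> with \<open>u\<close>, \<open>v\<close> in the real cone (\<open>Kc_cases\<close>); likewise the functionals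
  \<open>p + \<i> q\<close> with \<open>p\<close>, \<open>q\<close> in the dual cone suffice on the dual side.

  The bound defining \<open>Gamma_plus\<close> reads \<open>\<bar>D\<bar> \<le> \<theta> Re w\<close> with \<open>D\<close> and \<open>w\<close> real-linear in each of the
  two vectors and two functionals. It therefore passes from generators to the whole cones
  (\<open>matrix_bound\<close>). It bounds a pseudo-hyperbolic distance in the right half plane, and so yields
  that \<open>\<bar>\<mu> (A x)\<bar>\<close> is, up to a constant factor, a product of a function of \<open>\<mu>\<close> and a function of \<open>x\<close>
  (\<open>rank_one_comparison\<close>). Hence cross ratios of the values of functionals on the image of \<open>A\<close> are
  bounded. Suppose that the quotients \<open>\<bar>\<mu> x\<bar> / \<bar>\<mu> y\<bar>\<close> lie in \<open>[a, b]\<close>. Then \<open>x - z y\<close> belongs to the cone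
  whenever \<open>\<bar>z\<bar>\<close> is outside \<open>[a, b]\<close>, and the cross ratio bound for two such pencils shrinks
  \<open>b - a\<close> by a fixed factor when \<open>A\<close> is applied (\<open>in_annulus_contraction\<close>).

  A small value of \<open>b - a\<close> means closeness in norm (\<open>in_annulus_norm_bound\<close>): sectional aperture makes
  the real cone normal, and the dual cone determines its order by Hahn--Banach. So normalised orbits
  converge geometrically to an eigenvector \<open>h\<close>, and comparing any orbit with that of \<open>h\<close> produces the
  eigenfunctional \<open>\<nu>\<close>, which has no zero on the cone apart from the origin, together with the
  spectral gap (\<open>leading_eigenvector\<close>).

  The variational formulas then follow by evaluating \<open>\<nu>\<close>. If \<open>A x\<close> dominates \<open>t x\<close>, or is dominated by it,
  the number \<open>\<nu> (A x) = lam * \<nu> x\<close> compares \<open>t\<close> with \<open>\<bar>lam\<bar>\<close>. For each pair \<open>m1\<close>, \<open>m2\<close>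
  the numbers \<open>\<phi>\<close> and \<open>\<Phi>\<close> are the roots of a quadratic polynomial; its sign decides whether \<open>A x - z x\<close> lies in the cone
  (\<open>pencil_by_quotient_matrices\<close>). Were \<open>\<bar>lam\<bar>\<close> below the infimum of \<open>\<phi>\<close> or above the supremum of \<open>\<Phi>\<close>, the
  choice \<open>z = lam\<close> would give a vector of the cone annihilated by \<open>\<nu>\<close>; it vanishes, so \<open>x\<close> is an
  eigenvector, for which both extrema equal \<open>\<bar>lam\<bar>\<close>.\<close>

section \<open>Separation from a closed cone\<close>

definition sublinear :: "('a::real_vector \<Rightarrow> real) \<Rightarrow> bool"
  where "sublinear q \<longleftrightarrow> q 0 = 0 \<and> (\<forall>x y. q (x + y) \<le> q x + q y) \<and> (\<forall>t>0. \<forall>x. q (t *\<^sub>R x) \<le> t * q x)"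

lemma sublinearD:
  assumes "sublinear q"
  shows "q 0 = 0" "q (x + y) \<le> q x + q y" "0 \<le> t \<Longrightarrow> q (t *\<^sub>R x) = t * q x" "- q (- x) \<le> q x"
proof -
  show 0: "q 0 = 0" and add: "q (x + y) \<le> q x + q y" for x y
    using assms by (auto simp: sublinear_def)
  have le: "q (t *\<^sub>R x) \<le> t * q x" if "0 < t" for t x
    using assms that by (auto simp: sublinear_def)
  show "q (t *\<^sub>R x) = t * q x" if "0 \<le> t" for t x
  proof (cases "t = 0")
    case False
    with that have t: "0 < t" by simp
    have "q x \<le> inverse t * q (t *\<^sub>R x)"
      using le[of "inverse t" "t *\<^sub>R x"] t by simp
    hence "t * q x \<le> q (t *\<^sub>R x)" using t by (simp add: field_simps)
    with le[OF t, of x] show ?thesis by simp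
  qed (simp add: 0)
  show "- q (- x) \<le> q x" using add[of x "- x"] 0 by simp
qed

text \<open>A minimal sublinear functional coincides with its lowering in every direction \<open>y\<close>. The choice \<open>t = 1\<close>
  then shows that it is superadditive, hence linear.\<close>

lemma sublinear_lower:
  fixes q :: "'a::real_vector \<Rightarrow> real"
  assumes q: "sublinear q"
  defines "q' \<equiv> \<lambda>y x. INF t\<in>{0..}. q (x + t *\<^sub>R y) - t * q y"
  shows "sublinear (q' y)" "\<And>t. 0 \<le> t \<Longrightarrow> q' y x \<le> q (x + t *\<^sub>R y) - t * q y"
proof -
  note Q = sublinearD[OF q]
  have lb: "- q (- x) \<le> q (x + t *\<^sub>R y) - t * q y" if "0 \<le> t" for t x
    using Q(2)[of "x + t *\<^sub>R y" "- x"] Q(3)[OF that, of y] by simp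
  have bdd: "bdd_below ((\<lambda>t. q (x + t *\<^sub>R y) - t * q y) ` {0..})" for x
    by (rule bdd_belowI2[where m = "- q (- x)"]) (use lb in auto)
  show up: "q' y x \<le> q (x + t *\<^sub>R y) - t * q y" if "0 \<le> t" for t x
    unfolding q'_def by (rule cINF_lower[OF bdd]) (use that in auto)
  have greatest: "c \<le> q' y x" if "\<And>t. 0 \<le> t \<Longrightarrow> c \<le> q (x + t *\<^sub>R y) - t * q y" for c x
    unfolding q'_def by (rule cINF_greatest) (use that in auto)
  have "q' y 0 = 0"
  proof (rule antisym)
    show "q' y 0 \<le> 0" using up[of 0 0] Q(1) by simp
    show "0 \<le> q' y 0" by (rule greatest) (simp add: Q(3))
  qed
  moreover have "q' y (x + x') \<le> q' y x + q' y x'" for x x'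
  proof -
    have "q' y (x + x') - (q (x + t *\<^sub>R y) - t * q y) \<le> q (x' + s *\<^sub>R y) - s * q y"
      if "0 \<le> t" "0 \<le> s" for s t
      using up[of "t + s" "x + x'"] that Q(2)[of "x + t *\<^sub>R y" "x' + s *\<^sub>R y"]
      by (simp add: algebra_simps)
    hence "q' y (x + x') - (q (x + t *\<^sub>R y) - t * q y) \<le> q' y x'" if "0 \<le> t" for t
      using that by (intro greatest)
    hence "q' y (x + x') - q' y x' \<le> q (x + t *\<^sub>R y) - t * q y" if "0 \<le> t" for t
      using that by (smt (verit))
    hence "q' y (x + x') - q' y x' \<le> q' y x" by (intro greatest)
    thus ?thesis by simp
  qed
  moreover have "q' y (c *\<^sub>R x) \<le> c * q' y x" if c: "0 < c" for c x
  proof -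
    have "q' y (c *\<^sub>R x) / c \<le> q (x + t *\<^sub>R y) - t * q y" if "0 \<le> t" for t
    proof -
      have "q' y (c *\<^sub>R x) \<le> q (c *\<^sub>R (x + t *\<^sub>R y)) - (c * t) * q y"
        using up[of "c * t" "c *\<^sub>R x"] that c by (simp add: algebra_simps)
      also have "\<dots> = c * (q (x + t *\<^sub>R y) - t * q y)"
        by (subst Q(3)) (use c in \<open>auto simp: algebra_simps\<close>)
      finally show ?thesis using c by (simp add: field_simps)
    qed
    hence "q' y (c *\<^sub>R x) / c \<le> q' y x" by (rule greatest)
    thus ?thesis using c by (simp add: field_simps)
  qed
  ultimately show "sublinear (q' y)" by (simp add: sublinear_def)
qed

text \<open>Zorn's lemma applies because the pointwise infimum of a chain is sublinear; it is finite since
  \<open>- p (- x)\<close> is a common lower bound.\<close>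

lemma minimal_sublinear_below:
  fixes p :: "'a::real_vector \<Rightarrow> real"
  assumes p: "sublinear p"
  obtains l where "sublinear l" "l \<le> p" "\<And>q. sublinear q \<Longrightarrow> q \<le> l \<Longrightarrow> q = l"
proof -
  define S where "S = {q. sublinear q \<and> q \<le> p}"
  have "\<exists>l\<in>S. \<forall>q\<in>S. q \<le> l \<longrightarrow> q = l"
  proof (rule predicate_Zorn)
    show "partial_order_on S (relation_of (\<lambda>a b. b \<le> a) S)"
      by (rule partial_order_on_relation_ofI) auto
    fix C assume C: "C \<in> Chains (relation_of (\<lambda>a b. b \<le> a) S)"
    show "\<exists>u\<in>S. \<forall>a\<in>C. u \<le> a"
    proof (cases "C = {}")
      case True
      thus ?thesis using p by (auto simp: S_def)
    next
      case False
      have CS: "sublinear q" "q \<le> p" if "q \<in> C" for q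
        using C that by (auto simp: Chains_def relation_of_def S_def)
      have chain: "q \<le> r \<or> r \<le> q" if "q \<in> C" "r \<in> C" for q r
        using C that by (auto simp: Chains_def relation_of_def)
      define u where "u = (\<lambda>x. INF q\<in>C. q x)"
      have bdd: "bdd_below ((\<lambda>q. q x) ` C)" for x
      proof (rule bdd_belowI2[where m = "- p (- x)"])
        fix q assume "q \<in> C"
        thus "- p (- x) \<le> q x"
          using sublinearD(4)[OF CS(1), of q x] CS(2)[of q] by (smt (verit) le_funD)
      qed
      have low: "u x \<le> q x" if "q \<in> C" for q x
        unfolding u_def by (rule cINF_lower[OF bdd that])
      have great: "c \<le> u x" if "\<And>q. q \<in> C \<Longrightarrow> c \<le> q x" for c x
        unfolding u_def by (rule cINF_greatest[OF False that])
      have "(INF q\<in>C. q 0) = (INF q\<in>C. 0)" by (rule INF_cong) (auto simp: sublinearD(1)[OF CS(1)])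
      hence "u 0 = 0" using False by (simp add: u_def)
      moreover have "u (x + y) \<le> u x + u y" for x y
      proof -
        have "u (x + y) \<le> q x + r y" if "q \<in> C" "r \<in> C" for q r
          using chain[OF that] low[OF that(1), of "x + y"] low[OF that(2), of "x + y"]
            sublinearD(2)[OF CS(1)[OF that(1)], of x y] sublinearD(2)[OF CS(1)[OF that(2)], of x y]
          by (auto simp: le_fun_def) (smt (verit))+
        hence "u (x + y) - q x \<le> u y" if "q \<in> C" for q
          using that by (intro great) (smt (verit))
        hence "u (x + y) - u y \<le> u x" by (intro great) (smt (verit))
        thus ?thesis by simp
      qed
      moreover have "u (t *\<^sub>R x) \<le> t * u x" if "0 < t" for t x
      proof -
        have "u (t *\<^sub>R x) / t \<le> u x"
        proof (rule great)
          fix q assume q: "q \<in> C"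
          show "u (t *\<^sub>R x) / t \<le> q x"
            using low[OF q, of "t *\<^sub>R x"] sublinearD(3)[OF CS(1)[OF q], of t x] that
            by (simp add: field_simps)
        qed
        thus ?thesis using that by (simp add: field_simps)
      qed
      ultimately have "sublinear u" by (simp add: sublinear_def)
      moreover have "u \<le> p" using False low CS(2) by (meson ex_in_conv le_funI le_funD order_trans)
      ultimately show ?thesis using low by (auto simp: S_def le_fun_def)
    qed
  qed
  then obtain l where l: "l \<in> S" and min: "\<And>q. q \<in> S \<Longrightarrow> q \<le> l \<Longrightarrow> q = l" by blast
  show ?thesis
    by (rule that[of l]) (use l in \<open>auto simp: S_def intro!: min\<close>)
qed

text \<open>The functional is a minimal sublinear one below \<open>p\<close>. Lowering \<open>p\<close> in the direction \<open>x0\<close> first forces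
  \<open>l (- x0) \<le> - p x0\<close>, which makes the bound sharp at \<open>x0\<close>.\<close>

theorem Hahn_Banach_sublinear:
  fixes p :: "'a::real_vector \<Rightarrow> real"
  assumes p: "sublinear p"
  obtains l where "linear l" "\<And>x. l x \<le> p x" "l x0 = p x0"
proof -
  define p' where "p' = (\<lambda>x. INF t\<in>{0..}. p (x + t *\<^sub>R x0) - t * p x0)"
  have p': "sublinear p'" "p' x \<le> p (x + t *\<^sub>R x0) - t * p x0" if "0 \<le> t" for t x
    using sublinear_lower[OF p, where y = x0] that by (simp_all add: p'_def)
  obtain l where l: "sublinear l" "l \<le> p'" and min: "\<And>q. sublinear q \<Longrightarrow> q \<le> l \<Longrightarrow> q = l"
    using minimal_sublinear_below[OF p'(1)] by blast
  note L = sublinearD[OF l(1)]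
  have add: "l (x + y) = l x + l y" for x y
  proof -
    define l' where "l' = (\<lambda>x. INF t\<in>{0..}. l (x + t *\<^sub>R y) - t * l y)"
    have l': "sublinear l'" "l' x \<le> l (x + t *\<^sub>R y) - t * l y" if "0 \<le> t" for t x
      using sublinear_lower[OF l(1), where y = y] that by (simp_all add: l'_def)
    have "l' \<le> l" using l'(2)[of 0] by (simp add: le_fun_def)
    hence "l' = l" using min l'(1)[of 0] by simp
    with l'(2)[of 1 x] L(2)[of x y] show ?thesis by simp
  qed
  have neg: "l (- x) = - l x" for x using add[of x "- x"] L(1) by simp
  have lin: "linear l"
  proof (rule linearI)
    show "l (t *\<^sub>R x) = t *\<^sub>R l x" for t x
    proof (cases "0 \<le> t")
      case False
      thus ?thesis using L(3)[where t = "- t" and x = x] neg[of "t *\<^sub>R x"] by simp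
    qed (simp add: L(3))
  qed (rule add)
  have le: "l x \<le> p x" for x
    using l(2) p'(2)[of 0 x] by (auto simp: le_fun_def intro: order_trans)
  have "l (- x0) \<le> - p x0"
    using l(2) p'(2)[of 1 "- x0"] sublinearD(1)[OF p] by (auto simp: le_fun_def intro: order_trans)
  hence "l x0 = p x0" using neg[of x0] le[of x0] by simp
  with lin le that show ?thesis by blast
qed

lemma real_coneD:
  assumes "real_cone K"
  shows "closed K" "0 \<in> K" "x \<in> K \<Longrightarrow> y \<in> K \<Longrightarrow> x + y \<in> K" "0 \<le> t \<Longrightarrow> x \<in> K \<Longrightarrow> t *\<^sub>R x \<in> K"
    "x \<in> K \<Longrightarrow> - x \<in> K \<Longrightarrow> x = 0"
proof -
  from assms have c: "closed K" and a: "{x + y | x y. x \<in> K \<and> y \<in> K} = K"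
    and s: "{t *\<^sub>R x | t x. 0 \<le> t \<and> x \<in> K} = K" and z: "K \<inter> uminus ` K = {0}"
    by (auto simp only: real_cone_def)
  show "closed K" by (rule c)
  show "0 \<in> K" using z by blast
  show "x \<in> K \<Longrightarrow> y \<in> K \<Longrightarrow> x + y \<in> K" using a by blast
  show "0 \<le> t \<Longrightarrow> x \<in> K \<Longrightarrow> t *\<^sub>R x \<in> K" using s by blast
  show "x = 0" if "x \<in> K" "- x \<in> K"
  proof -
    have "x \<in> K \<inter> uminus ` K" using that by (metis IntI image_eqI minus_minus)
    thus ?thesis using z by blast
  qed
qed

text \<open>The distance of \<open>- y\<close> from \<open>K\<close> is a sublinear function of \<open>y\<close> that is zero on \<open>- K\<close> and positive
  at \<open>- x\<close>. A linear functional below it and equal to it at \<open>- x\<close> separates.\<close>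

theorem real_cone_separation:
  fixes K :: "'a::real_normed_vector set"
  assumes K: "real_cone K" and x: "x \<notin> K"
  obtains l where "l \<in> dual_cone K" "blinfun_apply l x < 0"
proof -
  note C = real_coneD[OF K]
  define p where "p = (\<lambda>y. infdist (- y) K)"
  have near: "\<exists>k\<in>K. norm (z - k) < infdist z K + e" if "0 < e" for z and e :: real
  proof (rule ccontr)
    assume "\<not> ?thesis"
    hence "infdist z K + e \<le> dist z k" if "k \<in> K" for k
      using that by (force simp: dist_norm not_less)
    hence "infdist z K + e \<le> (INF k\<in>K. dist z k)"
      using C(2) by (intro cINF_greatest) auto
    hence "infdist z K + e \<le> infdist z K"
      using C(2) infdist_notempty[of K z] by force
    with that show False by simp
  qed
  have le: "infdist z K \<le> norm (z - k)" if "k \<in> K" for z k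
    using infdist_le[OF that, of z] by (simp add: dist_norm)
  have "sublinear p"
    unfolding sublinear_def
  proof (intro conjI allI impI)
    show "p 0 = 0" using C(2) by (simp add: p_def)
    show "p (y + z) \<le> p y + p z" for y z
    proof (rule field_le_epsilon)
      fix e :: real assume e: "0 < e"
      obtain k k' where k: "k \<in> K" "k' \<in> K" "norm (- y - k) < p y + e / 2" "norm (- z - k') < p z + e / 2"
        using near[of "e / 2" "- y"] near[of "e / 2" "- z"] e by (auto simp: p_def)
      have "p (y + z) \<le> norm ((- y - k) + (- z - k'))"
        using le[OF C(3)[OF k(1,2)], of "- (y + z)"] by (simp add: p_def algebra_simps)
      also have "\<dots> \<le> norm (- y - k) + norm (- z - k')" by (rule norm_triangle_ineq)
      finally show "p (y + z) \<le> p y + p z + e" using k by simp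
    qed
    show "p (t *\<^sub>R y) \<le> t * p y" if t: "0 < t" for t y
    proof (rule field_le_epsilon)
      fix e :: real assume e: "0 < e"
      obtain k where k: "k \<in> K" "norm (- y - k) < p y + e / t"
        using near[of "e / t" "- y"] e t by (auto simp: p_def)
      have "p (t *\<^sub>R y) \<le> norm (t *\<^sub>R (- y - k))"
        using le[OF C(4)[OF _ k(1), of t], of "- (t *\<^sub>R y)"] t by (simp add: p_def algebra_simps)
      also have "\<dots> = t * norm (- y - k)" using t by simp
      also have "\<dots> \<le> t * (p y + e / t)" using k t by (intro mult_left_mono) auto
      finally show "p (t *\<^sub>R y) \<le> t * p y + e" using t by (simp add: algebra_simps)
    qed
  qed
  then obtain l where l: "linear l" "\<And>y. l y \<le> p y" "l (- x) = p (- x)"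
    using Hahn_Banach_sublinear by blast
  interpret l: linear l by (rule l(1))
  have pn: "p y \<le> norm y" for y using le[OF C(2), of "- y"] by (simp add: p_def)
  have "norm (l y) \<le> norm y * 1" for y
    using l(2)[of y] l(2)[of "- y"] pn[of y] pn[of "- y"] l.neg[of y] by (simp add: abs_le_iff)
  hence bl: "bounded_linear l"
    by (intro bounded_linear_intro[where K = 1]) (auto simp: l.add l.scaleR)
  have "0 < p (- x)"
    using x C(1,2) in_closed_iff_infdist_zero[OF C(1), of x] infdist_nonneg[of x K]
    by (auto simp: p_def less_le)
  hence "l x < 0" using l(3) l.neg[of x] by simp
  moreover have "0 \<le> l k" if "k \<in> K" for k
    using l(2)[of "- k"] that l.neg[of k] by (simp add: p_def)
  ultimately show ?thesis
    by (intro that[of "Blinfun l"]) (auto simp: dual_cone_def bounded_linear_Blinfun_apply[OF bl])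
qed

section \<open>The open mapping theorem\<close>

text \<open>By Baire's theorem the closure of the image of some ball has an interior point, so every \<open>x\<close> has an
  approximate preimage of comparable norm that leaves at most half of \<open>x\<close> over. Summing the
  preimages of the successive remainders gives an exact one.\<close>

theorem bounded_linear_surj_bounded_preimages:
  fixes T :: "'a::banach \<Rightarrow> 'b::banach"
  assumes T: "bounded_linear T" and surj: "surj T"
  obtains D where "0 < D" "\<And>x. \<exists>y. T y = x \<and> norm y \<le> D * norm x"
proof -
  interpret T: bounded_linear T by (rule T)
  define F where "F n = closure (T ` cball 0 (real n))" for n
  have "\<Union>(range F) = UNIV"
  proof -
    have "x \<in> \<Union>(range F)" for x
    proof -
      obtain y where "x = T y" using surj by (metis surjD)
      moreover obtain n where "norm y \<le> real n" using real_arch_simple by blast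
      ultimately have "x \<in> F n" unfolding F_def by (intro closure_subset[THEN subsetD]) auto
      thus ?thesis by blast
    qed
    thus ?thesis by blast
  qed
  moreover have "interior (\<Union>(range F)) = {}" if "\<And>n. interior (F n) = {}"
  proof -
    have "Met_TC.mtopology interior_of (\<Union>(range F)) = {}"
    proof (rule Met_TC.metric_Baire_category_alt)
      show "Met_TC.mcomplete TYPE('b)" by (simp only: mcomplete_iff_complete complete_UNIV)
    qed (use that in \<open>auto simp: F_def\<close>)
    thus ?thesis by (simp only: mtopology_is_euclidean euclidean_interior_of)
  qed
  ultimately obtain n where "interior (F n) \<noteq> {}" by (metis UNIV_not_empty interior_UNIV)
  then obtain x0 r where r: "0 < r" "ball x0 r \<subseteq> F n"
    by (meson all_not_in_conv mem_interior)
  have appr: "\<exists>y. norm (x - T y) < e \<and> norm y \<le> real n" if "x \<in> F n" "0 < e" for x e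
    using that unfolding F_def closure_approachable by (fastforce simp: dist_norm norm_minus_commute)
  have small: "\<exists>y. norm (z - T y) < e \<and> norm y \<le> 2 * real n" if z: "norm z < r" and e: "0 < e" for z e
  proof -
    have "x0 + z \<in> F n" "x0 \<in> F n" using r z by (auto simp: subset_iff dist_norm)
    then obtain y y' where y: "norm (x0 + z - T y) < e / 2" "norm y \<le> real n"
      "norm (x0 - T y') < e / 2" "norm y' \<le> real n"
      using appr[of "x0 + z" "e / 2"] appr[of x0 "e / 2"] e by auto
    have "norm (z - T (y - y')) = norm ((x0 + z - T y) - (x0 - T y'))" by (simp add: T.diff algebra_simps)
    also have "\<dots> \<le> norm (x0 + z - T y) + norm (x0 - T y')" by (rule norm_triangle_ineq4)
    finally have "norm (z - T (y - y')) < e" using y by simp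
    moreover have "norm (y - y') \<le> 2 * real n" using norm_triangle_ineq4[of y y'] y by simp
    ultimately show ?thesis by blast
  qed
  define c where "c = 4 * (real n + 1) / r"
  have c: "0 < c" using r by (simp add: c_def)
  have half: "\<exists>y. norm (x - T y) \<le> norm x / 2 \<and> norm y \<le> c * norm x" for x
  proof (cases "x = 0")
    case True
    thus ?thesis by (intro exI[of _ 0]) simp
  next
    case False
    define k where "k = r / (2 * norm x)"
    have k: "0 < k" "norm (k *\<^sub>R x) < r" using False r by (auto simp: k_def)
    obtain y where y: "norm (k *\<^sub>R x - T y) < k * norm x / 2" "norm y \<le> 2 * real n"
      using small[OF k(2), of "k * norm x / 2"] k False by auto
    have "norm (x - T (inverse k *\<^sub>R y)) = inverse k * norm (k *\<^sub>R x - T y)"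
    proof -
      have "x - T (inverse k *\<^sub>R y) = inverse k *\<^sub>R (k *\<^sub>R x - T y)"
        using k by (simp add: T.scaleR algebra_simps)
      thus ?thesis using k by simp
    qed
    also have "\<dots> \<le> norm x / 2" using y k by (simp add: field_simps)
    finally have "norm (x - T (inverse k *\<^sub>R y)) \<le> norm x / 2" .
    moreover have "norm (inverse k *\<^sub>R y) \<le> c * norm x"
    proof -
      have "norm (inverse k *\<^sub>R y) = inverse k * norm y" using k by simp
      also have "\<dots> \<le> inverse k * (2 * (real n + 1))" using y k by (intro mult_left_mono) auto
      also have "\<dots> = c * norm x" using False r by (simp add: k_def c_def field_simps)
      finally show ?thesis .
    qed
    ultimately show ?thesis by blast
  qed
  then obtain s where s: "norm (x - T (s x)) \<le> norm x / 2" "norm (s x) \<le> c * norm x" for x by metis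
  have "\<exists>y. T y = x \<and> norm y \<le> (2 * c) * norm x" for x
  proof -
    define X where "X n = ((\<lambda>x. x - T (s x)) ^^ n) x" for n
    have X: "X 0 = x" "X (Suc n) = X n - T (s (X n))" for n by (auto simp: X_def)
    have nX: "norm (X n) \<le> norm x * (1 / 2) ^ n" for n
    proof (induction n)
      case (Suc n)
      thus ?case using s(1)[of "X n"] X(2)[of n] by simp
    qed (simp add: X)
    have ns: "norm (s (X n)) \<le> (c * norm x) * (1 / 2) ^ n" for n
      using s(2)[of "X n"] nX[of n] c by (smt (verit) mult.assoc mult_left_mono)
    have geo: "summable (\<lambda>n. (c * norm x) * (1 / 2) ^ n)" "(\<Sum>n. (c * norm x) * (1 / 2) ^ n) = 2 * c * norm x"
      using geometric_sums[of "1 / 2 :: real"] by (auto intro!: summable_mult simp: suminf_mult sums_iff)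
    have sumn: "summable (\<lambda>n. norm (s (X n)))" by (rule summable_comparison_test'[OF geo(1)]) (use ns in auto)
    hence sum: "summable (\<lambda>n. s (X n))" by (rule summable_norm_cancel)
    have "X \<longlonglongrightarrow> 0"
    proof (rule Lim_null_comparison)
      show "\<forall>\<^sub>F n in sequentially. norm (X n) \<le> norm x * (1 / 2) ^ n" using nX by simp
      show "(\<lambda>n. norm x * (1 / 2) ^ n) \<longlonglongrightarrow> 0"
        by (intro tendsto_mult_right_zero LIMSEQ_power_zero) simp
    qed
    hence "(\<lambda>n. X n - X (Suc n)) sums (X 0 - 0)" by (rule telescope_sums')
    hence "(\<lambda>n. T (s (X n))) sums x" by (simp add: X)
    moreover have "(\<lambda>n. T (s (X n))) sums T (\<Sum>n. s (X n))"
      by (rule T.sums[OF summable_sums[OF sum]])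
    ultimately have "T (\<Sum>n. s (X n)) = x" by (metis sums_unique2)
    moreover have "norm (\<Sum>n. s (X n)) \<le> (2 * c) * norm x"
      using summable_norm[OF sumn] suminf_le[OF ns sumn geo(1)] geo(2) by simp
    ultimately show ?thesis by blast
  qed
  with c show ?thesis by (intro that[of "2 * c"]) auto
qed

section \<open>Sets of complex numbers within a right angle\<close>

text \<open>The rotation takes the most clockwise direction to the positive real axis. Such a direction exists
  by compactness once the directions have been closed up, and relative to a fixed member \<open>a0\<close> all
  directions lie in the right half plane, where clockwise order is the order of imaginary parts.\<close>

lemma complex_right_angle_sector:
  fixes S :: "complex set"
  assumes S: "\<And>a b. a \<in> S \<Longrightarrow> b \<in> S \<Longrightarrow> 0 \<le> Re (a * cnj b)"
  obtains \<zeta> where "cmod \<zeta> = 1" "\<And>a. a \<in> S \<Longrightarrow> 0 \<le> Re (\<zeta> * a)" "\<And>a. a \<in> S \<Longrightarrow> 0 \<le> Im (\<zeta> * a)"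
proof (cases "S \<subseteq> {0}")
  case True
  thus ?thesis by (intro that[of 1]) auto
next
  case False
  define T where "T = closure (sgn ` (S - {0}))"
  have T1: "cmod a = 1" if "a \<in> T" for a
  proof -
    have "T \<subseteq> sphere 0 1"
      unfolding T_def by (rule closure_minimal) (auto simp: norm_sgn split: if_splits)
    thus ?thesis using that by auto
  qed
  have "compact T"
    unfolding compact_eq_bounded_closed
    by (intro conjI bounded_subset[OF bounded_cball[of 0 1]]) (use T1 in \<open>auto simp: T_def\<close>)
  have TT: "0 \<le> Re (a * cnj b)" if a: "a \<in> T" and b: "b \<in> T" for a b
  proof -
    have 0: "0 \<le> Re (a * cnj b)" if "a \<in> sgn ` (S - {0})" "b \<in> sgn ` (S - {0})" for a b
    proof -
      from that obtain a' b' where *: "a' \<in> S" "b' \<in> S" "a = sgn a'" "b = sgn b'" by blast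
      have "a * cnj b = (a' * cnj b') /\<^sub>R (cmod a' * cmod b')"
        by (simp add: * sgn_div_norm)
      thus ?thesis using S[OF *(1,2)] by simp
    qed
    have cont: "continuous_on UNIV (\<lambda>a. Re (a * cnj b))" "continuous_on UNIV (\<lambda>b. Re (a * cnj b))" for a b
      by (intro continuous_intros)+
    have cl: "closed {a. 0 \<le> Re (a * cnj b)}" "closed {b. 0 \<le> Re (a * cnj b)}" for a b
      by (intro closed_Collect_le continuous_intros)+
    have 1: "0 \<le> Re (a * cnj b)" if "b \<in> sgn ` (S - {0})" for b
      using closure_minimal[OF _ cl(1)[of b], of "sgn ` (S - {0})"] 0 that a by (auto simp: T_def)
    show ?thesis
      using closure_minimal[OF _ cl(2)[of a], of "sgn ` (S - {0})"] 1 b by (auto simp: T_def)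
  qed
  from False obtain a0' where "a0' \<in> S" "a0' \<noteq> 0" by blast
  hence a0: "sgn a0' \<in> T" unfolding T_def by (intro closure_subset[THEN subsetD]) auto
  define a0 where "a0 = sgn a0'"
  have a0: "a0 \<in> T" using a0 by (simp add: a0_def)
  have "\<exists>a1\<in>T. \<forall>a\<in>T. Im (a1 * cnj a0) \<le> Im (a * cnj a0)"
    using a0 by (intro continuous_attains_inf[OF \<open>compact T\<close>] continuous_intros) auto
  then obtain a1 where a1: "a1 \<in> T" and min: "\<And>a. a \<in> T \<Longrightarrow> Im (a1 * cnj a0) \<le> Im (a * cnj a0)" by blast
  have ImT: "0 \<le> Im (a * cnj a1)" if a: "a \<in> T" for a
  proof -
    define x y x1 y1 where "x = Re (a * cnj a0)" "y = Im (a * cnj a0)"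
      "x1 = Re (a1 * cnj a0)" "y1 = Im (a1 * cnj a0)"
    note D = x_y_x1_y1_def
    have "cmod (a * cnj a0) = 1" "cmod (a1 * cnj a0) = 1" using T1 a a1 a0 by (auto simp: norm_mult)
    hence n: "x\<^sup>2 + y\<^sup>2 = 1" "x1\<^sup>2 + y1\<^sup>2 = 1"
      unfolding D using cmod_power2[of "a * cnj a0"] cmod_power2[of "a1 * cnj a0"] by simp_all
    have pos: "0 \<le> x" "0 \<le> x1" "y1 \<le> y" using TT[OF a a0] TT[OF a1 a0] min[OF a] by (auto simp: D)
    have "a * cnj a1 = (a * cnj a0) * cnj (a1 * cnj a0)"
    proof -
      have "(a * cnj a0) * cnj (a1 * cnj a0) = (a0 * cnj a0) * (a * cnj a1)"
        by (simp only: complex_cnj_mult complex_cnj_cnj mult_ac)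
      also have "a0 * cnj a0 = 1" using T1[OF a0] by (simp flip: complex_norm_square)
      finally show ?thesis by simp
    qed
    moreover have "Im (p * cnj q) = Im p * Re q - Re p * Im q" for p q by simp
    ultimately have eq: "Im (a * cnj a1) = y * x1 - x * y1" by (simp only: D)
    have "x * y1 \<le> y * x1"
    proof (cases "0 \<le> y1")
      case True
      hence "y1\<^sup>2 \<le> y\<^sup>2" using pos by (intro power_mono) auto
      hence "x\<^sup>2 \<le> x1\<^sup>2" using n by simp
      hence "x \<le> x1" using pos by (simp add: power2_le_iff_abs_le)
      hence "x * y1 \<le> x1 * y" using True pos by (intro mult_mono) auto
      thus ?thesis by (simp add: mult.commute)
    next
      case y1: False
      show ?thesis
      proof (cases "0 \<le> y")
        case True
        thus ?thesis using y1 pos by (meson mult_nonneg_nonneg mult_nonneg_nonpos le_less_linear less_imp_le order_trans)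
      next
        case False
        hence "(- y)\<^sup>2 \<le> (- y1)\<^sup>2" using pos by (intro power_mono) auto
        hence "x1\<^sup>2 \<le> x\<^sup>2" using n by simp
        hence "x1 \<le> x" using pos by (simp add: power2_le_iff_abs_le)
        hence "x1 * (- y) \<le> x * (- y1)" using pos y1 False by (intro mult_mono) auto
        thus ?thesis by (simp add: mult.commute)
      qed
    qed
    thus ?thesis using eq by simp
  qed
  show ?thesis
  proof (rule that[of "cnj a1"])
    show "cmod (cnj a1) = 1" using T1[OF a1] by simp
    fix a assume a: "a \<in> S"
    have eq: "cnj a1 * a = cmod a *\<^sub>R (sgn a * cnj a1)" by (cases "a = 0") (simp_all add: sgn_div_norm mult.commute)
    have "0 \<le> Re (sgn a * cnj a1) \<and> 0 \<le> Im (sgn a * cnj a1)"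
    proof (cases "a = 0")
      case False
      hence "sgn a \<in> T" using a unfolding T_def by (intro closure_subset[THEN subsetD]) auto
      thus ?thesis using TT[OF _ a1] ImT by blast
    qed simp
    thus "0 \<le> Re (cnj a1 * a)" "0 \<le> Im (cnj a1 * a)" unfolding eq by auto
  qed
qed

section \<open>Superlinear functionals on generated cones\<close>

text \<open>These lemmas carry the matrix estimates from generators to cones: \<open>\<theta> * Re w - cmod D\<close> is
  superlinear in each of the four arguments on which \<open>w\<close> and \<open>D\<close> depend real-linearly, and the
  arguments can be treated one at a time.\<close>

lemma superlinear_nonneg_span:
  fixes Q :: "'a::real_vector \<Rightarrow> real"
  assumes add: "\<And>x y. Q x + Q y \<le> Q (x + y)" and scale: "\<And>t x. 0 \<le> t \<Longrightarrow> t * Q x \<le> Q (t *\<^sub>R x)"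
    and S: "\<And>x. x \<in> S \<Longrightarrow> 0 \<le> Q x" and x: "x \<in> nonneg_span S"
  shows "0 \<le> Q x"
proof -
  obtain F t where F: "finite F" "F \<subseteq> S" "\<forall>u\<in>F. 0 \<le> t u" and x: "x = (\<Sum>u\<in>F. t u *\<^sub>R u)"
    using x by (auto simp: nonneg_span_def)
  from F have "0 \<le> Q (\<Sum>u\<in>F. t u *\<^sub>R u)"
  proof (induction F rule: finite_induct)
    case empty
    show ?case using scale[of 0 0] by simp
  next
    case (insert u F)
    have "0 \<le> t u * Q u" using insert S by simp
    with insert add[of "t u *\<^sub>R u" "\<Sum>u\<in>F. t u *\<^sub>R u"] scale[of "t u" u] show ?case by simp
  qed
  thus ?thesis by (simp add: x)
qed

lemma superlinear_nonneg_generated: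
  fixes Q :: "'a::real_normed_vector \<Rightarrow> real"
  assumes K: "generating_set K E" and cont: "continuous_on UNIV Q"
    and add: "\<And>x y. Q x + Q y \<le> Q (x + y)" and scale: "\<And>t x. 0 \<le> t \<Longrightarrow> t * Q x \<le> Q (t *\<^sub>R x)"
    and E: "\<And>x. x \<in> E \<Longrightarrow> 0 \<le> Q x" and x: "x \<in> K"
  shows "0 \<le> Q x"
proof -
  have "closed {x. 0 \<le> Q x}" by (intro closed_Collect_le cont continuous_intros)
  moreover have "nonneg_span E \<subseteq> {x. 0 \<le> Q x}" using superlinear_nonneg_span[OF add scale E] by blast
  ultimately have "closure (nonneg_span E) \<subseteq> {x. 0 \<le> Q x}" by (rule closure_minimal[rotated])
  thus ?thesis using K x by (auto simp: generating_set_def)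
qed

section \<open>Complexifications\<close>

lemma scaleC_simps [simp]:
  fixes x :: "'a::complex_banach"
  shows "0 *\<^sub>C x = 0" "1 *\<^sub>C x = x" "c *\<^sub>C (0::'a) = 0" "(- c) *\<^sub>C x = - (c *\<^sub>C x)" "c *\<^sub>C (- x) = - (c *\<^sub>C x)"
proof -
  show 0: "0 *\<^sub>C x = 0" "1 *\<^sub>C x = x" using scaleC_of_real[of 0 x] scaleC_of_real[of 1 x] by simp_all
  show 1: "c *\<^sub>C (0::'a) = 0" using scaleC_add_right[of c 0 "0::'a"] by simp
  show "(- c) *\<^sub>C x = - (c *\<^sub>C x)" using scaleC_add_left[of "- c" c x] 0 by (simp add: eq_neg_iff_add_eq_0)
  show "c *\<^sub>C (- x) = - (c *\<^sub>C x)" using scaleC_add_right[of c "- x" x] 1 by (simp add: eq_neg_iff_add_eq_0)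
qed

lemma scaleC_diff:
  fixes x y :: "'a::complex_banach"
  shows "c *\<^sub>C (x - y) = c *\<^sub>C x - c *\<^sub>C y" "(c - d) *\<^sub>C x = c *\<^sub>C x - d *\<^sub>C x"
  using scaleC_add_right[of c x "- y"] scaleC_add_left[of c "- d" x] by simp_all

lemma scaleC_complex [simp]: "c *\<^sub>C z = c * z" for z :: complex
  by (simp add: scaleC_complex_def)

lemma scaleR_scaleC: "r *\<^sub>R x = of_real r *\<^sub>C x" for x :: "'a::complex_banach"
  by (simp add: scaleC_of_real)

lemma scaleC_eq_0_iff [simp]: "c *\<^sub>C x = 0 \<longleftrightarrow> c = 0 \<or> x = 0" for x :: "'a::complex_banach"
  by (metis mult_eq_0_iff norm_eq_zero norm_scaleC)

lemma bounded_linear_scaleC: "bounded_linear (\<lambda>x. c *\<^sub>C x)" for c :: complex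
  by (rule bounded_linear_intro[where K = "cmod c"])
     (auto simp: scaleC_add_right scaleR_scaleC scaleC_scaleC norm_scaleC mult.commute)

lemma bounded_linear_scaleC_left: "bounded_linear (\<lambda>c. c *\<^sub>C x)" for x :: "'a::complex_banach"
proof (rule bounded_linear_intro[where K = "norm x"])
  fix r and c :: complex
  show "(r *\<^sub>R c) *\<^sub>C x = r *\<^sub>R c *\<^sub>C x"
    by (simp only: scaleR_scaleC[of r "c *\<^sub>C x"] scaleC_scaleC scaleR_conv_of_real)
qed (auto simp: scaleC_add_left norm_scaleC)

lemma bounded_clinearD:
  assumes "bounded_clinear f"
  shows "bounded_linear f" "f (x + y) = f x + f y" "f (x - y) = f x - f y" "f (c *\<^sub>C x) = c *\<^sub>C f x" "f 0 = 0"
proof -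
  show bl: "bounded_linear f" using assms by (simp add: bounded_clinear_def)
  interpret bounded_linear f by (rule bl)
  show "f (x + y) = f x + f y" "f (x - y) = f x - f y" "f 0 = 0" by (simp_all add: add diff zero)
  show "f (c *\<^sub>C x) = c *\<^sub>C f x" using assms by (simp add: bounded_clinear_def)
qed

locale complexified_space =
  fixes j :: "'r::banach \<Rightarrow> 'x::complex_banach"
  assumes complexification: "complexification j"
begin

definition J :: "'r \<Rightarrow> 'r \<Rightarrow> 'x" where "J u v = j u + \<i> *\<^sub>C j v"

lemma linear_j: "linear j" and norm_j [simp]: "norm (j u) = norm u"
  and bij_J: "bij (\<lambda>(u, v). J u v)"
  using complexification by (auto simp: complexification_def J_def)

lemma j_simps: "j (u + v) = j u + j v" "j (u - v) = j u - j v" "j (- u) = - j u" "j (r *\<^sub>R u) = of_real r *\<^sub>C j u"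
  "j 0 = 0"
  using linear_j by (auto simp: linear_add linear_diff linear_neg linear_scale linear_0 scaleR_scaleC)

lemma J_cases: obtains u v where "x = J u v"
  using bij_J by (metis (no_types, lifting) bij_pointE case_prod_conv surj_pair)

lemma J_0 [simp]: "J u 0 = j u" "J 0 0 = 0"
  by (simp_all add: J_def j_simps)

lemma J_eq_0_iff [simp]: "J u v = 0 \<longleftrightarrow> u = 0 \<and> v = 0"
proof
  assume "J u v = 0"
  hence "(\<lambda>(u, v). J u v) (u, v) = (\<lambda>(u, v). J u v) (0, 0)" by (simp add: j_simps)
  thus "u = 0 \<and> v = 0" using bij_J by (metis bij_is_inj injD prod.inject)
qed (simp add: j_simps)

lemma j_eq_0_iff [simp]: "j u = 0 \<longleftrightarrow> u = 0"
  by (metis norm_eq_zero norm_j)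

lemma J_add: "J u v + J u' v' = J (u + u') (v + v')"
  by (simp add: J_def j_simps scaleC_add_right)

lemma scaleC_J: "c *\<^sub>C J u v = J (Re c *\<^sub>R u - Im c *\<^sub>R v) (Im c *\<^sub>R u + Re c *\<^sub>R v)"
proof -
  have "(of_real a + \<i> * of_real b) *\<^sub>C J u v = J (a *\<^sub>R u - b *\<^sub>R v) (b *\<^sub>R u + a *\<^sub>R v)" for a b
    by (simp add: J_def j_simps scaleC_add_left scaleC_add_right scaleC_diff scaleC_scaleC algebra_simps)
  from this[of "Re c" "Im c"] show ?thesis by (simp only: flip: complex_eq)
qed

lemma J_scaleR: "J (r *\<^sub>R u) (r *\<^sub>R v) = r *\<^sub>R J u v"
  using scaleC_J[of "of_real r" u v] by (simp add: scaleC_of_real)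

lemma cext_J [simp]: "cext j l (J u v) = Complex (blinfun_apply l u) (blinfun_apply l v)"
proof -
  have "inv (\<lambda>(u, v). j u + \<i> *\<^sub>C j v) ((\<lambda>(u, v). j u + \<i> *\<^sub>C j v) (u, v)) = (u, v)"
    using bij_J by (intro inv_f_f) (simp add: J_def bij_is_inj)
  thus ?thesis by (simp add: cext_def J_def)
qed

lemma cext_j [simp]: "cext j l (j u) = of_real (blinfun_apply l u)"
  using cext_J[of l u 0] by (simp add: complex_of_real_def)

lemma cext_add: "cext j l (x + y) = cext j l x + cext j l y"
  by (cases x rule: J_cases; cases y rule: J_cases) (simp add: J_add blinfun.add_right complex_eq_iff)

lemma cext_scaleC: "cext j l (c *\<^sub>C x) = c * cext j l x"
  by (cases x rule: J_cases) (simp add: scaleC_J blinfun.add_right blinfun.diff_right blinfun.scaleR_right complex_eq_iff)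

lemma cext_diff: "cext j l (x - y) = cext j l x - cext j l y"
  using cext_add[of l x "- y"] cext_scaleC[of l "- 1" y] by simp

lemma cext_0 [simp]: "cext j l 0 = 0"
  using cext_diff[of l 0 0] by simp

lemma cext_functional: "cext j (l + l') x = cext j l x + cext j l' x" "cext j (r *\<^sub>R l) x = of_real r * cext j l x"
  by (cases x rule: J_cases, simp add: blinfun.add_left blinfun.scaleR_left complex_eq_iff)+

text \<open>Completeness enters here: \<open>J\<close> is a bounded bijection between Banach spaces, so its inverse is bounded
  by the open mapping theorem.\<close>

lemma J_norm_bound: obtains D where "0 < D" "\<And>u v. norm u + norm v \<le> D * norm (J u v)"
proof -
  have bl: "bounded_linear (\<lambda>(u, v). J u v)"
  proof (rule bounded_linear_intro[where K = 2])
    fix p :: "'r \<times> 'r"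
    obtain u v where p: "p = (u, v)" by fastforce
    have "norm (J u v) \<le> norm u + norm v"
      unfolding J_def by (rule norm_triangle_le) (simp add: norm_scaleC)
    also have "\<dots> \<le> norm p * 2"
      using norm_fst_le[of u v] norm_snd_le[of v u] by (simp add: p)
    finally show "norm (case p of (u, v) \<Rightarrow> J u v) \<le> norm p * 2" by (simp add: p)
  qed (auto simp: J_add J_scaleR split: prod.splits)
  obtain D where D: "0 < D" "\<And>x. \<exists>p. (case p of (u, v) \<Rightarrow> J u v) = x \<and> norm p \<le> D * norm x"
    using bounded_linear_surj_bounded_preimages[OF bl] bij_J by (metis bij_is_surj)
  show ?thesis
  proof (rule that[of "2 * D"])
    fix u v
    obtain p where p: "(case p of (u, v) \<Rightarrow> J u v) = J u v" "norm p \<le> D * norm (J u v)" using D by blast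
    hence "p = (u, v)" using bij_J by (metis (mono_tags, lifting) bij_is_inj case_prod_conv injD)
    thus "norm u + norm v \<le> 2 * D * norm (J u v)"
      using p norm_fst_le[of u v] norm_snd_le[of v u] by (simp add: mult.assoc)
  qed (use D in simp)
qed

lemma bounded_clinear_cext: "bounded_clinear (cext j l)"
proof -
  obtain D where D: "0 < D" "\<And>u v. norm u + norm v \<le> D * norm (J u v)" using J_norm_bound by metis
  have "norm (cext j l x) \<le> norm x * (norm l * D)" for x
  proof -
    obtain u v where x: "x = J u v" by (rule J_cases)
    have "norm (cext j l x) \<le> \<bar>blinfun_apply l u\<bar> + \<bar>blinfun_apply l v\<bar>"
      using cmod_le[of "cext j l x"] by (simp add: x)
    also have "\<dots> \<le> norm l * (norm u + norm v)"
      using norm_blinfun[of l u] norm_blinfun[of l v] by (simp add: algebra_simps)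
    also have "\<dots> \<le> norm l * (D * norm x)" using D(2)[of u v] by (intro mult_left_mono) (auto simp: x)
    finally show ?thesis by (simp add: mult_ac)
  qed
  hence "bounded_linear (cext j l)"
    by (intro bounded_linear_intro[where K = "norm l * D"]) (auto simp: cext_add scaleR_scaleC cext_scaleC)
  thus ?thesis by (simp add: bounded_clinear_def cext_scaleC)
qed

end

section \<open>Complexified cones\<close>

lemma dual_coneD: "l \<in> dual_cone K \<Longrightarrow> p \<in> K \<Longrightarrow> 0 \<le> blinfun_apply l p"
  by (simp add: dual_cone_def)

lemma dual_cone_closed:
  "0 \<in> dual_cone K" "l \<in> dual_cone K \<Longrightarrow> l' \<in> dual_cone K \<Longrightarrow> l + l' \<in> dual_cone K"
  "0 \<le> t \<Longrightarrow> l \<in> dual_cone K \<Longrightarrow> t *\<^sub>R l \<in> dual_cone K"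
  by (auto simp: dual_cone_def blinfun.add_left blinfun.scaleR_left)

text \<open>Bounded sectional aperture gives normality: in the plane of \<open>p \<le> q\<close> the functional \<open>m\<close> is
  monotone and controls the norm.\<close>

lemma sectional_aperture_normal:
  fixes K :: "'r::real_normed_vector set"
  assumes ap: "bounded_sectional_aperture \<kappa> K" and \<kappa>: "0 < \<kappa>" and K: "real_cone K"
    and p: "p \<in> K" and q: "q - p \<in> K"
  shows "norm p \<le> max 1 \<kappa> * norm q"
proof (cases "p \<noteq> q \<and> independent {p, q}")
  case True
  then obtain m :: "'r \<Rightarrow>\<^sub>L real" where m: "norm m = 1"
    "\<And>\<xi>. \<xi> \<in> K \<inter> span {p, q} \<Longrightarrow> norm \<xi> \<le> \<kappa> * blinfun_apply m \<xi>"
    using ap unfolding bounded_sectional_aperture_def by blast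
  have sp: "p \<in> span {p, q}" "q - p \<in> span {p, q}"
    by (auto intro: span_base span_diff)
  have "0 \<le> \<kappa> * blinfun_apply m (q - p)"
    using m(2)[of "q - p"] q sp by (meson IntI norm_ge_zero order_trans)
  hence mono: "\<kappa> * blinfun_apply m p \<le> \<kappa> * blinfun_apply m q"
    by (simp add: blinfun.diff_right algebra_simps)
  have "norm p \<le> \<kappa> * blinfun_apply m p" using m(2)[of p] p sp by auto
  also have "\<dots> \<le> \<kappa> * blinfun_apply m q" by (rule mono)
  also have "\<dots> \<le> \<kappa> * norm q"
    using norm_blinfun[of m q] m(1) \<kappa> by (intro mult_left_mono) auto
  also have "\<dots> \<le> max 1 \<kappa> * norm q" by (intro mult_right_mono) auto
  finally show ?thesis .
next
  case False
  have "norm p \<le> 1 * norm q"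
  proof (cases "p = q \<or> p = 0")
    case pq: False
    have "{p, q} = insert q {p}" by auto
    with False pq have "q \<in> span {p}" by (auto simp: independent_insert dependent_single)
    then obtain c where c: "q = c *\<^sub>R p" by (auto simp: span_singleton)
    have "1 \<le> c"
    proof (rule ccontr)
      assume "\<not> 1 \<le> c"
      hence "inverse (1 - c) *\<^sub>R (q - p) \<in> K" using q by (intro real_coneD(4)[OF K]) auto
      moreover have "inverse (1 - c) *\<^sub>R (q - p) = - p"
      proof -
        have "q - p = (c - 1) *\<^sub>R p" by (simp add: c algebra_simps)
        moreover have "inverse (1 - c) * (c - 1) = -1" using \<open>\<not> 1 \<le> c\<close> by (simp add: field_simps)
        ultimately show ?thesis by simp
      qed
      ultimately show False using real_coneD(5)[OF K p] pq by simp
    qed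
    thus ?thesis by (simp add: c mult_right_mono[of 1 c "norm p", simplified])
  qed auto
  also have "\<dots> \<le> max 1 \<kappa> * norm q" by (intro mult_right_mono) auto
  finally show ?thesis .
qed

text \<open>On the pencil of the vectors \<open>(a, b)\<close> and \<open>(c, d)\<close> the form \<open>Re (\<xi> * cnj \<eta>)\<close> is a quadratic
  polynomial in \<open>cmod z\<close> once the phase of \<open>z\<close> is the one that makes it smallest, and its discriminant
  is \<open>(cmod (a * d - b * c))\<^sup>2\<close>.\<close>

lemma Re_pencil:
  "Re ((a - z * c) * cnj (b - z * d)) =
    Re (a * cnj b) + (cmod z)\<^sup>2 * Re (c * cnj d) - Re (cnj z * (a * cnj d + b * cnj c))"
  unfolding cmod_power2 by (simp add: algebra_simps power2_eq_square)

lemma pencil_discriminant: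
  "(cmod (a * cnj d + b * cnj c))\<^sup>2 =
    (cmod (a * d - b * c))\<^sup>2 + 4 * Re (a * cnj b) * Re (c * cnj d)"
  unfolding cmod_power2 by (simp add: algebra_simps power2_eq_square)

text \<open>The roots of \<open>P - s W + s\<^sup>2 Q\<close> are \<open>D / Q\<close> apart, and the polynomial is negative between them. So
  they lie in \<open>[a, b]\<close>. When \<open>Q = 0\<close>, nonnegativity for large \<open>s\<close> forces \<open>W = 0\<close>.\<close>

lemma quadratic_root_gap:
  fixes W D P Q a b :: real
  assumes disc: "W\<^sup>2 = D\<^sup>2 + 4 * P * Q" and nn: "0 \<le> W" "0 \<le> D" "0 \<le> P" "0 \<le> Q" and ab: "a \<le> b"
    and pos: "\<And>s. 0 \<le> s \<Longrightarrow> s < a \<or> b < s \<Longrightarrow> 0 \<le> P + s\<^sup>2 * Q - s * W"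
  shows "D \<le> (b - a) * Q"
proof (cases "D = 0")
  case True
  thus ?thesis using nn ab by simp
next
  case D: False
  show ?thesis
  proof (cases "Q = 0")
    case True
    hence "W = D" using disc nn by (simp add: power2_eq_iff_nonneg)
    hence W: "0 < W" using D nn by simp
    define s where "s = \<bar>b\<bar> + 1 + P / W"
    have "0 \<le> P / W" using nn W by simp
    hence "0 \<le> s" "b < s" by (simp_all add: s_def)
    hence "0 \<le> P - s * W" using pos[of s] True by simp
    moreover have "s * W = (\<bar>b\<bar> + 1) * W + P" using W by (simp add: s_def field_simps)
    moreover have "0 < (\<bar>b\<bar> + 1) * W" using W by (intro mult_pos_pos) auto
    ultimately show ?thesis by simp
  next
    case False
    with nn have Q: "0 < Q" by simp
    define s0 s1 where "s0 = (W - D) / (2 * Q)" and "s1 = (W + D) / (2 * Q)"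
    have "0 \<le> 4 * P * Q" using nn by simp
    hence "D\<^sup>2 \<le> W\<^sup>2" using disc by linarith
    hence "D \<le> W" using nn(1) by (rule power2_le_imp_le)
    hence s: "0 \<le> s0" "s0 < s1" using Q D nn by (auto simp: s0_def s1_def divide_strict_right_mono)
    have sums: "Q * (s0 + s1) = W" "Q * (s0 * s1) = P"
    proof -
      show "Q * (s0 + s1) = W" using Q by (simp add: s0_def s1_def field_simps)
      have "Q * (s0 * s1) = (W\<^sup>2 - D\<^sup>2) / (4 * Q)"
        using Q by (simp add: s0_def s1_def power2_eq_square field_simps)
      thus "Q * (s0 * s1) = P" using disc Q by simp
    qed
    have neg: "P + s\<^sup>2 * Q - s * W < 0" if "s0 < s" "s < s1" for s
    proof -
      have "P + s\<^sup>2 * Q - s * W = - (Q * ((s - s0) * (s1 - s)))"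
        unfolding sums[symmetric] by (simp add: algebra_simps power2_eq_square)
      thus ?thesis using that Q by simp
    qed
    have "s1 \<le> b"
    proof (rule ccontr)
      assume "\<not> s1 \<le> b"
      then obtain s where "max b s0 < s" "s < s1" using s dense[of "max b s0" s1] by auto
      thus False using neg[of s] pos[of s] s by auto
    qed
    moreover have "a \<le> s0"
    proof (rule ccontr)
      assume "\<not> a \<le> s0"
      then obtain s where "s0 < s" "s < min a s1" using s dense[of s0 "min a s1"] by auto
      thus False using neg[of s] pos[of s] s by auto
    qed
    ultimately have "s1 - s0 \<le> b - a" by simp
    hence "Q * (s1 - s0) \<le> Q * (b - a)" using Q by (intro mult_left_mono) auto
    moreover have "Q * (s1 - s0) = D" using Q by (simp add: s0_def s1_def field_simps)
    ultimately show ?thesis by (simp add: mult.commute)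
  qed
qed

locale cone_complexification = complexified_space j for j :: "'r::banach \<Rightarrow> 'x::complex_banach" +
  fixes K :: "'r set" and \<kappa> :: real
  assumes cone: "real_cone K" and aperture: "bounded_sectional_aperture \<kappa> K" and \<kappa>_pos: "0 < \<kappa>"
    and reproducing: "reproducing K"
begin

abbreviation "Kd \<equiv> dual_cone K"
abbreviation "Kc \<equiv> complexified_cone j K"
abbreviation "ext \<equiv> cext j"

lemmas K_simps = real_coneD[OF cone]

lemma K_bipolar:
  assumes "\<And>l. l \<in> Kd \<Longrightarrow> 0 \<le> blinfun_apply l p"
  shows "p \<in> K"
  using real_cone_separation[OF cone, of p] assms by (metis not_less)

lemma ext_separates:
  assumes "\<And>l. l \<in> Kd \<Longrightarrow> ext l x = 0"
  shows "x = 0"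
proof -
  obtain u v where x: "x = J u v" by (rule J_cases)
  have "blinfun_apply l u = 0 \<and> blinfun_apply l v = 0" if "l \<in> Kd" for l
    using assms[OF that] by (simp add: x complex_eq_iff)
  hence "u \<in> K" "- u \<in> K" "v \<in> K" "- v \<in> K" by (auto intro!: K_bipolar simp: blinfun.minus_right)
  thus ?thesis using K_simps(5) by (simp add: x)
qed

lemma KcI: "(\<And>l1 l2. l1 \<in> Kd \<Longrightarrow> l2 \<in> Kd \<Longrightarrow> 0 \<le> Re (ext l1 x * cnj (ext l2 x))) \<Longrightarrow> x \<in> Kc"
  by (simp add: complexified_cone_def)

lemma KcD: "x \<in> Kc \<Longrightarrow> l1 \<in> Kd \<Longrightarrow> l2 \<in> Kd \<Longrightarrow> 0 \<le> Re (ext l1 x * cnj (ext l2 x))"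
  by (simp add: complexified_cone_def)

lemma closed_Kc: "closed Kc"
proof -
  have c: "continuous_on UNIV (ext l)" for l
    using bounded_clinearD(1)[OF bounded_clinear_cext] by (rule linear_continuous_on)
  have "Kc = (\<Inter>l1\<in>Kd. \<Inter>l2\<in>Kd. {x. 0 \<le> Re (ext l1 x * cnj (ext l2 x))})"
    by (auto simp: complexified_cone_def)
  moreover have "closed {x. 0 \<le> Re (ext l1 x * cnj (ext l2 x))}" for l1 l2
    by (intro closed_Collect_le continuous_intros c)
  ultimately show ?thesis by (simp add: closed_INT)
qed

lemma scaleC_Kc: "x \<in> Kc \<Longrightarrow> c *\<^sub>C x \<in> Kc"
proof (rule KcI)
  fix l1 l2 assume *: "x \<in> Kc" "l1 \<in> Kd" "l2 \<in> Kd"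
  have "ext l1 (c *\<^sub>C x) * cnj (ext l2 (c *\<^sub>C x)) = of_real ((cmod c)\<^sup>2) * (ext l1 x * cnj (ext l2 x))"
    by (simp only: cext_scaleC complex_norm_square complex_cnj_mult mult_ac)
  thus "0 \<le> Re (ext l1 (c *\<^sub>C x) * cnj (ext l2 (c *\<^sub>C x)))"
    using KcD[OF *] by simp
qed

lemma J_in_Kc: "u \<in> K \<Longrightarrow> v \<in> K \<Longrightarrow> J u v \<in> Kc"
  by (intro KcI) (simp add: dual_coneD)

text \<open>The values of the dual cone at \<open>x\<close> lie within a right angle; rotating it onto the first quadrant
  puts both components of \<open>x\<close> into \<open>K\<close>.\<close>

lemma Kc_cases:
  assumes x: "x \<in> Kc"
  obtains \<zeta> u v where "cmod \<zeta> = 1" "u \<in> K" "v \<in> K" "x = \<zeta> *\<^sub>C J u v"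
proof -
  have "0 \<le> Re (a * cnj b)" if "a \<in> (\<lambda>l. ext l x) ` Kd" "b \<in> (\<lambda>l. ext l x) ` Kd" for a b
    using that KcD[OF x] by blast
  then obtain \<eta> where \<eta>: "cmod \<eta> = 1"
    and "\<And>a. a \<in> (\<lambda>l. ext l x) ` Kd \<Longrightarrow> 0 \<le> Re (\<eta> * a)" "\<And>a. a \<in> (\<lambda>l. ext l x) ` Kd \<Longrightarrow> 0 \<le> Im (\<eta> * a)"
    using complex_right_angle_sector by metis
  hence pos: "0 \<le> Re (\<eta> * ext l x)" "0 \<le> Im (\<eta> * ext l x)" if "l \<in> Kd" for l
    using that by blast+
  obtain u v where uv: "\<eta> *\<^sub>C x = J u v" by (rule J_cases)
  have "ext l (\<eta> *\<^sub>C x) = \<eta> * ext l x" for l by (rule cext_scaleC)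
  hence "Complex (blinfun_apply l u) (blinfun_apply l v) = \<eta> * ext l x" for l by (simp flip: uv cext_J)
  hence "blinfun_apply l u = Re (\<eta> * ext l x)" "blinfun_apply l v = Im (\<eta> * ext l x)" for l
    by (metis complex.sel(1), metis complex.sel(2))
  hence "u \<in> K" "v \<in> K" using pos by (auto intro!: K_bipolar simp del: times_complex.sel)
  moreover have "x = cnj \<eta> *\<^sub>C J u v"
    using \<eta> by (simp flip: uv complex_norm_square add: scaleC_scaleC mult.commute[of "cnj \<eta>"])
  ultimately show ?thesis using that[of "cnj \<eta>"] \<eta> by simp
qed

text \<open>The functionals \<open>mu p q\<close> with \<open>p\<close>, \<open>q\<close> in the dual cone are, up to complex factors, the elements
  of the complexified dual cone. The relation below says that \<open>x\<close> and \<open>y\<close> are comparable for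
  the complex order, with quotients in the annulus between \<open>a\<close> and \<open>b\<close>.\<close>

definition mu :: "('r \<Rightarrow>\<^sub>L real) \<Rightarrow> ('r \<Rightarrow>\<^sub>L real) \<Rightarrow> 'x \<Rightarrow> complex"
  where "mu p q x = ext p x + \<i> * ext q x"

definition in_annulus :: "real \<Rightarrow> real \<Rightarrow> 'x \<Rightarrow> 'x \<Rightarrow> bool"
  where "in_annulus a b x y \<longleftrightarrow>
    (\<forall>p\<in>Kd. \<forall>q\<in>Kd. a * cmod (mu p q y) \<le> cmod (mu p q x) \<and> cmod (mu p q x) \<le> b * cmod (mu p q y))"

lemma mu_linear: "mu p q (x + y) = mu p q x + mu p q y" "mu p q (x - y) = mu p q x - mu p q y"
  "mu p q (c *\<^sub>C x) = c * mu p q x" "mu p 0 x = ext p x"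
  using cext_functional(2)[of 0 0 x] by (simp_all add: mu_def cext_add cext_diff cext_scaleC algebra_simps)

text \<open>A combination \<open>l1 + c l2\<close> with \<open>Re c \<ge> 0\<close> is \<open>mu p q\<close> if \<open>Im c \<ge> 0\<close> and a multiple of \<open>mu q p\<close> by a
  unit otherwise.\<close>

lemma in_annulus_combination:
  assumes an: "in_annulus a b x y" and l: "l1 \<in> Kd" "l2 \<in> Kd" and c: "0 \<le> Re c"
  shows "a * cmod (ext l1 y + c * ext l2 y) \<le> cmod (ext l1 x + c * ext l2 x)"
    "cmod (ext l1 x + c * ext l2 x) \<le> b * cmod (ext l1 y + c * ext l2 y)"
proof -
  define p q where "p = l1 + Re c *\<^sub>R l2" and "q = \<bar>Im c\<bar> *\<^sub>R l2"
  have pq: "p \<in> Kd" "q \<in> Kd" using l c by (auto simp: p_def q_def intro!: dual_cone_closed)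
  have "cmod (ext l1 z + c * ext l2 z) = (if 0 \<le> Im c then cmod (mu p q z) else cmod (mu q p z))" for z
  proof -
    have cc: "c = Re c + \<i> * Im c" by (rule complex_eq)
    have "ext l1 z + c * ext l2 z = ext p z + \<i> * (of_real (Im c) * ext l2 z)"
      by (subst cc) (simp add: p_def cext_functional algebra_simps)
    moreover have "cmod (ext p z - \<i> * ext q z) = cmod (\<i> * (ext p z - \<i> * ext q z))" by (simp add: norm_mult)
    moreover have "\<i> * (ext p z - \<i> * ext q z) = mu q p z" by (simp add: mu_def algebra_simps)
    moreover have "ext q z = of_real \<bar>Im c\<bar> * ext l2 z" by (simp only: q_def cext_functional)
    ultimately show ?thesis by (simp add: mu_def abs_if split: if_splits)
  qed
  thus "a * cmod (ext l1 y + c * ext l2 y) \<le> cmod (ext l1 x + c * ext l2 x)"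
    "cmod (ext l1 x + c * ext l2 x) \<le> b * cmod (ext l1 y + c * ext l2 y)"
    using an pq unfolding in_annulus_def by auto
qed

text \<open>If \<open>l1\<close>, \<open>l2\<close> witness that \<open>v\<close> is outside \<open>Kc\<close>, then \<open>l1 + c l2\<close> with \<open>c = - l1 v / l2 v\<close> annihilates
  \<open>v\<close>. Since \<open>Re c > 0\<close>, it vanishes on \<open>Kc\<close> only where both \<open>l1\<close> and \<open>l2\<close> do. For \<open>v = x - z y\<close> this
  exhibits \<open>z\<close> as a quotient of values at \<open>x\<close> and \<open>y\<close>, whose modulus lies in \<open>[a, b]\<close>.\<close>

lemma in_annulus_pencil:
  assumes x: "x \<in> Kc" and y: "y \<in> Kc" and an: "in_annulus a b x y" and z: "cmod z < a \<or> b < cmod z"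
  shows "x - z *\<^sub>C y \<in> Kc"
proof (rule ccontr)
  assume "x - z *\<^sub>C y \<notin> Kc"
  then obtain l1 l2 where l: "l1 \<in> Kd" "l2 \<in> Kd"
    and neg: "Re (ext l1 (x - z *\<^sub>C y) * cnj (ext l2 (x - z *\<^sub>C y))) < 0"
    using KcI not_less by blast
  define v1 v2 where "v1 = ext l1 (x - z *\<^sub>C y)" and "v2 = ext l2 (x - z *\<^sub>C y)"
  have v2: "v2 \<noteq> 0" using neg by (auto simp: v2_def)
  define c where "c = - v1 / v2"
  have v1: "v1 = - c * v2" using v2 by (simp add: c_def)
  have "Re (v1 * cnj v2) = - Re c * (cmod v2)\<^sup>2"
    unfolding v1 cmod_power2 by (simp add: algebra_simps power2_eq_square)
  hence c: "0 < Re c" using neg v2 by (auto simp: v1_def v2_def mult_less_0_iff zero_less_mult_iff)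
  have "v1 + c * v2 = 0" by (simp add: v1)
  hence eq: "ext l1 x + c * ext l2 x = z * (ext l1 y + c * ext l2 y)"
    by (simp add: v1_def v2_def cext_diff cext_scaleC algebra_simps)
  have vanish: "ext l1 w = 0 \<and> ext l2 w = 0" if "ext l1 w + c * ext l2 w = 0" "w \<in> Kc" for w
  proof -
    have e: "ext l1 w = - c * ext l2 w" using that(1) by (simp add: add_eq_0_iff2)
    have "Re (ext l1 w * cnj (ext l2 w)) = - Re c * (cmod (ext l2 w))\<^sup>2"
      unfolding e cmod_power2 by (simp add: algebra_simps power2_eq_square)
    with KcD[OF that(2) l] c have "ext l2 w = 0" by (auto simp: mult_le_0_iff zero_le_mult_iff)
    with e show ?thesis by simp
  qed
  show False
  proof (cases "ext l1 y + c * ext l2 y = 0")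
    case True
    hence "ext l1 y = 0 \<and> ext l2 y = 0" "ext l1 x = 0 \<and> ext l2 x = 0"
      using vanish x y eq by auto
    hence "v2 = 0" by (simp add: v2_def cext_diff cext_scaleC)
    thus False using v2 by simp
  next
    case False
    hence "0 < cmod (ext l1 y + c * ext l2 y)" by simp
    moreover have "cmod (ext l1 x + c * ext l2 x) = cmod z * cmod (ext l1 y + c * ext l2 y)"
      by (simp add: eq norm_mult)
    ultimately show False
      using in_annulus_combination[OF an l, of c] c z by auto
  qed
qed

text \<open>The pencil \<open>x - z y\<close> stays in \<open>Kc\<close> for \<open>\<bar>z\<bar>\<close> outside \<open>[a, b]\<close>, so for every \<open>l\<close> in the dual cone the
  roots of the quadratic polynomial belonging to \<open>m\<close> and \<open>l\<close> are at most \<open>b - a\<close> apart. This bounds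
  the values of \<open>l\<close> at \<open>x - c y\<close> by \<open>(b - a) \<bar>l y\<bar>\<close>. Both components of \<open>x - c y\<close> are thus squeezed into
  a small order interval, and normality of \<open>K\<close> makes them small in norm.\<close>

lemma in_annulus_norm_bound:
  obtains C where "0 < C"
    "\<And>x y a b m. x \<in> Kc \<Longrightarrow> y \<in> Kc \<Longrightarrow> m \<in> Kd \<Longrightarrow> ext m y \<noteq> 0 \<Longrightarrow> a \<le> b \<Longrightarrow> in_annulus a b x y
      \<Longrightarrow> norm (x - (ext m x / ext m y) *\<^sub>C y) \<le> C * (b - a) * norm y"
proof -
  obtain D where D: "0 < D" "\<And>u v. norm u + norm v \<le> D * norm (J u v)" using J_norm_bound by metis
  define N where "N = max 1 \<kappa>"
  have N: "1 \<le> N" by (simp add: N_def)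
  define C where "C = 2 * (2 * N + 1) * D"
  show ?thesis
  proof (rule that[of C])
    show "0 < C" using D N by (simp add: C_def)
    fix x y a b m
    assume x: "x \<in> Kc" and y: "y \<in> Kc" and m: "m \<in> Kd" "ext m y \<noteq> 0" and ab: "a \<le> b"
      and an: "in_annulus a b x y"
    define c where "c = ext m x / ext m y"
    have val: "cmod (ext l (x - c *\<^sub>C y)) \<le> (b - a) * cmod (ext l y)" if l: "l \<in> Kd" for l
    proof -
      define d P Q w where "d = ext m x * ext l y - ext l x * ext m y"
        and "P = Re (ext m x * cnj (ext l x))" and "Q = Re (ext m y * cnj (ext l y))"
        and "w = ext m x * cnj (ext l y) + ext l x * cnj (ext m y)"
      have "cmod d \<le> (b - a) * Q"
      proof (rule quadratic_root_gap)
        show "(cmod w)\<^sup>2 = (cmod d)\<^sup>2 + 4 * P * Q"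
          unfolding w_def d_def P_def Q_def by (rule pencil_discriminant)
        show "0 \<le> P" "0 \<le> Q" using KcD x y m l by (auto simp: P_def Q_def)
        fix s :: real assume s: "0 \<le> s" "s < a \<or> b < s"
        \<comment> \<open>The phase of \<open>z\<close> is the one for which \<open>Re (cnj z * w)\<close> is largest.\<close>
        define z where "z = of_real s * (if w = 0 then 1 else sgn w)"
        have z: "cmod z = s" using s by (simp add: z_def norm_mult norm_sgn)
        have "cnj z * w = of_real (s * cmod w)"
          using complex_norm_square[of w]
          by (auto simp: z_def sgn_div_norm scaleR_conv_of_real power2_eq_square field_simps)
        hence "P + s\<^sup>2 * Q - s * cmod w = Re (ext m (x - z *\<^sub>C y) * cnj (ext l (x - z *\<^sub>C y)))"
          by (simp only: cext_diff cext_scaleC Re_pencil z P_def Q_def flip: w_def) simp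
        moreover have "x - z *\<^sub>C y \<in> Kc" using in_annulus_pencil[OF x y an] z s by auto
        ultimately show "0 \<le> P + s\<^sup>2 * Q - s * cmod w" using KcD m l by simp
      qed (use ab in auto)
      also have "\<dots> \<le> (b - a) * (cmod (ext m y) * cmod (ext l y))"
        using ab complex_Re_le_cmod[of "ext m y * cnj (ext l y)"]
        by (intro mult_left_mono) (auto simp: Q_def norm_mult)
      finally have "cmod d \<le> cmod (ext m y) * ((b - a) * cmod (ext l y))" by (simp add: mult_ac)
      moreover have "d = - (ext m y * ext l (x - c *\<^sub>C y))"
        using m by (simp add: d_def c_def cext_diff cext_scaleC field_simps)
      ultimately show ?thesis using m by (simp add: norm_mult)
    qed
    obtain \<zeta> u v where y': "cmod \<zeta> = 1" "u \<in> K" "v \<in> K" "y = \<zeta> *\<^sub>C J u v" by (rule Kc_cases[OF y])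
    obtain p q where pq: "x - c *\<^sub>C y = J p q" by (rule J_cases)
    define e where "e = (b - a) *\<^sub>R (u + v)"
    have ly: "cmod (ext l y) \<le> blinfun_apply l (u + v)" if "l \<in> Kd" for l
      using cmod_le[of "Complex (blinfun_apply l u) (blinfun_apply l v)"] y' that
      by (simp add: cext_scaleC norm_mult dual_coneD blinfun.add_right)
    have le: "\<bar>blinfun_apply l p\<bar> \<le> blinfun_apply l e \<and> \<bar>blinfun_apply l q\<bar> \<le> blinfun_apply l e" if l: "l \<in> Kd" for l
    proof -
      have "(b - a) * cmod (ext l y) \<le> blinfun_apply l e"
        using ly[OF l] ab unfolding e_def blinfun.scaleR_right by (simp add: mult_left_mono)
      thus ?thesis
        using val[OF l] abs_Re_le_cmod[of "ext l (J p q)"] abs_Im_le_cmod[of "ext l (J p q)"]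
        by (simp add: pq)
    qed
    have small: "norm r \<le> (2 * N + 1) * norm e" if "\<And>l. l \<in> Kd \<Longrightarrow> \<bar>blinfun_apply l r\<bar> \<le> blinfun_apply l e" for r
    proof -
      have "e + r \<in> K" "2 *\<^sub>R e - (e + r) \<in> K"
        using that by (auto intro!: K_bipolar simp: blinfun.add_right blinfun.diff_right blinfun.scaleR_right abs_le_iff)
           (smt (verit))+
      hence "norm (e + r) \<le> N * norm (2 *\<^sub>R e)"
        unfolding N_def by (rule sectional_aperture_normal[OF aperture \<kappa>_pos cone])
      moreover have "norm r \<le> norm (e + r) + norm e" using norm_triangle_ineq4[of "e + r" e] by simp
      ultimately show ?thesis by (simp add: algebra_simps)
    qed
    have "norm (x - c *\<^sub>C y) \<le> norm p + norm q"
      unfolding pq J_def by (rule norm_triangle_le) (simp add: norm_scaleC)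
    also have "\<dots> \<le> 2 * ((2 * N + 1) * norm e)" using small le by (smt (verit))
    also have "norm e \<le> (b - a) * (D * norm y)"
    proof -
      have "norm e \<le> (b - a) * (norm u + norm v)"
        using ab norm_triangle_ineq[of u v] by (simp add: e_def mult_left_mono)
      also have "\<dots> \<le> (b - a) * (D * norm y)"
        using ab D(2)[of u v] y' by (intro mult_left_mono) (auto simp: norm_scaleC)
      finally show ?thesis .
    qed
    finally show "norm (x - (ext m x / ext m y) *\<^sub>C y) \<le> C * (b - a) * norm y"
      using N by (simp add: C_def c_def mult_ac)
  qed
qed

end

section \<open>The matrix estimates on cones\<close>

text \<open>Nonnegativity for \<open>\<tau> = \<theta>\<close>, \<open>\<sigma> = 1\<close> is the bound that defines \<open>Gamma_plus \<theta>\<close>; \<open>\<tau> = 1\<close>, \<open>\<sigma> = 0\<close> is the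
  positivity of the real part. The two parameters let one extension argument serve for both.\<close>

definition pencil_form :: "real \<Rightarrow> real \<Rightarrow> complex \<Rightarrow> complex \<Rightarrow> complex \<Rightarrow> complex \<Rightarrow> real"
  where "pencil_form \<tau> \<sigma> a b c d = \<tau> * Re (a * cnj d + b * cnj c) - \<sigma> * cmod (a * d - b * c)"

lemma pencil_form_swap:
  "pencil_form \<tau> \<sigma> a b c d = pencil_form \<tau> \<sigma> c d a b"
  "pencil_form \<tau> \<sigma> a b c d = pencil_form \<tau> \<sigma> a c b d"
  by (auto simp: pencil_form_def algebra_simps norm_minus_commute)

lemma pencil_form_superlinear:
  assumes "0 \<le> \<sigma>"
  shows "pencil_form \<tau> \<sigma> a b c d + pencil_form \<tau> \<sigma> a' b' c d \<le> pencil_form \<tau> \<sigma> (a + a') (b + b') c d"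
    "0 \<le> t \<Longrightarrow> t * pencil_form \<tau> \<sigma> a b c d \<le> pencil_form \<tau> \<sigma> (of_real t * a) (of_real t * b) c d"
proof -
  have "cmod ((a + a') * d - (b + b') * c) = cmod ((a * d - b * c) + (a' * d - b' * c))"
    by (simp add: algebra_simps)
  also have "\<dots> \<le> cmod (a * d - b * c) + cmod (a' * d - b' * c)" by (rule norm_triangle_ineq)
  finally have "\<sigma> * cmod ((a + a') * d - (b + b') * c) \<le> \<sigma> * (cmod (a * d - b * c) + cmod (a' * d - b' * c))"
    using assms by (rule mult_left_mono)
  thus "pencil_form \<tau> \<sigma> a b c d + pencil_form \<tau> \<sigma> a' b' c d \<le> pencil_form \<tau> \<sigma> (a + a') (b + b') c d"
    by (simp add: pencil_form_def algebra_simps)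
  assume t: "0 \<le> t"
  have "of_real t * a * d - of_real t * b * c = of_real t * (a * d - b * c)" by (simp add: algebra_simps)
  hence "cmod (of_real t * a * d - of_real t * b * c) = t * cmod (a * d - b * c)" using t by (simp add: norm_mult)
  thus "t * pencil_form \<tau> \<sigma> a b c d \<le> pencil_form \<tau> \<sigma> (of_real t * a) (of_real t * b) c d"
    by (simp add: pencil_form_def algebra_simps)
qed

context cone_complexification
begin

text \<open>The approximating functionals are nonnegative combinations of \<open>M\<close>, for which superlinearity suffices,
  and only the two values at \<open>X\<close> and \<open>Y\<close> have to converge.\<close>

lemma weak_star_superlinear:
  fixes q :: "complex \<Rightarrow> complex \<Rightarrow> real"
  assumes M: "weak_star_generating_set j K M" and cont: "continuous_on UNIV (\<lambda>z. q (fst z) (snd z))"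
    and add: "\<And>a b a' b'. q a b + q a' b' \<le> q (a + a') (b + b')"
    and scale: "\<And>t a b. 0 \<le> t \<Longrightarrow> t * q a b \<le> q (of_real t * a) (of_real t * b)"
    and pos: "\<And>m. m \<in> M \<Longrightarrow> 0 \<le> q (ext m X) (ext m Y)" and l: "l \<in> Kd"
  shows "0 \<le> q (ext l X) (ext l Y)"
proof -
  have "\<exists>l'\<in>nonneg_span M. \<forall>y\<in>{X, Y}. cmod (ext l' y - ext l y) < inverse (real (Suc n))" for n
  proof -
    have "\<exists>l'\<in>nonneg_span M. \<forall>y\<in>Z. cmod (ext l' y - ext l y) < \<epsilon>" if "finite Z" "0 < \<epsilon>" for Z \<epsilon>
      using M l that by (simp add: weak_star_generating_set_def)
    from this[of "{X, Y}" "inverse (real (Suc n))"] show ?thesis by simp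
  qed
  then obtain L where L': "\<And>n. L n \<in> nonneg_span M \<and> (\<forall>y\<in>{X, Y}. cmod (ext (L n) y - ext l y) < inverse (real (Suc n)))"
    by metis
  hence L: "\<And>n. L n \<in> nonneg_span M"
    "\<And>n. cmod (ext (L n) X - ext l X) < inverse (real (Suc n))" "\<And>n. cmod (ext (L n) Y - ext l Y) < inverse (real (Suc n))"
    by auto
  have lim: "(\<lambda>n. ext (L n) Z) \<longlonglongrightarrow> ext l Z" if "\<And>n. cmod (ext (L n) Z - ext l Z) < inverse (real (Suc n))" for Z
    using that by (intro LIM_zero_cancel[OF Lim_null_comparison[OF _ LIMSEQ_inverse_real_of_nat]] eventuallyI less_imp_le)
  have "(\<lambda>n. (ext (L n) X, ext (L n) Y)) \<longlonglongrightarrow> (ext l X, ext l Y)"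
    by (intro tendsto_Pair lim L)
  from continuous_on_tendsto_compose[OF cont this]
  have "(\<lambda>n. q (ext (L n) X) (ext (L n) Y)) \<longlonglongrightarrow> q (ext l X) (ext l Y)" by simp
  moreover have "0 \<le> q (ext (L n) X) (ext (L n) Y)" for n
    by (rule superlinear_nonneg_span[where Q = "\<lambda>l. q (ext l X) (ext l Y)", OF _ _ pos L(1)])
       (simp_all add: cext_functional add scale)
  ultimately show ?thesis by (intro LIMSEQ_le_const) auto
qed

lemma Kc_by_generators:
  assumes M: "weak_star_generating_set j K M"
    and pos: "\<And>m1 m2. m1 \<in> M \<Longrightarrow> m2 \<in> M \<Longrightarrow> 0 \<le> Re (ext m1 x * cnj (ext m2 x))"
  shows "x \<in> Kc"
proof -
  have 1: "0 \<le> Re (ext l x * cnj z)" if "\<And>m. m \<in> M \<Longrightarrow> 0 \<le> Re (ext m x * cnj z)" "l \<in> Kd" for l z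
  proof (rule weak_star_superlinear[OF M, where q = "\<lambda>a b. Re (a * cnj z)" and X = x and Y = x, OF _ _ _ that])
    show "continuous_on UNIV (\<lambda>p. Re (fst p * cnj z))" by (intro continuous_intros)
  qed (simp_all add: algebra_simps)
  have sym: "Re (a * cnj b) = Re (b * cnj a)" for a b by simp
  show ?thesis
  proof (rule KcI)
    fix l1 l2 assume l: "l1 \<in> Kd" "l2 \<in> Kd"
    have "0 \<le> Re (ext l2 x * cnj (ext m x))" if "m \<in> M" for m
      by (rule 1[OF _ l(2)]) (rule pos[OF _ that])
    hence "0 \<le> Re (ext m x * cnj (ext l2 x))" if "m \<in> M" for m using that sym by metis
    thus "0 \<le> Re (ext l1 x * cnj (ext l2 x))" by (rule 1[OF _ l(1)])
  qed
qed

lemma ext_nonzero_generator: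
  assumes M: "weak_star_generating_set j K M" and x: "x \<noteq> 0"
  obtains m where "m \<in> M" "ext m x \<noteq> 0"
proof (rule ccontr)
  assume "\<not> thesis"
  hence "\<not> (m \<in> M \<and> ext m x \<noteq> 0)" for m using that by blast
  hence 0: "ext m x = 0" if "m \<in> M" for m using that by blast
  have "ext l x = 0" if l: "l \<in> Kd" for l
  proof -
    have "0 \<le> - cmod (ext l x)"
    proof (rule weak_star_superlinear[OF M, where q = "\<lambda>a b. - cmod a" and X = x and Y = x, OF _ _ _ _ l])
      show "continuous_on UNIV (\<lambda>p. - cmod (fst p))" by (intro continuous_intros)
      show "- cmod a + - cmod a' \<le> - cmod (a + a')" for a a' using norm_triangle_ineq[of a a'] by linarith
    qed (auto simp: 0 norm_mult)
    thus ?thesis by simp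
  qed
  thus False using x ext_separates by blast
qed

end

locale cone_contraction = cone_complexification j K \<kappa>
  for j :: "'r::banach \<Rightarrow> 'x::complex_banach" and K :: "'r set" and \<kappa> :: real +
  fixes A :: "'x \<Rightarrow> 'x" and E :: "'r set" and M :: "('r \<Rightarrow>\<^sub>L real) set" and \<theta> :: real
  assumes A: "bounded_clinear A" and E: "archimedean_generating_set K E"
    and M: "weak_star_generating_set j K M" and \<theta>: "0 \<le> \<theta>" "\<theta> < 1"
    and T: "T_matrices j E M A \<subseteq> Gamma_plus \<theta>"
begin

text \<open>The matrices in \<open>T_matrices\<close> are the two by two blocks of the kernel \<open>k\<close>, which is real-bilinear in
  the functional and the vector.\<close>

definition k :: "('r \<Rightarrow>\<^sub>L real) \<Rightarrow> 'r \<Rightarrow> complex" where "k l p = ext l (A (j p))"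

lemma A_simps: "A (x + y) = A x + A y" "A (x - y) = A x - A y" "A (c *\<^sub>C x) = c *\<^sub>C A x" "A 0 = 0"
  using bounded_clinearD[OF A] by auto

lemma k_simps: "k l (p + q) = k l p + k l q" "k l (r *\<^sub>R p) = of_real r * k l p" "k (l + l') p = k l p + k l' p"
  "k (r *\<^sub>R l) p = of_real r * k l p" "k l 0 = 0"
  by (simp_all add: k_def j_simps A_simps cext_add cext_scaleC cext_functional)

lemma ext_A_J: "ext l (A (J u v)) = k l u + \<i> * k l v"
  by (simp add: J_def k_def A_simps cext_add cext_scaleC)

lemma M_subset: "m \<in> M \<Longrightarrow> m \<in> Kd" and E_subset: "e \<in> E \<Longrightarrow> e \<in> K" "e \<in> E \<Longrightarrow> e \<noteq> 0"
  using M E by (auto simp: weak_star_generating_set_def archimedean_generating_set_def generating_set_def)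

lemma continuous_k: "continuous_on UNIV (k l)"
proof -
  have "bounded_linear j" by (rule bounded_linear_intro[where K = 1]) (auto simp: j_simps scaleC_of_real)
  hence "bounded_linear (\<lambda>p. ext l (A (j p)))"
    by (rule bounded_linear_compose[OF bounded_clinearD(1)[OF bounded_clinear_cext]
          bounded_linear_compose[OF bounded_clinearD(1)[OF A]]])
  thus ?thesis unfolding k_def by (rule linear_continuous_on)
qed

lemma mat2_nth: "mat2 a b c d $ 1 $ 1 = a" "mat2 a b c d $ 1 $ 2 = b" "mat2 a b c d $ 2 $ 1 = c" "mat2 a b c d $ 2 $ 2 = d"
  by (simp_all add: mat2_def)

lemma generator_matrix:
  assumes "e1 \<in> E" "e2 \<in> E" "m1 \<in> M" "m2 \<in> M"
  shows "0 \<le> pencil_form \<theta> 1 (k m1 e1) (k m2 e1) (k m1 e2) (k m2 e2)"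
    "0 \<le> pencil_form 1 0 (k m1 e1) (k m2 e1) (k m1 e2) (k m2 e2)"
    "0 < Re (k m1 e1 * cnj (k m1 e2))"
proof -
  have "mat2 (k m1 e1) (k m2 e1) (k m1 e2) (k m2 e2) \<in> Gamma_plus \<theta>"

  proof (rule subsetD[OF T])
    show "mat2 (k m1 e1) (k m2 e1) (k m1 e2) (k m2 e2) \<in> T_matrices j E M A"
      unfolding T_matrices_def k_def mem_Collect_eq
      by (rule exI[of _ e1], rule exI[of _ e2], rule exI[of _ m1], rule exI[of _ m2]) (use assms in simp)
  qed
  then obtain a b c d where eq: "mat2 (k m1 e1) (k m2 e1) (k m1 e2) (k m2 e2) = mat2 a b c d"
    and D: "cmod (a * d - b * c) < Re (a * cnj d + b * cnj c)"
    and ac: "0 < Re (a * cnj c)" and q: "cmod (a * d - b * c) / Re (a * cnj d + b * cnj c) \<le> \<theta>"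
    unfolding Gamma_plus_def by blast
  have k: "k m1 e1 = a" "k m2 e1 = b" "k m1 e2 = c" "k m2 e2 = d"
    using eq mat2_nth by metis+
  have "0 < Re (a * cnj d + b * cnj c)" using D by (rule le_less_trans[OF norm_ge_zero])
  with q have "cmod (a * d - b * c) \<le> \<theta> * Re (a * cnj d + b * cnj c)" by (simp add: pos_divide_le_eq)
  thus "0 \<le> pencil_form \<theta> 1 (k m1 e1) (k m2 e1) (k m1 e2) (k m2 e2)"
    unfolding k pencil_form_def by linarith
  show "0 \<le> pencil_form 1 0 (k m1 e1) (k m2 e1) (k m1 e2) (k m2 e2)"
    using \<open>0 < Re (a * cnj d + b * cnj c)\<close> unfolding k pencil_form_def by linarith
  show "0 < Re (k m1 e1 * cnj (k m1 e2))" unfolding k by (rule ac)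
qed

lemma pencil_form_extends:
  assumes \<sigma>: "0 \<le> \<sigma>"
    and gen: "\<And>e1 e2 m1 m2. e1 \<in> E \<Longrightarrow> e2 \<in> E \<Longrightarrow> m1 \<in> M \<Longrightarrow> m2 \<in> M \<Longrightarrow>
      0 \<le> pencil_form \<tau> \<sigma> (k m1 e1) (k m2 e1) (k m1 e2) (k m2 e2)"
    and pq: "p \<in> K" "q \<in> K" and l: "l1 \<in> Kd" "l2 \<in> Kd"
  shows "0 \<le> pencil_form \<tau> \<sigma> (k l1 p) (k l2 p) (k l1 q) (k l2 q)"
proof -
  have gK: "generating_set K E" using E by (simp add: archimedean_generating_set_def)
  \<comment> \<open>Both rows, and then both columns, pass from generators to the cone; the symmetries of the form
    move the argument in question into the first place.\<close>
  have *: "continuous_on UNIV (\<lambda>p. pencil_form \<tau> \<sigma> (k l1 p) (k l2 p) c d)" for l1 l2 c d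
    unfolding pencil_form_def by (intro continuous_intros continuous_k)
  have row: "0 \<le> pencil_form \<tau> \<sigma> (k l1 p) (k l2 p) c d"
    if "\<And>e. e \<in> E \<Longrightarrow> 0 \<le> pencil_form \<tau> \<sigma> (k l1 e) (k l2 e) c d" "p \<in> K" for l1 l2 c d p
    by (rule superlinear_nonneg_generated[OF gK, where Q = "\<lambda>p. pencil_form \<tau> \<sigma> (k l1 p) (k l2 p) c d", OF _ _ _ that])
      (simp_all add: k_simps pencil_form_superlinear[OF \<sigma>] *)
  have contc: "continuous_on UNIV (\<lambda>z. pencil_form \<tau> \<sigma> (fst z) (snd z) c d)" for c d
    unfolding pencil_form_def by (intro continuous_intros)
  have col: "0 \<le> pencil_form \<tau> \<sigma> (k l p) (k l q) c d"
    if "\<And>m. m \<in> M \<Longrightarrow> 0 \<le> pencil_form \<tau> \<sigma> (k m p) (k m q) c d" "l \<in> Kd" for l p q c d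
    unfolding k_def
    by (rule weak_star_superlinear[OF M contc _ _ _ that(2)]) (simp_all add: pencil_form_superlinear[OF \<sigma>] that(1)[unfolded k_def])
  note swap = pencil_form_swap(1)[of \<tau> \<sigma>] and tr = pencil_form_swap(2)[of \<tau> \<sigma>]
  have 1: "0 \<le> pencil_form \<tau> \<sigma> (k m1 e) (k m2 e) (k m1 p) (k m2 p)"
    if "e \<in> E" "m1 \<in> M" "m2 \<in> M" for m1 m2 e
    using row[OF gen[OF _ that] pq(1)] by (simp only: swap[of "k m1 e"])
  have 2: "0 \<le> pencil_form \<tau> \<sigma> (k m1 p) (k m1 q) (k m2 p) (k m2 q)" if "m1 \<in> M" "m2 \<in> M" for m1 m2
    using row[OF 1[OF _ that] pq(2)] by (simp only: swap[of "k m1 q"] tr[of "k m1 p"])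
  have 3: "0 \<le> pencil_form \<tau> \<sigma> (k m p) (k m q) (k l1 p) (k l1 q)" if "m \<in> M" for m
    using col[OF 2[OF _ that] l(1)] by (simp only: swap[of "k m p"])
  have "0 \<le> pencil_form \<tau> \<sigma> (k l2 p) (k l2 q) (k l1 p) (k l1 q)" by (rule col[OF 3 l(2)])
  thus ?thesis by (simp only: swap[of "k l2 p"] tr[of "k l1 p"])
qed

lemma matrix_bound:
  assumes "p \<in> K" "q \<in> K" "l1 \<in> Kd" "l2 \<in> Kd"
  shows "cmod (k l1 p * k l2 q - k l2 p * k l1 q) \<le> \<theta> * Re (k l1 p * cnj (k l2 q) + k l2 p * cnj (k l1 q))"
    "0 \<le> Re (k l1 p * cnj (k l2 q) + k l2 p * cnj (k l1 q))"
proof -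
  have "0 \<le> pencil_form \<theta> 1 (k l1 p) (k l2 p) (k l1 q) (k l2 q)"
    by (rule pencil_form_extends[OF _ generator_matrix(1) assms]) simp_all
  thus "cmod (k l1 p * k l2 q - k l2 p * k l1 q) \<le> \<theta> * Re (k l1 p * cnj (k l2 q) + k l2 p * cnj (k l1 q))"
    unfolding pencil_form_def by linarith
  have "0 \<le> pencil_form 1 0 (k l1 p) (k l2 p) (k l1 q) (k l2 q)"
    by (rule pencil_form_extends[OF _ generator_matrix(2) assms]) simp_all
  thus "0 \<le> Re (k l1 p * cnj (k l2 q) + k l2 p * cnj (k l1 q))"
    unfolding pencil_form_def by linarith
qed

lemma k_same_functional:
  assumes "p \<in> K" "q \<in> K" "l \<in> Kd"
  shows "0 \<le> Re (k l p * cnj (k l q))"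
  using matrix_bound(2)[OF assms(1,2,3,3)] unfolding plus_complex.sel by linarith

lemma k_same_vector:
  assumes "p \<in> K" "l1 \<in> Kd" "l2 \<in> Kd"
  shows "0 \<le> Re (k l1 p * cnj (k l2 p))"
proof -
  have "Re (k l2 p * cnj (k l1 p)) = Re (k l1 p * cnj (k l2 p))" by simp
  thus ?thesis using matrix_bound(2)[OF assms(1,1,2,3)] unfolding plus_complex.sel by linarith
qed

lemma E_below: "p \<in> K - {0} \<Longrightarrow> \<exists>e\<in>E. \<exists>t>0. p - t *\<^sub>R e \<in> K"
  using E unfolding archimedean_generating_set_def by blast

text \<open>The Archimedean property turns the strict inequality between generators into a strict one on the
  punctured cone: \<open>p\<close> and \<open>q\<close> each dominate a positive multiple of a generator.\<close>

lemma k_generator_pos: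
  assumes p: "p \<in> K - {0}" and q: "q \<in> K - {0}" and m: "m \<in> M"
  shows "0 < Re (k m p * cnj (k m q))"
proof -
  obtain e t where e: "e \<in> E" "0 < t" "p - t *\<^sub>R e \<in> K" using E_below[OF p] by blast
  obtain e' t' where e': "e' \<in> E" "0 < t'" "q - t' *\<^sub>R e' \<in> K" using E_below[OF q] by blast
  note md = M_subset[OF m]
  have pe: "k m p = k m (p - t *\<^sub>R e) + of_real t * k m e" using k_simps(1)[of m "p - t *\<^sub>R e" "t *\<^sub>R e"] by (simp add: k_simps)
  have qe: "k m q = k m (q - t' *\<^sub>R e') + of_real t' * k m e'" using k_simps(1)[of m "q - t' *\<^sub>R e'" "t' *\<^sub>R e'"] by (simp add: k_simps)
  have "0 < t * (t' * Re (k m e * cnj (k m e')))" using generator_matrix(3)[OF e(1) e'(1) m m] e e' by simp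
  also have "\<dots> \<le> t * (t' * Re (k m e * cnj (k m e'))) + t * Re (k m e * cnj (k m (q - t' *\<^sub>R e')))"
    using k_same_functional[OF E_subset(1)[OF e(1)] e'(3) md] e by simp
  also have "\<dots> = t * Re (k m e * cnj (k m q))" by (simp add: qe algebra_simps)
  also have "\<dots> \<le> t * Re (k m e * cnj (k m q)) + Re (k m (p - t *\<^sub>R e) * cnj (k m q))"
    using k_same_functional[OF e(3) _ md, of q] q by simp
  also have "\<dots> = Re (k m p * cnj (k m q))" by (simp add: pe algebra_simps)
  finally show ?thesis .
qed

lemma k_generator_nonzero: "p \<in> K - {0} \<Longrightarrow> m \<in> M \<Longrightarrow> k m p \<noteq> 0"
  using k_generator_pos[of p p m] by auto

lemma ext_A_generator_nonzero:
  assumes x: "x \<in> Kc - {0}" and m: "m \<in> M"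
  shows "ext m (A x) \<noteq> 0"
proof -
  from x have "x \<in> Kc" by simp
  then obtain \<zeta> u v where x': "cmod \<zeta> = 1" "u \<in> K" "v \<in> K" "x = \<zeta> *\<^sub>C J u v" by (rule Kc_cases)
  have uv: "u \<noteq> 0 \<or> v \<noteq> 0" using x x' by auto
  have "k m u + \<i> * k m v \<noteq> 0"
  proof (cases "u = 0 \<or> v = 0")
    case True
    thus ?thesis using uv x' k_generator_nonzero[of u m] k_generator_nonzero[of v m] m by (auto simp: k_simps)
  next
    case False
    show ?thesis
    proof
      assume "k m u + \<i> * k m v = 0"
      hence "k m u = - \<i> * k m v" by (simp add: add_eq_0_iff2)
      hence "Re (k m u * cnj (k m v)) = 0" by simp
      thus False using k_generator_pos[of u v m] False x' m by simp
    qed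
  qed
  thus ?thesis using x' by (auto simp: A_simps cext_scaleC ext_A_J)
qed

text \<open>The cross term of \<open>Re (l1 (A x) * cnj (l2 (A x)))\<close> for \<open>x = u + \<i> v\<close> is \<open>Im w\<close>. The discriminant
  identity and \<open>\<bar>D\<bar> \<le> Re w\<close> bound it by twice the geometric mean of the diagonal terms.\<close>

lemma A_Kc: assumes x: "x \<in> Kc" shows "A x \<in> Kc"
proof -
  obtain \<zeta> u v where x': "cmod \<zeta> = 1" "u \<in> K" "v \<in> K" "x = \<zeta> *\<^sub>C J u v" using x by (rule Kc_cases)
  have "A (J u v) \<in> Kc"
  proof (rule KcI)
    fix l1 l2 assume l: "l1 \<in> Kd" "l2 \<in> Kd"
    define a b c d where "a = k l1 u" "b = k l2 u" "c = k l1 v" "d = k l2 v"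
    note D = a_b_c_d_def
    define P Q where "P = Re (a * cnj b)" and "Q = Re (c * cnj d)"
    define w where "w = a * cnj d + b * cnj c"
    have PQ: "0 \<le> P" "0 \<le> Q" using k_same_vector x' l by (auto simp: P_def Q_def D)
    have "0 \<le> Re w" "cmod (a * d - b * c) \<le> \<theta> * Re w"
      using matrix_bound[OF x'(2,3) l] by (auto simp: w_def D)
    moreover have "\<theta> * Re w \<le> Re w" using \<theta> \<open>0 \<le> Re w\<close> by (simp add: mult_left_le_one_le)
    ultimately have "(cmod (a * d - b * c))\<^sup>2 \<le> (Re w)\<^sup>2" by (intro power_mono) auto
    hence "(Im w)\<^sup>2 \<le> 4 * P * Q"
      using pencil_discriminant[of a d b c] by (simp add: w_def[symmetric] P_def Q_def cmod_power2[of w])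
    also have "\<dots> \<le> (P + Q)\<^sup>2" using zero_le_power2[of "P - Q"] by (simp add: power2_eq_square algebra_simps)
    finally have "\<bar>Im w\<bar> \<le> \<bar>P + Q\<bar>" unfolding abs_le_square_iff .
    hence "\<bar>Im w\<bar> \<le> P + Q" using PQ by simp
    moreover have "Re ((a + \<i> * c) * cnj (b + \<i> * d)) = P + Q + Im w" by (simp add: P_def Q_def w_def algebra_simps)
    ultimately show "0 \<le> Re (ext l1 (A (J u v)) * cnj (ext l2 (A (J u v))))" by (simp add: ext_A_J D)
  qed
  thus ?thesis using x' by (simp add: A_simps scaleC_Kc)
qed

end

section \<open>Comparison with a rank one operator\<close>

lemma comparable_of_difference:
  fixes X Y :: complex
  assumes "cmod (X - Y) \<le> \<theta> * R" "R \<le> cmod X + cmod Y" "0 \<le> \<theta>" "\<theta> < 1"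
  shows "cmod X \<le> (1 + \<theta>) / (1 - \<theta>) * cmod Y"
proof -
  have "cmod X - cmod Y \<le> cmod (X - Y)" by (rule norm_triangle_ineq2)
  also have "\<dots> \<le> \<theta> * (cmod X + cmod Y)" using assms by (meson mult_left_mono order_trans)
  finally have "(1 - \<theta>) * cmod X \<le> (1 + \<theta>) * cmod Y" by (simp add: algebra_simps)
  thus ?thesis using assms by (simp add: field_simps)
qed

lemma Re_add_le_cmod: "Re (a * cnj b + c * cnj d) \<le> cmod (a * b) + cmod (c * d)"
  using complex_Re_le_cmod[of "a * cnj b"] complex_Re_le_cmod[of "c * cnj d"] by (simp add: norm_mult)

text \<open>With \<open>R1 = c / a\<close> and \<open>R2 = d / b\<close> the hypothesis bounds the pseudo-hyperbolic distance
  \<open>\<bar>R1 - R2\<bar> / \<bar>R1 + cnj R2\<bar>\<close> of the right half plane by \<open>\<theta>\<close>. For \<open>\<zeta>\<close> on the imaginary axis,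
  \<open>\<bar>R1 + cnj R2\<bar> \<le> \<bar>R1 - \<zeta>\<bar> + \<bar>R2 - \<zeta>\<bar>\<close>, hence \<open>\<bar>R1 - \<zeta>\<bar>\<close> and \<open>\<bar>R2 - \<zeta>\<bar>\<close> differ by at most the factor \<open>C\<close>.
  The first two inequalities are the case \<open>\<zeta> = 0\<close>, the next two the case \<open>\<zeta> = \<i>\<close>, and the last two
  again \<open>\<zeta> = \<i>\<close> with the quotient of \<open>c + \<i> d\<close> by \<open>a + \<i> b\<close> in place of \<open>R2\<close>.\<close>

lemma matrix_comparison:
  fixes a b c d :: complex
  assumes "cmod (a * d - b * c) \<le> \<theta> * Re (a * cnj d + b * cnj c)" "0 \<le> \<theta>" "\<theta> < 1"
  defines "C \<equiv> (1 + \<theta>) / (1 - \<theta>)"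
  shows "cmod (a * d) \<le> C * cmod (b * c)" "cmod (b * c) \<le> C * cmod (a * d)"
    "cmod ((a + \<i> * c) * b) \<le> C * cmod ((b + \<i> * d) * a)"
    "cmod ((b + \<i> * d) * a) \<le> C * cmod ((a + \<i> * c) * b)"
    "cmod ((a + \<i> * b + \<i> * (c + \<i> * d)) * a) \<le> C * cmod ((a + \<i> * c) * (a + \<i> * b))"
    "cmod ((a + \<i> * c) * (a + \<i> * b)) \<le> C * cmod ((a + \<i> * b + \<i> * (c + \<i> * d)) * a)"
proof -
  define D R where "D = a * d - b * c" and "R = Re (a * cnj d + b * cnj c)"
  have comp: "cmod X \<le> C * cmod Y" "cmod Y \<le> C * cmod X"
    if "cmod (X - Y) = cmod D" "R \<le> cmod X + cmod Y" for X Y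
    using comparable_of_difference[of X Y \<theta> R] comparable_of_difference[of Y X \<theta> R] that assms
    by (simp_all add: D_def R_def norm_minus_commute add.commute)
  have 1: "R \<le> cmod (a * d) + cmod (b * c)" unfolding R_def by (rule Re_add_le_cmod)
  show "cmod (a * d) \<le> C * cmod (b * c)" "cmod (b * c) \<le> C * cmod (a * d)"
    using comp[OF _ 1] by (simp_all add: D_def)
  have "R = Re ((\<i> * a) * cnj (b + \<i> * d) + (- \<i> * (a + \<i> * c)) * cnj b)" by (simp add: R_def algebra_simps)
  also have "\<dots> \<le> cmod ((\<i> * a) * (b + \<i> * d)) + cmod ((- \<i> * (a + \<i> * c)) * b)" by (rule Re_add_le_cmod)
  finally have 2: "R \<le> cmod ((a + \<i> * c) * b) + cmod ((b + \<i> * d) * a)" by (simp add: norm_mult mult_ac)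
  have "(a + \<i> * c) * b - (b + \<i> * d) * a = - \<i> * D" by (simp add: D_def algebra_simps)
  hence "cmod ((a + \<i> * c) * b - (b + \<i> * d) * a) = cmod D" by (simp add: norm_mult)
  thus "cmod ((a + \<i> * c) * b) \<le> C * cmod ((b + \<i> * d) * a)"
    "cmod ((b + \<i> * d) * a) \<le> C * cmod ((a + \<i> * c) * b)" using comp[OF _ 2] by simp_all
  have "R = Re ((a + \<i> * c) * cnj (a + \<i> * b) + (- (a + \<i> * b + \<i> * (c + \<i> * d))) * cnj a)"
    by (simp add: R_def algebra_simps)
  also have "\<dots> \<le> cmod ((a + \<i> * c) * (a + \<i> * b)) + cmod ((- (a + \<i> * b + \<i> * (c + \<i> * d))) * a)" by (rule Re_add_le_cmod)
  finally have 3: "R \<le> cmod ((a + \<i> * b + \<i> * (c + \<i> * d)) * a) + cmod ((a + \<i> * c) * (a + \<i> * b))"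
    by (simp only: norm_mult norm_minus_cancel add.commute)
  have "(a + \<i> * b + \<i> * (c + \<i> * d)) * a - (a + \<i> * c) * (a + \<i> * b) = - D" by (simp add: D_def algebra_simps)
  hence "cmod ((a + \<i> * b + \<i> * (c + \<i> * d)) * a - (a + \<i> * c) * (a + \<i> * b)) = cmod D" by simp
  thus "cmod ((a + \<i> * b + \<i> * (c + \<i> * d)) * a) \<le> C * cmod ((a + \<i> * c) * (a + \<i> * b))"
    "cmod ((a + \<i> * c) * (a + \<i> * b)) \<le> C * cmod ((a + \<i> * b + \<i> * (c + \<i> * d)) * a)"
    using comp[OF _ 3] by simp_all
qed

text \<open>Multiplying the four comparisons and cancelling. In the application \<open>X\<close>, \<open>L\<close>, \<open>M\<close> stand for values of
  the functionals \<open>l + \<i> l'\<close>, \<open>l\<close>, \<open>m\<close>, and the suffixes \<open>x\<close>, \<open>u\<close>, \<open>e\<close> (none in the case of \<open>X\<close>) tell at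
  the images of which vector they are taken.\<close>

lemma comparison_chain:
  fixes C :: real
  assumes "X * Lu \<le> C * (Lx * Xu)" "Xu * Le \<le> C * (Lu * Xe)" "Lx * Mu \<le> C * (Mx * Lu)" "Lu * Me \<le> C * (Mu * Le)"
    and "0 \<le> C" "0 \<le> X" "0 \<le> Xu" "0 \<le> Xe" "0 \<le> Lx" "0 \<le> Mx" "0 \<le> Me" "0 < Lu" "0 < Le" "0 < Mu"
  shows "X * Me \<le> C ^ 4 * (Mx * Xe)"
proof -
  have "(X * Lu) * (Le * Mu) \<le> C * (Lx * Xu) * (Le * Mu)" using assms by (intro mult_right_mono) auto
  also have "\<dots> = C * ((Lx * Mu) * (Xu * Le))" by (simp add: mult_ac)
  also have "\<dots> \<le> C * ((C * (Mx * Lu)) * (C * (Lu * Xe)))"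
    by (rule mult_left_mono[OF mult_mono[OF assms(3,2)]]) (use assms in auto)
  finally have "(X * Lu) * (Le * Mu) * Me \<le> C * ((C * (Mx * Lu)) * (C * (Lu * Xe))) * Me"
    using assms by (intro mult_right_mono)
  also have "\<dots> = C ^ 3 * (Mx * Xe * Lu) * (Lu * Me)" by (simp add: power3_eq_cube mult_ac)
  also have "\<dots> \<le> C ^ 3 * (Mx * Xe * Lu) * (C * (Mu * Le))" using assms by (intro mult_left_mono) auto
  finally have "(Lu * Le * Mu) * (X * Me) \<le> (Lu * Le * Mu) * (C ^ 4 * (Mx * Xe))"
    by (simp add: power4_eq_xxxx power3_eq_cube mult_ac)
  moreover have "0 < Lu * Le * Mu" using assms by simp
  ultimately show ?thesis by (rule mult_left_le_imp_le)
qed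

lemma comparison_chain':
  fixes C :: real
  assumes "Lx * Xu \<le> C * (X * Lu)" "Lu * Xe \<le> C * (Xu * Le)" "Mx * Lu \<le> C * (Lx * Mu)" "Mu * Le \<le> C * (Lu * Me)"
    and "0 \<le> C" "0 \<le> X" "0 \<le> Xu" "0 \<le> Xe" "0 \<le> Lx" "0 \<le> Mx" "0 \<le> Me" "0 < Lu" "0 < Le" "0 < Mu"
  shows "Mx * Xe \<le> C ^ 4 * (X * Me)"
proof -
  have "(Mx * Lu) * (Lu * Xe) \<le> (C * (Lx * Mu)) * (C * (Xu * Le))"
    by (rule mult_mono[OF assms(3,2)]) (use assms in auto)
  also have "\<dots> = C\<^sup>2 * (Mu * Le) * (Lx * Xu)" by (simp add: power2_eq_square mult_ac)
  also have "\<dots> \<le> C\<^sup>2 * (Mu * Le) * (C * (X * Lu))" using assms by (intro mult_left_mono) auto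
  also have "\<dots> = C ^ 3 * (X * Lu) * (Mu * Le)" by (simp add: power2_eq_square power3_eq_cube mult_ac)
  also have "\<dots> \<le> C ^ 3 * (X * Lu) * (C * (Lu * Me))" using assms by (intro mult_left_mono) auto
  finally have "(Lu * Lu) * (Mx * Xe) \<le> (Lu * Lu) * (C ^ 4 * (X * Me))"
    by (simp add: power4_eq_xxxx power3_eq_cube mult_ac)
  moreover have "0 < Lu * Lu" using assms by simp
  ultimately show ?thesis by (rule mult_left_le_imp_le)
qed

context cone_contraction
begin

lemma matrix_bound_rows_cols:
  assumes "p \<in> K" "q \<in> K" "l1 \<in> Kd" "l2 \<in> Kd"
  shows "cmod (k l1 p * k l2 q - k l2 p * k l1 q) \<le> \<theta> * Re (k l1 p * cnj (k l2 q) + k l2 p * cnj (k l1 q))"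
    "cmod (k l1 p * k l2 q - k l1 q * k l2 p) \<le> \<theta> * Re (k l1 p * cnj (k l2 q) + k l1 q * cnj (k l2 p))"
proof -
  show *: "cmod (k l1 p * k l2 q - k l2 p * k l1 q) \<le> \<theta> * Re (k l1 p * cnj (k l2 q) + k l2 p * cnj (k l1 q))"
    by (rule matrix_bound(1)[OF assms])
  have "Re (k l1 q * cnj (k l2 p)) = Re (k l2 p * cnj (k l1 q))" by simp
  thus "cmod (k l1 p * k l2 q - k l1 q * k l2 p) \<le> \<theta> * Re (k l1 p * cnj (k l2 q) + k l1 q * cnj (k l2 p))"
    using * by (simp only: plus_complex.sel mult.commute[of "k l1 q" "k l2 p"])
qed

definition comparison_const :: real where "comparison_const = ((1 + \<theta>) / (1 - \<theta>)) ^ 4"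

lemma comparison_const: "1 \<le> comparison_const"
  unfolding comparison_const_def using \<theta> by (intro one_le_power) (simp add: field_simps)

lemma mu_A_J: "mu l l' (A (J u v)) = (k l u + \<i> * k l' u) + \<i> * (k l v + \<i> * k l' v)"
  by (simp add: mu_def ext_A_J algebra_simps)

text \<open>With \<open>\<mu> = l + \<i> l'\<close> and \<open>x = u + \<i> v\<close>, the cross ratio of \<open>\<mu>\<close>, \<open>m\<close> at \<open>x\<close>, \<open>e\<close> is the product of those of
  \<open>\<mu>\<close>, \<open>l\<close> and of \<open>l\<close>, \<open>m\<close> at \<open>x\<close>, \<open>u\<close> and at \<open>u\<close>, \<open>e\<close>. Each of these four is bounded by one case of
  \<open>matrix_comparison\<close>.\<close>

lemma rank_one_comparison_nondegenerate:
  assumes u: "u \<in> K - {0}" and v: "v \<in> K" and l: "l \<in> Kd" "l' \<in> Kd" and m: "m \<in> M" and e: "e \<in> K - {0}" and le: "k l e \<noteq> 0"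
  shows "cmod (mu l l' (A (J u v))) * cmod (k m e) \<le> comparison_const * (cmod (ext m (A (J u v))) * cmod (mu l l' (A (j e))))"
    "cmod (ext m (A (J u v))) * cmod (mu l l' (A (j e))) \<le> comparison_const * (cmod (mu l l' (A (J u v))) * cmod (k m e))"
proof -
  define C where "C = (1 + \<theta>) / (1 - \<theta>)"
  have C: "0 \<le> C" using \<theta> by (simp add: C_def)
  have uK: "u \<in> K" "e \<in> K" and md: "m \<in> Kd" using u e M_subset[OF m] by auto
  note comp = matrix_comparison[OF _ \<theta>, folded C_def]
  define X Xu Xe Lx Lu Le Mx Mu Me where
    "X = cmod (mu l l' (A (J u v)))" "Xu = cmod (k l u + \<i> * k l' u)" "Xe = cmod (mu l l' (A (j e)))"
    "Lx = cmod (k l u + \<i> * k l v)" "Lu = cmod (k l u)" "Le = cmod (k l e)"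
    "Mx = cmod (k m u + \<i> * k m v)" "Mu = cmod (k m u)" "Me = cmod (k m e)"
  note D = this
  have Xe: "Xe = cmod (k l e + \<i> * k l' e)" using mu_A_J[of l l' e 0] by (simp add: D j_simps k_simps)
  have 4: "X * Lu \<le> C * (Lx * Xu)" "Lx * Xu \<le> C * (X * Lu)"
    using comp(5,6)[OF matrix_bound_rows_cols(1)[OF uK(1) v l]] by (simp_all add: D mu_A_J flip: norm_mult)
  have 3: "Xu * Le \<le> C * (Lu * Xe)" "Lu * Xe \<le> C * (Xu * Le)"
    using comp(3,4)[OF matrix_bound_rows_cols(2)[OF uK l]] unfolding Xe by (simp_all add: D mult.commute flip: norm_mult)
  have 2: "Lx * Mu \<le> C * (Mx * Lu)" "Mx * Lu \<le> C * (Lx * Mu)"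
    using comp(3,4)[OF matrix_bound_rows_cols(1)[OF uK(1) v l(1) md]] by (simp_all add: D flip: norm_mult)
  have 1: "Lu * Me \<le> C * (Mu * Le)" "Mu * Le \<le> C * (Lu * Me)"
    using comp(1,2)[OF matrix_bound_rows_cols(1)[OF uK l(1) md]] by (simp_all add: D flip: norm_mult)
  have nn: "0 \<le> X" "0 \<le> Xu" "0 \<le> Xe" "0 \<le> Lx" "0 \<le> Mx" "0 \<le> Me" "0 < Le" "0 < Mu" "0 \<le> Lu"
    using le k_generator_nonzero[OF u m] by (simp_all add: D)
  have "0 < Mu * Le" using nn by simp
  with 1(2) have "Lu \<noteq> 0" by auto
  with nn have Lu: "0 < Lu" by simp
  have "X * Me \<le> C ^ 4 * (Mx * Xe)"
    by (rule comparison_chain[OF 4(1) 3(1) 2(1) 1(1) C]) (use nn Lu in auto)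
  thus "cmod (mu l l' (A (J u v))) * cmod (k m e) \<le> comparison_const * (cmod (ext m (A (J u v))) * cmod (mu l l' (A (j e))))"
    by (simp add: D comparison_const_def C_def ext_A_J)
  have "Mx * Xe \<le> C ^ 4 * (X * Me)"
    by (rule comparison_chain'[OF 4(2) 3(2) 2(2) 1(2) C]) (use nn Lu in auto)
  thus "cmod (ext m (A (J u v))) * cmod (mu l l' (A (j e))) \<le> comparison_const * (cmod (mu l l' (A (J u v))) * cmod (k m e))"
    by (simp add: D comparison_const_def C_def ext_A_J)
qed

text \<open>A functional \<open>l\<close> with \<open>k l e = 0\<close> annihilates the whole image of the cone under \<open>A\<close>. Such \<open>l\<close> can
  occur in the dual cone, as weak-* limits of combinations of \<open>M\<close>.\<close>

lemma k_zero_propagates: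
  assumes l: "l \<in> Kd" and e: "e \<in> K - {0}" "k l e = 0" and p: "p \<in> K" and m: "m \<in> M"
  shows "k l p = 0"
proof -
  have "cmod (k l p * k m e) \<le> (1 + \<theta>) / (1 - \<theta>) * cmod (k m p * k l e)"
    using matrix_comparison(1)[OF matrix_bound_rows_cols(1)[OF p _ l M_subset[OF m], of e] \<theta>] e by simp
  thus ?thesis using e k_generator_nonzero[OF e(1) m] by simp
qed

text \<open>In the order, \<open>A\<close> looks like an operator of rank one: up to a constant, \<open>\<bar>\<mu> (A x)\<bar>\<close> is a product of a
  function of \<open>\<mu>\<close> and a function of \<open>x\<close>. The degenerate cases are removed by multiplying \<open>x\<close> by \<open>\<i>\<close> if
  \<open>u = 0\<close>, and by dropping \<open>l\<close> if it annihilates the image.\<close>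

lemma rank_one_comparison:
  assumes x: "x \<in> Kc" and l: "l \<in> Kd" "l' \<in> Kd" and m: "m \<in> M" and e: "e \<in> K - {0}"
  shows "cmod (mu l l' (A x)) * cmod (k m e) \<le> comparison_const * (cmod (ext m (A x)) * cmod (mu l l' (A (j e))))
    \<and> cmod (ext m (A x)) * cmod (mu l l' (A (j e))) \<le> comparison_const * (cmod (mu l l' (A x)) * cmod (k m e))"
proof (cases "x = 0")
  case True
  thus ?thesis by (simp add: A_simps mu_def)
next
  case x0: False
  obtain \<zeta> u v where x': "cmod \<zeta> = 1" "u \<in> K" "v \<in> K" "x = \<zeta> *\<^sub>C J u v" "u \<noteq> 0"
  proof -
    obtain \<zeta> u v where *: "cmod \<zeta> = 1" "u \<in> K" "v \<in> K" "x = \<zeta> *\<^sub>C J u v" using Kc_cases[OF x] by metis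
    show thesis
    proof (cases "u = 0")
      case True
      have "J 0 v = \<i> *\<^sub>C J v 0" by (simp add: J_def j_simps)
      hence "x = (\<zeta> * \<i>) *\<^sub>C J v 0" using * True by (simp add: scaleC_scaleC)
      moreover have "v \<noteq> 0" using * True x0 by auto
      ultimately show thesis using that[of "\<zeta> * \<i>" v 0] * K_simps(2) by (simp add: norm_mult)
    qed (use * that in blast)
  qed
  have Ax: "cmod (ext m (A x)) = cmod (ext m (A (J u v)))" "cmod (mu l l' (A x)) = cmod (mu l l' (A (J u v)))"
    using x' by (simp_all add: A_simps cext_scaleC mu_linear norm_mult)
  show ?thesis
  proof (cases "k l e = 0")
    case False
    thus ?thesis unfolding Ax using rank_one_comparison_nondegenerate[OF _ x'(3) l m e] x' by simp
  next
    case True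
    have 0: "k l p = 0" if "p \<in> K" for p using k_zero_propagates[OF l(1) e True that m] .
    have J: "mu l l' (A (J u v)) = \<i> * mu l' 0 (A (J u v))" "mu l l' (A (j e)) = \<i> * mu l' 0 (A (j e))"
      using mu_A_J[of l l' u v] mu_A_J[of l' 0 u v] mu_A_J[of l l' e 0] mu_A_J[of l' 0 e 0] 0 x' e
      by (simp_all add: mu_linear ext_A_J k_def[symmetric] k_simps algebra_simps)
    show ?thesis
    proof (cases "k l' e = 0")
      case True
      hence "k l' p = 0" if "p \<in> K" for p using k_zero_propagates[OF l(2) e _ that m] by simp
      hence "mu l l' (A (J u v)) = 0" "mu l l' (A (j e)) = 0" using x' e by (simp_all add: J mu_linear ext_A_J k_def[symmetric])
      thus ?thesis unfolding Ax by simp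
    next
      case False
      thus ?thesis unfolding Ax J norm_mult norm_ii mult_1
        using rank_one_comparison_nondegenerate[OF _ x'(3) l(2) dual_cone_closed(1) m e] x' by simp
    qed
  qed
qed

lemma cross_ratio_bound:
  assumes x: "x \<in> Kc" and y: "y \<in> Kc" and p: "p \<in> Kd" "p' \<in> Kd" and q: "q \<in> Kd" "q' \<in> Kd" and m: "m \<in> M" and e: "e \<in> K - {0}"
  shows "cmod (mu p p' (A x)) * cmod (mu q q' (A y)) \<le> comparison_const ^ 4 * (cmod (mu q q' (A x)) * cmod (mu p p' (A y)))"
proof -
  define a where "a = cmod (k m e)"
  have a: "0 < a" using k_generator_nonzero[OF e m] by (simp add: a_def)
  define X Y fp fq where "X = cmod (ext m (A x))" and "Y = cmod (ext m (A y))"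
    and "fp = cmod (mu p p' (A (j e)))" and "fq = cmod (mu q q' (A (j e)))"
  note D = X_def Y_def fp_def fq_def a_def
  have c: "0 \<le> comparison_const" using comparison_const by simp
  have 1: "cmod (mu p p' (A x)) * a \<le> comparison_const * (X * fp)" "cmod (mu q q' (A y)) * a \<le> comparison_const * (Y * fq)"
    "X * fq \<le> comparison_const * (cmod (mu q q' (A x)) * a)" "Y * fp \<le> comparison_const * (cmod (mu p p' (A y)) * a)"
    using rank_one_comparison[OF x p m e] rank_one_comparison[OF y q m e] rank_one_comparison[OF x q m e]
      rank_one_comparison[OF y p m e] by (simp_all add: D)
  have "(cmod (mu p p' (A x)) * a) * (cmod (mu q q' (A y)) * a) \<le> (comparison_const * (X * fp)) * (comparison_const * (Y * fq))"
    by (rule mult_mono[OF 1(1,2)]) (use c a in \<open>auto simp: D\<close>)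
  also have "\<dots> = comparison_const\<^sup>2 * ((X * fq) * (Y * fp))" by (simp add: power2_eq_square mult_ac)
  also have "\<dots> \<le> comparison_const\<^sup>2 * ((comparison_const * (cmod (mu q q' (A x)) * a)) * (comparison_const * (cmod (mu p p' (A y)) * a)))"
    by (rule mult_left_mono[OF mult_mono[OF 1(3,4)]]) (use c a in \<open>auto simp: D\<close>)
  finally have "(a * a) * (cmod (mu p p' (A x)) * cmod (mu q q' (A y))) \<le>
    (a * a) * (comparison_const ^ 4 * (cmod (mu q q' (A x)) * cmod (mu p p' (A y))))"
    by (simp add: power2_eq_square power4_eq_xxxx mult_ac)
  thus ?thesis using a by simp
qed

end

section \<open>Contraction\<close>

text \<open>The estimate of Birkhoff in linear form: if the cross ratio of \<open>r\<^sub>1\<close>, \<open>r\<^sub>2\<close> with the end points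
  of \<open>[a, b]\<close> is at most \<open>C\<close>, then \<open>r\<^sub>1 - r\<^sub>2\<close> is a definite fraction shorter than \<open>b - a\<close>.\<close>

lemma cross_ratio_contraction:
  fixes a b r1 r2 C :: real
  assumes "a \<le> r2" "r1 \<le> b" "(r1 - a) * (b - r2) \<le> C * ((r2 - a) * (b - r1))" "1 \<le> C"
  shows "r1 - r2 \<le> (1 - 1 / (1 + C)) * (b - a)"
proof (rule ccontr)
  define L s t where "L = b - a" and "s = r2 - a" and "t = b - r1"
  assume "\<not> ?thesis"
  hence st: "(s + t) * (1 + C) < L"
    using assms by (simp add: L_def s_def t_def field_simps)
  have nn: "0 \<le> s" "0 \<le> t" using assms by (simp_all add: s_def t_def)
  have L: "0 < L" using st nn assms by (smt (verit) mult_nonneg_nonneg)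
  have "(L - t) * (L - s) \<le> C * (s * t)" using assms by (simp add: L_def s_def t_def)
  have sL: "s + t \<le> L / (1 + C)" using st assms by (simp add: field_simps)
  have Lt: "C * L / (1 + C) \<le> L - t - s" using sL assms by (simp add: field_simps)
  have "C * (s * t) \<le> C * ((L / (1 + C)) * (L / (1 + C)))"
    using nn sL assms by (intro mult_left_mono mult_mono) auto
  also have "\<dots> = (C * L / (1 + C)) * (L / (1 + C))" by simp
  also have "\<dots> < (C * L / (1 + C)) * L"
    using L assms by (intro mult_strict_left_mono) (auto simp: field_simps)
  also have "\<dots> \<le> (L - t - s) * L" using Lt L by (intro mult_right_mono) auto
  also have "\<dots> \<le> (L - t) * (L - s)" using nn by (simp add: algebra_simps)
  finally show False using \<open>(L - t) * (L - s) \<le> C * (s * t)\<close> by simp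
qed

context cone_contraction
begin

lemma in_annulus_m:
  assumes "in_annulus a b x y" "l \<in> Kd"
  shows "a * cmod (ext l y) \<le> cmod (ext l x)" "cmod (ext l x) \<le> b * cmod (ext l y)"
  using assms dual_cone_closed(1) unfolding in_annulus_def by (metis mu_linear(4))+

lemma in_annulus_initial:
  assumes x: "x \<in> Kc - {0}" and y: "y \<in> Kc - {0}" and m: "m \<in> M" and e: "e \<in> K - {0}"
  defines "r \<equiv> cmod (ext m (A x)) / cmod (ext m (A y))"
  shows "in_annulus (r / comparison_const ^ 4) (comparison_const ^ 4 * r) (A x) (A y)"
  unfolding in_annulus_def
proof (intro ballI conjI)
  fix p q assume p: "p \<in> Kd" "q \<in> Kd"
  note md = M_subset[OF m]
  have X: "0 < cmod (ext m (A x))" and Y: "0 < cmod (ext m (A y))"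
    using ext_A_generator_nonzero x y m by auto
  have C: "0 < comparison_const ^ 4" using comparison_const by simp
  have "cmod (mu m 0 (A x)) * cmod (mu p q (A y)) \<le> comparison_const ^ 4 * (cmod (mu p q (A x)) * cmod (mu m 0 (A y)))"
    using x y by (intro cross_ratio_bound[OF _ _ md dual_cone_closed(1) p m e]) auto
  thus "r / comparison_const ^ 4 * cmod (mu p q (A y)) \<le> cmod (mu p q (A x))"
    using Y C by (simp add: r_def mu_linear field_simps)
  have "cmod (mu p q (A x)) * cmod (mu m 0 (A y)) \<le> comparison_const ^ 4 * (cmod (mu m 0 (A x)) * cmod (mu p q (A y)))"
    using x y by (intro cross_ratio_bound[OF _ _ p md dual_cone_closed(1) m e]) auto
  thus "cmod (mu p q (A x)) \<le> comparison_const ^ 4 * r * cmod (mu p q (A y))"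
    using Y C by (simp add: r_def mu_linear field_simps)
qed

definition contraction_rate :: real where "contraction_rate = 1 - 1 / (1 + comparison_const ^ 4)"

lemma contraction_rate: "0 < contraction_rate" "contraction_rate < 1"
proof -
  have "0 < comparison_const ^ 4" using comparison_const by simp
  thus "0 < contraction_rate" "contraction_rate < 1" unfolding contraction_rate_def by (auto simp: field_simps add_pos_pos)
qed

text \<open>For \<open>\<bar>z1\<bar> \<le> a\<close> and \<open>\<bar>z2\<bar> \<ge> b\<close> both \<open>x - z1 y\<close> and \<open>x - z2 y\<close> lie in the cone, so two quotients
  \<open>\<alpha>\<close>, \<open>\<beta>\<close> of values at \<open>A x\<close> and \<open>A y\<close> have a bounded cross ratio with \<open>z1\<close> and \<open>z2\<close>. Choosing the
  phases of \<open>z1\<close> and \<open>z2\<close> so that \<open>\<beta>\<close>, \<open>z1\<close> and \<open>\<alpha>\<close>, \<open>z2\<close> are aligned reduces the estimate to the real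
  one for the moduli.\<close>

lemma in_annulus_contraction:
  assumes x: "x \<in> Kc - {0}" and y: "y \<in> Kc - {0}" and m: "m \<in> M" and e: "e \<in> K - {0}"
    and an: "in_annulus a b x y" and a: "0 < a" "a \<le> b"
  obtains a' b' where "in_annulus a' b' (A x) (A y)" "a \<le> a'" "a' \<le> b'" "b' \<le> b" "b' - a' \<le> contraction_rate * (b - a)"
proof -
  \<comment> \<open>The functionals outside \<open>F\<close> annihilate the image of the cone under \<open>A\<close>.\<close>
  define F where "F = {(p, p'). p \<in> Kd \<and> p' \<in> Kd \<and> mu p p' (A (j e)) \<noteq> 0}"
  define r where "r = (\<lambda>(p, p'). cmod (mu p p' (A x)) / cmod (mu p p' (A y)))"
  have me: "0 < cmod (k m e)" using k_generator_nonzero[OF e m] by simp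
  have xy: "x \<in> Kc" "y \<in> Kc" using x y by auto
  have C: "1 \<le> comparison_const" "1 \<le> comparison_const ^ 4" using comparison_const by (auto intro: one_le_power)
  have nz: "mu p p' (A z) \<noteq> 0" if "(p, p') \<in> F" "z \<in> Kc - {0}" for p p' z
  proof
    assume "mu p p' (A z) = 0"
    hence "cmod (ext m (A z)) * cmod (mu p p' (A (j e))) \<le> 0"
      using rank_one_comparison[of z p p' m e] that m e by (auto simp: F_def)
    thus False using that ext_A_generator_nonzero[OF that(2) m] by (auto simp: F_def mult_le_0_iff)
  qed
  have z0: "mu p p' (A z) = 0" if "p \<in> Kd" "p' \<in> Kd" "(p, p') \<notin> F" "z \<in> Kc" for p p' z
  proof -
    have "cmod (mu p p' (A z)) * cmod (k m e) \<le> 0"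
      using rank_one_comparison[of z p p' m e] that m e by (auto simp: F_def)
    thus ?thesis using me by (auto simp: mult_le_0_iff)
  qed
  have mF: "(m, 0) \<in> F" using me M_subset[OF m] dual_cone_closed(1) by (simp add: F_def mu_linear k_def)
  have pencil: "x - z *\<^sub>C y \<in> Kc" if z: "cmod z \<le> a \<or> b \<le> cmod z" for z
  proof -
    \<comment> \<open>The boundary cases \<open>\<bar>z\<bar> = a\<close> and \<open>\<bar>z\<bar> = b\<close> follow by approximation, since \<open>Kc\<close> is closed.\<close>
    define s :: "nat \<Rightarrow> real" where "s n = (if cmod z \<le> a then 1 - inverse (real (Suc n)) else 1 + inverse (real (Suc n)))" for n
    have s: "cmod (of_real (s n) * z) < a \<or> b < cmod (of_real (s n) * z)" for n
    proof (cases "cmod z \<le> a")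
      case True
      have i: "0 < inverse (real (Suc n))" "inverse (real (Suc n)) \<le> 1" by (simp_all add: field_simps)
      hence "\<bar>s n\<bar> < 1" "0 \<le> \<bar>s n\<bar>" using True by (simp_all add: s_def)
      hence "\<bar>s n\<bar> * cmod z < a" using True a(1)
        by (cases "z = 0") (auto intro: le_less_trans[OF mult_left_mono] simp: mult_less_cancel_right2 less_le_trans[OF _ True])
      thus ?thesis by (simp add: norm_mult)
    next
      case False
      hence "b \<le> cmod z" using z by simp
      moreover have "1 < s n" using False by (simp add: s_def)
      moreover have "0 < cmod z" using False a by linarith
      ultimately have "b < s n * cmod z" by (smt (verit) mult_less_cancel_right1)
      thus ?thesis using \<open>1 < s n\<close> by (simp add: norm_mult)
    qed
    have "s \<longlonglongrightarrow> 1"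
    proof (cases "cmod z \<le> a")
      case True
      have "(\<lambda>n. 1 - inverse (real (Suc n))) \<longlonglongrightarrow> 1 - 0" by (intro tendsto_intros LIMSEQ_inverse_real_of_nat)
      thus ?thesis using True by (simp add: s_def[abs_def])
    next
      case False
      have "(\<lambda>n. 1 + inverse (real (Suc n))) \<longlonglongrightarrow> 1 + 0" by (intro tendsto_intros LIMSEQ_inverse_real_of_nat)
      thus ?thesis using False by (simp add: s_def[abs_def])
    qed
    hence "(\<lambda>n. x - (of_real (s n) * z) *\<^sub>C y) \<longlonglongrightarrow> x - (of_real 1 * z) *\<^sub>C y"
      by (intro tendsto_intros bounded_linear.tendsto[OF bounded_linear_scaleC_left])
    moreover have "x - (of_real (s n) * z) *\<^sub>C y \<in> Kc" for n using in_annulus_pencil[OF xy an s] .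
    ultimately show ?thesis using closed_sequentially[OF closed_Kc] by force
  qed
  have range: "a \<le> r P \<and> r P \<le> b" if P: "P \<in> F" for P
  proof -
    obtain p p' where P': "P = (p, p')" by fastforce
    define z where "z = mu p p' (A x) / mu p p' (A y)"
    have y0: "mu p p' (A y) \<noteq> 0" using nz P P' y by auto
    have "mu p p' (A (x - z *\<^sub>C y)) = 0" using y0 by (simp add: A_simps mu_linear z_def)
    hence "\<not> (x - z *\<^sub>C y \<in> Kc - {0})" using nz[of p p' "x - z *\<^sub>C y"] P P' by blast
    moreover have "x - z *\<^sub>C y \<noteq> 0 \<or> (a \<le> cmod z \<and> cmod z \<le> b)"
    proof (rule disjCI)
      assume "\<not> (a \<le> cmod z \<and> cmod z \<le> b)"
      moreover have "\<not> (cmod z < a \<or> b < cmod z)" if "x - z *\<^sub>C y = 0"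
      proof -
        from that have xz: "x = z *\<^sub>C y" by simp
        obtain l where l: "l \<in> Kd" "ext l y \<noteq> 0" using ext_separates[of y] y by auto
        have "a * cmod (ext l y) \<le> cmod z * cmod (ext l y)" "cmod z * cmod (ext l y) \<le> b * cmod (ext l y)"
          using in_annulus_m[OF an l(1)] by (simp_all add: xz cext_scaleC norm_mult)
        thus ?thesis using l by simp
      qed
      ultimately show "x - z *\<^sub>C y \<noteq> 0" by auto
    qed
    ultimately have "a \<le> cmod z \<and> cmod z \<le> b" using in_annulus_pencil[OF xy an, of z] by force
    thus ?thesis by (simp add: r_def P' z_def norm_divide)
  qed
  have osc: "r P1 - r P2 \<le> contraction_rate * (b - a)" if P: "P1 \<in> F" "P2 \<in> F" for P1 P2
  proof -
    obtain p p' s s' where PP: "P1 = (p, p')" "P2 = (s, s')" by fastforce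
    have Kd: "p \<in> Kd" "p' \<in> Kd" "s \<in> Kd" "s' \<in> Kd" using P by (auto simp: PP F_def)
    define \<alpha> \<beta> where "\<alpha> = mu p p' (A x) / mu p p' (A y)" and "\<beta> = mu s s' (A x) / mu s s' (A y)"
    have y0: "mu p p' (A y) \<noteq> 0" "mu s s' (A y) \<noteq> 0" using nz P PP y by auto
    have rr: "r P1 = cmod \<alpha>" "r P2 = cmod \<beta>" by (simp_all add: r_def PP \<alpha>_def \<beta>_def norm_divide)
    have ab: "a \<le> cmod \<alpha>" "cmod \<alpha> \<le> b" "a \<le> cmod \<beta>" "cmod \<beta> \<le> b" using range[OF P(1)] range[OF P(2)] unfolding rr by blast+
    define z1 z2 where "z1 = of_real a * sgn \<beta>" and "z2 = of_real b * sgn \<alpha>"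
    have z: "cmod z1 = a" "cmod z2 = b" using a ab by (auto simp: z1_def z2_def norm_mult norm_sgn)
    have pol: "of_real (cmod w) * sgn w = w" for w :: complex
      by (cases "w = 0") (simp_all add: sgn_div_norm scaleR_conv_of_real)
    have "\<beta> - z1 = of_real (cmod \<beta> - a) * sgn \<beta>" "\<alpha> - z2 = of_real (cmod \<alpha> - b) * sgn \<alpha>"
      by (simp_all only: z1_def z2_def of_real_diff left_diff_distrib pol)
    moreover have "cmod (sgn \<alpha>) = 1" "cmod (sgn \<beta>) = 1" using a ab by (auto simp: norm_sgn)
    ultimately have ex: "cmod (\<beta> - z1) = cmod \<beta> - a" "cmod (\<alpha> - z2) = b - cmod \<alpha>"
      using ab by (simp_all only: norm_mult norm_of_real) auto
    have lb: "cmod \<alpha> - a \<le> cmod (\<alpha> - z1)" "b - cmod \<beta> \<le> cmod (\<beta> - z2)"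
      using norm_triangle_ineq2[of \<alpha> z1] norm_triangle_ineq2[of z2 \<beta>] z by (auto simp: norm_minus_commute)
    have val: "mu p p' (A (x - z *\<^sub>C y)) = mu p p' (A y) * (\<alpha> - z)" "mu s s' (A (x - z *\<^sub>C y)) = mu s s' (A y) * (\<beta> - z)" for z
      using y0 by (simp_all add: A_simps mu_linear \<alpha>_def \<beta>_def field_simps)
    have "cmod (mu p p' (A (x - z1 *\<^sub>C y))) * cmod (mu s s' (A (x - z2 *\<^sub>C y)))
      \<le> comparison_const ^ 4 * (cmod (mu s s' (A (x - z1 *\<^sub>C y))) * cmod (mu p p' (A (x - z2 *\<^sub>C y))))"
      using z by (intro cross_ratio_bound[OF _ _ Kd m e] pencil) auto
    hence "(cmod (mu p p' (A y)) * cmod (mu s s' (A y))) * (cmod (\<alpha> - z1) * cmod (\<beta> - z2))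
      \<le> (cmod (mu p p' (A y)) * cmod (mu s s' (A y))) * (comparison_const ^ 4 * (cmod (\<beta> - z1) * cmod (\<alpha> - z2)))"
      by (simp add: val norm_mult mult_ac)
    moreover have "0 < cmod (mu p p' (A y)) * cmod (mu s s' (A y))" using y0 by simp
    ultimately have "cmod (\<alpha> - z1) * cmod (\<beta> - z2) \<le> comparison_const ^ 4 * ((cmod \<beta> - a) * (b - cmod \<alpha>))"
      unfolding ex by (rule mult_left_le_imp_le)
    moreover have "(cmod \<alpha> - a) * (b - cmod \<beta>) \<le> cmod (\<alpha> - z1) * cmod (\<beta> - z2)"
      using lb ab by (intro mult_mono) auto
    ultimately have "(cmod \<alpha> - a) * (b - cmod \<beta>) \<le> comparison_const ^ 4 * ((cmod \<beta> - a) * (b - cmod \<alpha>))" by simp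
    thus ?thesis unfolding rr contraction_rate_def using ab C by (intro cross_ratio_contraction) auto
  qed
  define a' b' where "a' = (INF P\<in>F. r P)" and "b' = (SUP P\<in>F. r P)"
  have ne: "F \<noteq> {}" using mF by auto
  have bdd: "bdd_below (r ` F)" "bdd_above (r ` F)" using range by (auto intro!: bdd_belowI2 bdd_aboveI2)
  have in': "a' \<le> r P" "r P \<le> b'" if "P \<in> F" for P
    using that bdd by (auto simp: a'_def b'_def intro: cINF_lower cSUP_upper)
  show ?thesis
  proof (rule that[of a' b'])
    show "a \<le> a'" unfolding a'_def using range ne by (intro cINF_greatest) auto
    show "b' \<le> b" unfolding b'_def using range ne by (intro cSUP_least) auto
    show "a' \<le> b'" using in'[OF mF] by simp
    have "r P1 - contraction_rate * (b - a) \<le> a'" if "P1 \<in> F" for P1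
      unfolding a'_def using ne osc[OF that] by (intro cINF_greatest) (auto simp: algebra_simps)
    hence "r P1 \<le> a' + contraction_rate * (b - a)" if "P1 \<in> F" for P1 using that by (smt (verit))
    hence "b' \<le> a' + contraction_rate * (b - a)" unfolding b'_def using ne by (intro cSUP_least)
    thus "b' - a' \<le> contraction_rate * (b - a)" by simp
    show "in_annulus a' b' (A x) (A y)"
      unfolding in_annulus_def
    proof (intro ballI)
      fix p p' assume p: "p \<in> Kd" "p' \<in> Kd"
      show "a' * cmod (mu p p' (A y)) \<le> cmod (mu p p' (A x)) \<and> cmod (mu p p' (A x)) \<le> b' * cmod (mu p p' (A y))"
      proof (cases "(p, p') \<in> F")
        case True
        hence "0 < cmod (mu p p' (A y))" using nz y by simp
        thus ?thesis using in'[OF True] by (simp add: r_def field_simps)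
      next
        case False
        thus ?thesis using z0 p xy by simp
      qed
    qed
  qed
qed

lemma A_pow_Kc: "x \<in> Kc - {0} \<Longrightarrow> (A ^^ n) x \<in> Kc - {0}"
proof (induction n)
  case (Suc n)
  have "M \<noteq> {}"
  proof
    assume "M = {}"
    thus False using ext_nonzero_generator[OF M, of x] Suc by auto
  qed
  then obtain m where "m \<in> M" by auto
  hence "A ((A ^^ n) x) \<noteq> 0" using ext_A_generator_nonzero[OF Suc.IH] Suc.prems by force
  thus ?case using Suc A_Kc by auto
qed simp

lemma in_annulus_iterates:
  assumes x: "x \<in> Kc - {0}" and y: "y \<in> Kc - {0}" and m: "m \<in> M" and e: "e \<in> K - {0}"
  defines "r \<equiv> cmod (ext m (A x)) / cmod (ext m (A y))"
  obtains a b where "in_annulus a b ((A ^^ Suc n) x) ((A ^^ Suc n) y)" "r / comparison_const ^ 4 \<le> a" "a \<le> b" "b \<le> comparison_const ^ 4 * r"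
    "b - a \<le> contraction_rate ^ n * (comparison_const ^ 4 * r)"
proof -
  have r: "0 < r" using ext_A_generator_nonzero x y m by (simp add: r_def)
  have C: "1 \<le> comparison_const ^ 4" using comparison_const by (auto intro: one_le_power)
  have le: "r / comparison_const ^ 4 \<le> comparison_const ^ 4 * r"
  proof -
    have "r / comparison_const ^ 4 \<le> r / 1" using r C by (intro divide_left_mono) auto
    also have "\<dots> \<le> comparison_const ^ 4 * r" using r C by simp
    finally show ?thesis .
  qed
  have "\<exists>a b. in_annulus a b ((A ^^ Suc n) x) ((A ^^ Suc n) y) \<and> r / comparison_const ^ 4 \<le> a \<and> a \<le> b \<and> b \<le> comparison_const ^ 4 * r
    \<and> b - a \<le> contraction_rate ^ n * (comparison_const ^ 4 * r)"
  proof (induction n)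
    case 0
    have "0 \<le> r / comparison_const ^ 4" using r C by simp
    thus ?case using in_annulus_initial[OF x y m e, folded r_def] le
      by (intro exI[of _ "r / comparison_const ^ 4"] exI[of _ "comparison_const ^ 4 * r"]) simp
  next
    case (Suc n)
    then obtain a b where ab: "in_annulus a b ((A ^^ Suc n) x) ((A ^^ Suc n) y)" "r / comparison_const ^ 4 \<le> a" "a \<le> b" "b \<le> comparison_const ^ 4 * r"
      "b - a \<le> contraction_rate ^ n * (comparison_const ^ 4 * r)" by blast
    have "0 < r / comparison_const ^ 4" using r C by (intro divide_pos_pos) linarith+
    hence "0 < a" using ab by simp
    obtain a' b' where ab': "in_annulus a' b' (A ((A ^^ Suc n) x)) (A ((A ^^ Suc n) y))" "a \<le> a'" "a' \<le> b'" "b' \<le> b"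
      "b' - a' \<le> contraction_rate * (b - a)"
      using in_annulus_contraction[OF A_pow_Kc[OF x] A_pow_Kc[OF y] m e ab(1) \<open>0 < a\<close> ab(3)] by blast
    have "contraction_rate * (b - a) \<le> contraction_rate * (contraction_rate ^ n * (comparison_const ^ 4 * r))" using ab contraction_rate by (intro mult_left_mono) auto
    thus ?case using ab ab' by (intro exI[of _ a'] exI[of _ b']) (simp add: mult.assoc)
  qed
  thus ?thesis using that by blast
qed

text \<open>The form in which the contraction is used. The second estimate is uniform in \<open>n\<close> because the annuli
  of the iterates are nested.\<close>

lemma normalized_iterates_contract:
  assumes m: "m \<in> M" and e: "e \<in> K - {0}"
  obtains G where "0 < G"
    "\<And>x y n. x \<in> Kc - {0} \<Longrightarrow> y \<in> Kc - {0} \<Longrightarrow>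
      norm ((A ^^ Suc n) x - (ext m ((A ^^ Suc n) x) / ext m ((A ^^ Suc n) y)) *\<^sub>C (A ^^ Suc n) y)
       \<le> G * contraction_rate ^ n * cmod (ext m ((A ^^ Suc n) x) / ext m ((A ^^ Suc n) y)) * norm ((A ^^ Suc n) y)"
    "\<And>x y n. x \<in> Kc - {0} \<Longrightarrow> y \<in> Kc - {0} \<Longrightarrow>
      cmod (ext m (A x)) / cmod (ext m (A y)) / G \<le> cmod (ext m ((A ^^ Suc n) x)) / cmod (ext m ((A ^^ Suc n) y))
      \<and> cmod (ext m ((A ^^ Suc n) x)) / cmod (ext m ((A ^^ Suc n) y)) \<le> G * (cmod (ext m (A x)) / cmod (ext m (A y)))"
proof -
  obtain C where C: "0 < C" "\<And>x y a b m. x \<in> Kc \<Longrightarrow> y \<in> Kc \<Longrightarrow> m \<in> Kd \<Longrightarrow> ext m y \<noteq> 0 \<Longrightarrow> a \<le> b \<Longrightarrow> in_annulus a b x y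
      \<Longrightarrow> norm (x - (ext m x / ext m y) *\<^sub>C y) \<le> C * (b - a) * norm y"
    using in_annulus_norm_bound by blast
  define B where "B = comparison_const ^ 4"
  have B: "1 \<le> B" using comparison_const by (auto simp: B_def intro: one_le_power)
  define G where "G = max B (C * B * B)"
  show ?thesis
  proof (rule that[of G])
    show G: "0 < G" using B by (simp add: G_def)
    fix x y n assume x: "x \<in> Kc - {0}" and y: "y \<in> Kc - {0}"
    define X Y where "X = (A ^^ Suc n) x" and "Y = (A ^^ Suc n) y"
    have XY: "X \<in> Kc" "Y \<in> Kc" using A_pow_Kc x y unfolding X_def Y_def by blast+
    have X0: "ext m X \<noteq> 0" and Y0: "ext m Y \<noteq> 0"
      using ext_A_generator_nonzero[OF A_pow_Kc[OF x] m] ext_A_generator_nonzero[OF A_pow_Kc[OF y] m]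
      by (simp_all add: X_def Y_def)
    define r where "r = cmod (ext m (A x)) / cmod (ext m (A y))"
    have r: "0 < r" using ext_A_generator_nonzero x y m by (simp add: r_def)
    obtain a b where ab: "in_annulus a b X Y" "r / B \<le> a" "a \<le> b" "b \<le> B * r" "b - a \<le> contraction_rate ^ n * (B * r)"
      using in_annulus_iterates[OF x y m e] unfolding X_def Y_def r_def B_def by metis
    define c where "c = cmod (ext m X) / cmod (ext m Y)"
    have c: "a \<le> c" "c \<le> b" using in_annulus_m[OF ab(1) M_subset[OF m]] Y0 by (simp_all add: c_def field_simps)
    have BG: "B \<le> G" "C * B * B \<le> G" by (auto simp: G_def)
    have "r / G \<le> r / B" using r B BG G by (intro divide_left_mono) auto
    moreover have "B * r \<le> G * r" using BG r by (intro mult_right_mono) auto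
    ultimately show "cmod (ext m (A x)) / cmod (ext m (A y)) / G \<le> cmod (ext m ((A ^^ Suc n) x)) / cmod (ext m ((A ^^ Suc n) y))
      \<and> cmod (ext m ((A ^^ Suc n) x)) / cmod (ext m ((A ^^ Suc n) y)) \<le> G * (cmod (ext m (A x)) / cmod (ext m (A y)))"
      using c ab unfolding c_def r_def X_def Y_def by linarith
    have "r \<le> B * c" using ab(2) c B by (simp add: field_simps) (smt (verit) mult_left_mono)
    have "norm (X - (ext m X / ext m Y) *\<^sub>C Y) \<le> C * (b - a) * norm Y"
      by (rule C(2)[OF XY M_subset[OF m] Y0 ab(3,1)])
    also have "\<dots> \<le> C * (contraction_rate ^ n * (B * (B * c))) * norm Y"
    proof -
      have "b - a \<le> contraction_rate ^ n * (B * r)" by (rule ab)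
      also have "\<dots> \<le> contraction_rate ^ n * (B * (B * c))" using \<open>r \<le> B * c\<close> B contraction_rate by (intro mult_left_mono) auto
      finally show ?thesis using C(1) by (intro mult_right_mono mult_left_mono) auto
    qed
    also have "\<dots> = (C * B * B) * (contraction_rate ^ n * c * norm Y)" by (simp add: mult_ac)
    also have "\<dots> \<le> G * (contraction_rate ^ n * c * norm Y)"
      using BG contraction_rate by (intro mult_right_mono) (auto simp: c_def)
    finally have "norm (X - (ext m X / ext m Y) *\<^sub>C Y) \<le> G * (contraction_rate ^ n * c * norm Y)" .
    thus "norm ((A ^^ Suc n) x - (ext m ((A ^^ Suc n) x) / ext m ((A ^^ Suc n) y)) *\<^sub>C (A ^^ Suc n) y)
       \<le> G * contraction_rate ^ n * cmod (ext m ((A ^^ Suc n) x) / ext m ((A ^^ Suc n) y)) * norm ((A ^^ Suc n) y)"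
      unfolding X_def[symmetric] Y_def[symmetric] c_def norm_divide by (simp add: mult.assoc)
  qed
qed

end

section \<open>Spectral radius\<close>

lemma bounded_bilinear_scaleC: "bounded_bilinear (\<lambda>c (x :: 'a::complex_banach). c *\<^sub>C x)"
proof
  show "(r *\<^sub>R a) *\<^sub>C b = r *\<^sub>R a *\<^sub>C b" for r a and b :: 'a
    by (simp only: scaleR_scaleC[of r "a *\<^sub>C b"] scaleC_scaleC scaleR_conv_of_real)
  show "a *\<^sub>C (r *\<^sub>R b) = r *\<^sub>R a *\<^sub>C b" for r a and b :: 'a
    by (simp add: scaleR_scaleC scaleC_scaleC mult.commute)
  show "\<exists>K. \<forall>a (b::'a). norm (a *\<^sub>C b) \<le> norm a * norm b * K"
    by (rule exI[of _ 1]) (simp add: norm_scaleC)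
qed (auto simp: scaleC_add_left scaleC_add_right)

lemmas tendsto_scaleC = bounded_bilinear.tendsto[OF bounded_bilinear_scaleC]

lemma geometric_increments_converge:
  fixes d :: "nat \<Rightarrow> 'a::banach"
  assumes inc: "\<And>n. norm (d (Suc n) - d n) \<le> B * q ^ n" and q: "0 \<le> q" "q < 1"
  obtains l where "d \<longlonglongrightarrow> l" "\<And>n. norm (d n - l) \<le> B / (1 - q) * q ^ n"
proof -
  have "0 \<le> B" using order_trans[OF norm_ge_zero inc[of 0]] by simp
  have diff: "norm (d (n + k) - d n) \<le> B / (1 - q) * q ^ n" for n k
  proof -
    have "norm (d (n + k) - d n) \<le> B / (1 - q) * q ^ n * (1 - q ^ k)"
    proof (induction k)
      case (Suc k)
      have "norm (d (n + Suc k) - d n) \<le> norm (d (Suc (n + k)) - d (n + k)) + norm (d (n + k) - d n)"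
        using norm_triangle_ineq[of "d (Suc (n + k)) - d (n + k)" "d (n + k) - d n"] by simp
      also have "\<dots> \<le> B * q ^ (n + k) + B / (1 - q) * q ^ n * (1 - q ^ k)" using inc[of "n + k"] Suc by simp
      also have "\<dots> = B / (1 - q) * q ^ n * (1 - q ^ Suc k)" using q by (simp add: power_add field_simps)
      finally show ?case .
    qed simp
    also have "\<dots> \<le> B / (1 - q) * q ^ n * 1"
      using q \<open>0 \<le> B\<close> by (intro mult_left_mono) auto
    finally show ?thesis by simp
  qed
  have lim0: "(\<lambda>n. B / (1 - q) * q ^ n) \<longlonglongrightarrow> 0"
    using q by (intro tendsto_mult_right_zero LIMSEQ_power_zero) auto
  have "Cauchy d"
  proof (rule CauchyI)
    fix e :: real assume e: "0 < e"
    obtain N where N: "B / (1 - q) * q ^ N < e / 2"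
      using order_tendstoD(2)[OF lim0, of "e / 2"] e by (auto simp: eventually_sequentially)
    have "norm (d m - d n) < e" if "N \<le> m" "N \<le> n" for m n
    proof -
      have "norm (d m - d N) < e / 2" "norm (d n - d N) < e / 2"
        using order_le_less_trans[OF diff[of N "m - N"] N] order_le_less_trans[OF diff[of N "n - N"] N] that
        by simp_all
      thus ?thesis using norm_triangle_ineq4[of "d m - d N" "d n - d N"] by simp
    qed
    thus "\<exists>N. \<forall>m\<ge>N. \<forall>n\<ge>N. norm (d m - d n) < e" by blast
  qed
  then obtain l where l: "d \<longlonglongrightarrow> l" by (auto simp: Cauchy_convergent_iff convergent_def)
  have "norm (d n - l) \<le> B / (1 - q) * q ^ n" for n
  proof (rule tendsto_upperbound)
    show "(\<lambda>k. norm (d n - d (n + k))) \<longlonglongrightarrow> norm (d n - l)"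
      using LIMSEQ_ignore_initial_segment[OF l, of n] by (intro tendsto_intros) (simp add: add.commute)
    show "\<forall>\<^sub>F k in sequentially. norm (d n - d (n + k)) \<le> B / (1 - q) * q ^ n"
      using diff by (simp add: norm_minus_commute)
  qed simp
  with l that show ?thesis by blast
qed

text \<open>The resolvent is the Neumann series \<open>- (\<Sum>n. T\<^sup>n / z\<^sup>n\<^sup>+\<^sup>1)\<close>, which converges geometrically.\<close>

lemma not_in_spectrum:
  fixes T :: "'x::complex_banach \<Rightarrow> 'x"
  assumes T: "bounded_clinear T" and bound: "\<And>n x. norm ((T ^^ Suc n) x) \<le> C * \<rho> ^ Suc n * norm x"
    and \<rho>: "0 \<le> \<rho>" "\<rho> < cmod z"
  shows "z \<notin> spectrum_op T"
proof -
  note TL = bounded_clinearD[OF T]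
  have z0: "z \<noteq> 0" "0 < cmod z" using \<rho> by auto
  define C' where "C' = max 1 C"
  have C': "1 \<le> C'" by (simp add: C'_def)
  have b: "norm ((T ^^ n) x) \<le> C' * \<rho> ^ n * norm x" for n x
  proof (cases n)
    case 0
    thus ?thesis using C' by (simp add: mult_right_mono[of 1 C' "norm x", simplified])
  next
    case (Suc k)
    have "C * (\<rho> ^ Suc k * norm x) \<le> C' * (\<rho> ^ Suc k * norm x)"
      using \<rho> by (intro mult_right_mono) (auto simp: C'_def)
    thus ?thesis using bound[of k x] Suc by (simp add: mult.assoc)
  qed
  define s where "s n x = (inverse z ^ Suc n) *\<^sub>C ((T ^^ n) x)" for n x
  define t where "t = \<rho> / cmod z"
  have t: "0 \<le> t" "t < 1" using \<rho> z0 by (auto simp: t_def)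
  have ns: "norm (s n x) \<le> C' / cmod z * norm x * t ^ n" for n x
  proof -
    have "norm (s n x) = norm ((T ^^ n) x) / cmod z ^ Suc n"
      by (simp add: s_def norm_scaleC norm_power norm_inverse norm_mult norm_divide divide_inverse power_inverse)
    also have "\<dots> \<le> (C' * \<rho> ^ n * norm x) / cmod z ^ Suc n" by (rule divide_right_mono[OF b]) simp
    also have "\<dots> = C' / cmod z * norm x * t ^ n" using z0 by (simp add: t_def power_divide field_simps)
    finally show ?thesis .
  qed
  have geo: "summable (\<lambda>n. C' / cmod z * norm x * t ^ n)" for x
    using t by (intro summable_mult summable_geometric) auto
  have sumn: "summable (\<lambda>n. norm (s n x))" for x by (rule summable_comparison_test'[OF geo]) (use ns in auto)
  have sum: "summable (\<lambda>n. s n x)" for x by (rule summable_norm_cancel[OF sumn])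
  define R where "R x = - (\<Sum>n. s n x)" for x
  have Tn: "(T ^^ n) (x + y) = (T ^^ n) x + (T ^^ n) y" "(T ^^ n) (c *\<^sub>C x) = c *\<^sub>C (T ^^ n) x" for n x y c
    by (induction n) (simp_all add: TL)
  have s_lin: "s n (x + y) = s n x + s n y" "s n (c *\<^sub>C x) = c *\<^sub>C s n x" for n x y c
    by (simp_all add: s_def Tn scaleC_add_right scaleC_scaleC mult_ac)
  have R_add: "R (x + y) = R x + R y" for x y
    by (simp add: R_def s_lin suminf_add[OF sum sum, symmetric])
  have R_scale: "R (c *\<^sub>C x) = c *\<^sub>C R x" for c x
    using bounded_linear.suminf[OF bounded_linear_scaleC sum, of c x] by (simp add: R_def s_lin)
  have "norm (R x) \<le> norm x * (C' / cmod z * (1 / (1 - t)))" for x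
  proof -
    have "norm (R x) \<le> (\<Sum>n. norm (s n x))" unfolding R_def norm_minus_cancel by (rule summable_norm[OF sumn])
    also have "\<dots> \<le> (\<Sum>n. C' / cmod z * norm x * t ^ n)" by (rule suminf_le[OF ns sumn geo])
    also have "\<dots> = C' / cmod z * norm x * (1 / (1 - t))"
      using t by (subst suminf_mult) (auto intro: summable_geometric simp: suminf_geometric)
    finally show ?thesis by (simp add: mult_ac)
  qed
  hence "bounded_linear R"
    by (intro bounded_linear_intro[where K = "C' / cmod z * (1 / (1 - t))"]) (simp_all only: R_add R_scale scaleR_scaleC)
  hence R: "bounded_clinear R" by (simp add: bounded_clinear_def R_scale)
  have comm: "s n (T x) = T (s n x)" for n x by (simp add: s_def TL funpow_swap1)
  have step: "T (s n x) = z *\<^sub>C s (Suc n) x" for n x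
  proof -
    have "z * inverse z ^ Suc (Suc n) = inverse z ^ Suc n"
      using z0 by (simp add: mult.assoc[symmetric])
    thus ?thesis by (simp add: s_def TL scaleC_scaleC del: power_Suc)
  qed
  have TR: "T (R x) - z *\<^sub>C R x = x" for x
  proof -
    have "(\<lambda>n. s n x) \<longlonglongrightarrow> 0" by (rule summable_LIMSEQ_zero[OF sum])
    hence "(\<lambda>n. s (Suc n) x - s n x) sums (0 - s 0 x)" by (rule telescope_sums)
    from bounded_linear.sums[OF bounded_linear_scaleC this, of z]
    have 1: "(\<lambda>n. z *\<^sub>C (s (Suc n) x - s n x)) sums (- x)"
      using z0 by (simp add: s_def scaleC_scaleC)
    have "(\<lambda>n. T (s n x) - z *\<^sub>C s n x) sums (T (\<Sum>n. s n x) - z *\<^sub>C (\<Sum>n. s n x))"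
      by (intro sums_diff bounded_linear.sums[OF TL(1)] bounded_linear.sums[OF bounded_linear_scaleC] summable_sums sum)
    hence "(\<lambda>n. z *\<^sub>C (s (Suc n) x - s n x)) sums (T (\<Sum>n. s n x) - z *\<^sub>C (\<Sum>n. s n x))"
      by (simp add: step scaleC_diff)
    with 1 have "T (\<Sum>n. s n x) - z *\<^sub>C (\<Sum>n. s n x) = - x" by (rule sums_unique2[symmetric])
    moreover have "T (- y) = - T y" for y using TL(3)[of 0 y] TL(5) by simp
    ultimately show ?thesis unfolding R_def by (simp add: algebra_simps)
  qed
  have RT: "R (T x) = T (R x)" for x
  proof -
    have "T (- y) = - T y" for y using TL(3)[of 0 y] TL(5) by simp
    thus ?thesis using bounded_linear.suminf[OF TL(1) sum, of x] by (simp add: R_def comm)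
  qed
  have R_diff: "R (x - y) = R x - R y" for x y using bounded_clinearD(3)[OF R] .
  show ?thesis
    unfolding spectrum_op_def using R TR by (auto intro!: exI[of _ R] simp: R_diff R_scale RT)
qed

lemma eigenvalue_in_spectrum:
  assumes "T h = z *\<^sub>C h" "h \<noteq> 0"
  shows "z \<in> spectrum_op T"
proof -
  have False if B: "bounded_clinear B" "\<forall>x. B (T x - z *\<^sub>C x) = x" for B
    using spec[OF B(2), of h] bounded_clinearD(5)[OF B(1)] assms by simp
  thus ?thesis unfolding spectrum_op_def by blast
qed

lemma spectral_radius_le:
  assumes "bounded_clinear T" "\<And>n x. norm ((T ^^ Suc n) x) \<le> C * \<rho> ^ Suc n * norm x" "0 \<le> \<rho>"
    and "T h = z *\<^sub>C h" "h \<noteq> 0"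
  shows "spectral_radius_op T \<le> \<rho>" "cmod z = \<rho> \<Longrightarrow> spectral_radius_op T = \<rho>"
proof -
  have le: "cmod w \<le> \<rho>" if "w \<in> spectrum_op T" for w
    using not_in_spectrum[OF assms(1,2,3), of w] that by (meson not_less)
  have z: "z \<in> spectrum_op T" using assms(4,5) by (rule eigenvalue_in_spectrum)
  show "spectral_radius_op T \<le> \<rho>" unfolding spectral_radius_op_def using le z by (intro cSup_least) auto
  show "spectral_radius_op T = \<rho>" if "cmod z = \<rho>"
    unfolding spectral_radius_op_def using le z that by (intro cSup_eq_maximum) auto
qed

section \<open>The leading eigenvector\<close>

context cone_complexification
begin

text \<open>\<open>Kc\<close> is not convex, but as \<open>K\<close> is reproducing every vector is a combination of four elements of \<open>Kc\<close>
  with control of the norms. Estimates of additive maps therefore extend from \<open>Kc\<close> to the space.\<close>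

lemma Kc_decomposition:
  obtains G where "0 < G"
    "\<And>x. \<exists>a b c d. a \<in> Kc \<and> b \<in> Kc \<and> c \<in> Kc \<and> d \<in> Kc \<and> x = (a - b) + (c - d)
      \<and> norm a + norm b + norm c + norm d \<le> G * norm x"
proof -
  obtain g where g: "\<And>x. \<exists>y1\<in>K. \<exists>y2\<in>K. x = y1 - y2 \<and> norm y1 + norm y2 \<le> g * norm x"
    using reproducing unfolding reproducing_def by blast
  obtain D where D: "0 < D" "\<And>u v. norm u + norm v \<le> D * norm (J u v)" using J_norm_bound by metis
  define g' where "g' = \<bar>g\<bar> + 1"
  show ?thesis
  proof (rule that[of "g' * D"])
    show "0 < g' * D" using D by (simp add: g'_def)
    fix x
    obtain u v where x: "x = J u v" by (rule J_cases)
    obtain u1 u2 where u: "u1 \<in> K" "u2 \<in> K" "u = u1 - u2" "norm u1 + norm u2 \<le> g * norm u" using g by blast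
    obtain v1 v2 where v: "v1 \<in> K" "v2 \<in> K" "v = v1 - v2" "norm v1 + norm v2 \<le> g * norm v" using g by blast
    have "x = (J u1 0 - J u2 0) + (J 0 v1 - J 0 v2)"
      by (simp add: x u v J_def j_simps scaleC_diff)
    moreover have "J u1 0 \<in> Kc" "J u2 0 \<in> Kc" "J 0 v1 \<in> Kc" "J 0 v2 \<in> Kc"
      using u v K_simps(2) by (auto intro!: J_in_Kc simp del: J_0)
    moreover have "norm (J u1 0) + norm (J u2 0) + norm (J 0 v1) + norm (J 0 v2) \<le> g' * D * norm x"
    proof -
      have "norm (J u1 0) + norm (J u2 0) + norm (J 0 v1) + norm (J 0 v2) = norm u1 + norm u2 + norm v1 + norm v2"
        by (simp add: J_def j_simps norm_scaleC)
      also have "\<dots> \<le> g * (norm u + norm v)" using u v by (simp add: algebra_simps)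
      also have "\<dots> \<le> g' * (norm u + norm v)" by (intro mult_right_mono) (auto simp: g'_def)
      also have "\<dots> \<le> g' * (D * norm x)" unfolding x by (intro mult_left_mono D) (simp add: g'_def)
      finally show ?thesis by (simp add: mult.assoc)
    qed
    ultimately show "\<exists>a b c d. a \<in> Kc \<and> b \<in> Kc \<and> c \<in> Kc \<and> d \<in> Kc \<and> x = (a - b) + (c - d)
      \<and> norm a + norm b + norm c + norm d \<le> g' * D * norm x" by blast
  qed
qed

lemma additive_bound_from_Kc:
  fixes f :: "'x \<Rightarrow> 'b::real_normed_vector"
  assumes G: "\<And>x. \<exists>a b c d. a \<in> Kc \<and> b \<in> Kc \<and> c \<in> Kc \<and> d \<in> Kc \<and> x = (a - b) + (c - d)
      \<and> norm a + norm b + norm c + norm d \<le> G * norm x"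
    and add: "\<And>x y. f (x + y) = f x + f y" and diff: "\<And>x y. f (x - y) = f x - f y"
    and b: "\<And>w. w \<in> Kc \<Longrightarrow> norm (f w) \<le> B * norm w" and B: "0 \<le> B"
  shows "norm (f x) \<le> G * B * norm x"
proof -
  obtain a b c d where x: "a \<in> Kc" "b \<in> Kc" "c \<in> Kc" "d \<in> Kc" "x = (a - b) + (c - d)"
    "norm a + norm b + norm c + norm d \<le> G * norm x" using G by blast
  have "norm (f x) \<le> norm (f a - f b) + norm (f c - f d)"
    unfolding x(5) add diff by (rule norm_triangle_ineq)
  also have "\<dots> \<le> (norm (f a) + norm (f b)) + (norm (f c) + norm (f d))"
    by (intro add_mono norm_triangle_ineq4)
  also have "\<dots> \<le> B * (norm a + norm b + norm c + norm d)"
    using b[OF x(1)] b[OF x(2)] b[OF x(3)] b[OF x(4)] by (simp add: algebra_simps)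
  also have "\<dots> \<le> B * (G * norm x)" using x(6) B by (intro mult_left_mono)
  finally show ?thesis by (simp add: mult_ac)
qed

text \<open>If \<open>Re (\<mu> p * cnj (\<mu> q)) < 0\<close> for some \<open>p\<close>, \<open>q\<close> in \<open>K\<close>, then \<open>\<mu>\<close> annihilates \<open>p + c q\<close> with
  \<open>c = - \<mu> p / \<mu> q\<close>. As \<open>Re c > 0\<close>, this is a nonzero vector of \<open>Kc\<close>.\<close>

lemma nonvanishing_in_dual:
  assumes \<mu>: "bounded_clinear \<mu>" and nz: "\<And>x. x \<in> Kc - {0} \<Longrightarrow> \<mu> x \<noteq> 0"
  shows "\<mu> \<in> complexified_dual_cone j K"
proof -
  note L = bounded_clinearD[OF \<mu>]
  have "0 \<le> Re (\<mu> (j p) * cnj (\<mu> (j q)))" if pq: "p \<in> K" "q \<in> K" for p q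
  proof (rule ccontr)
    assume neg: "\<not> ?thesis"
    hence qnz: "\<mu> (j q) \<noteq> 0" by auto
    define c where "c = - \<mu> (j p) / \<mu> (j q)"
    have eq: "\<mu> (j p) = - c * \<mu> (j q)" using qnz by (simp add: c_def)
    have "Re (\<mu> (j p) * cnj (\<mu> (j q))) = - Re c * (cmod (\<mu> (j q)))\<^sup>2"
      unfolding eq cmod_power2 by (simp add: algebra_simps power2_eq_square)
    hence c: "0 < Re c" using neg by (auto simp: not_le mult_less_0_iff zero_less_mult_iff)
    define y where "y = j p + c *\<^sub>C j q"
    have "\<mu> y = 0" by (simp add: y_def L eq)
    have y: "y = J (p + Re c *\<^sub>R q) (Im c *\<^sub>R q)"
      using scaleC_J[of c q 0] by (simp add: y_def J_add flip: J_0)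
    have "y \<in> Kc"
    proof (cases "0 \<le> Im c")
      case True
      thus ?thesis unfolding y using pq c by (intro J_in_Kc K_simps) auto
    next
      case False
      have "J ((- Im c) *\<^sub>R q) (p + Re c *\<^sub>R q) \<in> Kc" using pq c False by (intro J_in_Kc K_simps) auto
      hence "(- \<i>) *\<^sub>C J ((- Im c) *\<^sub>R q) (p + Re c *\<^sub>R q) \<in> Kc" by (rule scaleC_Kc)
      thus ?thesis unfolding scaleC_J y by (simp add: add.commute)
    qed
    with nz \<open>\<mu> y = 0\<close> have "y = 0" by auto
    hence "p + Re c *\<^sub>R q = 0" by (simp add: y)
    hence "- (Re c *\<^sub>R q) = p" by (simp add: add_eq_0_iff2)
    hence "Re c *\<^sub>R q \<in> K" "- (Re c *\<^sub>R q) \<in> K" using pq c by (auto intro: K_simps)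
    hence "Re c *\<^sub>R q = 0" by (rule K_simps(5))
    hence "q = 0" using c by simp
    with qnz show False by (simp add: L j_simps)
  qed
  thus ?thesis using \<mu> by (simp add: complexified_dual_cone_def)
qed

lemma K_nontrivial:
  assumes "(UNIV :: 'r set) \<noteq> {0}"
  obtains p where "p \<in> K - {0}"
proof -
  from assms obtain x :: 'r where "x \<noteq> 0" by blast
  moreover obtain y1 y2 where "y1 \<in> K" "y2 \<in> K" "x = y1 - y2" using reproducing unfolding reproducing_def by blast
  ultimately show ?thesis using that[of y1] that[of y2] by auto
qed

end

context cone_contraction
begin

text \<open>The eigenvector is the limit of the orbit of a real vector, normalised by \<open>m\<close>. The functional \<open>\<nu> x\<close> is
  the limit of \<open>m (A\<^sup>n x) / lam\<^sup>n\<close>; this sequence has geometrically decreasing increments because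
  \<open>A\<^sup>n x\<close> is close to \<open>m (A\<^sup>n x) h\<close>. On the punctured cone it stays away from zero.\<close>

theorem leading_eigenvector:
  assumes nontrivial: "(UNIV :: 'r set) \<noteq> {0}"
  obtains lam h \<nu> C \<rho> where "lam \<noteq> 0" "h \<in> Kc - {0}" "A h = lam *\<^sub>C h" "bounded_clinear \<nu>" "\<nu> h = 1"
    "\<And>x. \<nu> (A x) = lam * \<nu> x" "\<And>x. x \<in> Kc - {0} \<Longrightarrow> \<nu> x \<noteq> 0" "0 < \<rho>" "\<rho> < cmod lam"
    "\<And>n x. norm ((A ^^ Suc n) x - (lam ^ Suc n * \<nu> x) *\<^sub>C h) \<le> C * \<rho> ^ Suc n * norm x"
proof -
  obtain e where e: "e \<in> K - {0}" using K_nontrivial[OF nontrivial] .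
  have "j e \<noteq> 0" using e by simp
  then obtain m where m: "m \<in> M" using ext_nonzero_generator[OF M] by metis
  obtain G where G: "0 < G" and
    contract: "\<And>x y n. x \<in> Kc - {0} \<Longrightarrow> y \<in> Kc - {0} \<Longrightarrow>
      norm ((A ^^ Suc n) x - (ext m ((A ^^ Suc n) x) / ext m ((A ^^ Suc n) y)) *\<^sub>C (A ^^ Suc n) y)
       \<le> G * contraction_rate ^ n * cmod (ext m ((A ^^ Suc n) x) / ext m ((A ^^ Suc n) y)) * norm ((A ^^ Suc n) y)" and
    quot: "\<And>x y n. x \<in> Kc - {0} \<Longrightarrow> y \<in> Kc - {0} \<Longrightarrow>
      cmod (ext m (A x)) / cmod (ext m (A y)) / G \<le> cmod (ext m ((A ^^ Suc n) x)) / cmod (ext m ((A ^^ Suc n) y))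
      \<and> cmod (ext m ((A ^^ Suc n) x)) / cmod (ext m ((A ^^ Suc n) y)) \<le> G * (cmod (ext m (A x)) / cmod (ext m (A y)))"
    using normalized_iterates_contract[OF m e] by metis
  have nz: "ext m ((A ^^ Suc n) x) \<noteq> 0" if "x \<in> Kc - {0}" for x n
    using ext_A_generator_nonzero[OF A_pow_Kc[OF that] m, of n] by simp
  have lim_m: "bounded_linear (ext m)" and lim_A: "bounded_linear A"
    using bounded_clinearD(1)[OF bounded_clinear_cext] bounded_clinearD(1)[OF A] by auto
  have q: "0 \<le> contraction_rate" "contraction_rate < 1" "0 < contraction_rate" using contraction_rate by auto
  \<comment> \<open>The normalised iterates form a Cauchy sequence.\<close>
  define N where "N z = inverse (ext m z) *\<^sub>C z" for z
  have N_contract: "norm (N ((A ^^ Suc n) x) - N ((A ^^ Suc n) y)) \<le> G * contraction_rate ^ n * norm (N ((A ^^ Suc n) y))"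
    if x: "x \<in> Kc - {0}" and y: "y \<in> Kc - {0}" for x y n
  proof -
    define X Y where "X = (A ^^ Suc n) x" and "Y = (A ^^ Suc n) y"
    have 0: "ext m X \<noteq> 0" "ext m Y \<noteq> 0" unfolding X_def Y_def by (rule nz[OF x], rule nz[OF y])
    have "N X - N Y = inverse (ext m X) *\<^sub>C (X - (ext m X / ext m Y) *\<^sub>C Y)"
      using 0 by (simp add: N_def scaleC_diff scaleC_scaleC field_simps)
    hence "norm (N X - N Y) = norm (X - (ext m X / ext m Y) *\<^sub>C Y) / cmod (ext m X)"
      by (simp add: norm_scaleC norm_inverse divide_inverse mult.commute)
    also have "\<dots> \<le> (G * contraction_rate ^ n * cmod (ext m X / ext m Y) * norm Y) / cmod (ext m X)"
      unfolding X_def Y_def by (intro divide_right_mono contract x y) simp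
    also have "\<dots> = G * contraction_rate ^ n * norm (N Y)" using 0 by (simp add: N_def norm_scaleC norm_divide norm_inverse field_simps)
    finally show ?thesis unfolding X_def Y_def .
  qed
  define x0 where "x0 = j e"
  have x0: "x0 \<in> Kc - {0}" using e J_in_Kc[of e 0] K_simps(2) by (simp add: x0_def)
  define E' where "E' n = N ((A ^^ Suc n) x0)" for n
  have shift: "(A ^^ Suc (n + i)) x0 = (A ^^ Suc n) ((A ^^ i) x0)" for n i
    by (simp add: funpow_add)
  have bddE: "norm (E' n) \<le> (G + 1) * norm (E' 0)" for n
  proof -
    have "norm (E' n - E' 0) \<le> G * norm (E' 0)"
      using N_contract[OF A_pow_Kc[OF x0, of n] x0, of 0] shift[of 0 n] by (simp add: E'_def)
    thus ?thesis using norm_triangle_ineq[of "E' n - E' 0" "E' 0"] by (simp add: algebra_simps)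
  qed
  have "norm (E' (Suc n) - E' n) \<le> (G * ((G + 1) * norm (E' 0))) * contraction_rate ^ n" for n
  proof -
    have "norm (E' (Suc n) - E' n) \<le> G * contraction_rate ^ n * norm (E' n)"
      using N_contract[OF A_pow_Kc[OF x0, of 1] x0, of n] shift[of n 1] by (simp add: E'_def)
    also have "\<dots> \<le> G * contraction_rate ^ n * ((G + 1) * norm (E' 0))" using bddE G q by (intro mult_left_mono) auto
    finally show ?thesis by (simp add: mult_ac)
  qed
  then obtain h where h: "E' \<longlonglongrightarrow> h" using geometric_increments_converge[OF _ q(1,2)] by metis
  have E'1: "ext m (E' n) = 1" for n using nz[OF x0, of n] by (simp add: E'_def N_def cext_scaleC)
  have mh: "ext m h = 1"
    using LIMSEQ_unique[OF bounded_linear.tendsto[OF lim_m h], of 1] by (simp add: E'1)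
  have "h \<in> Kc"
  proof (rule closed_sequentially[OF closed_Kc _ h])
    show "E' n \<in> Kc" for n unfolding E'_def N_def using A_pow_Kc[OF x0, of "Suc n"] by (intro scaleC_Kc) blast
  qed
  hence hK: "h \<in> Kc - {0}" using mh by auto
  define lam where "lam = ext m (A h)"
  have lam: "lam \<noteq> 0" using ext_A_generator_nonzero[OF hK m] by (simp add: lam_def)
  have AE: "A (E' n) = ext m (A (E' n)) *\<^sub>C E' (Suc n)" for n
    using nz[OF x0, of n] nz[OF x0, of "Suc n"] by (simp add: E'_def N_def A_simps cext_scaleC scaleC_scaleC mult.assoc)
  have Ah: "A h = lam *\<^sub>C h"
  proof (rule LIMSEQ_unique)
    show "(\<lambda>n. A (E' n)) \<longlonglongrightarrow> A h" by (rule bounded_linear.tendsto[OF lim_A h])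
    hence "(\<lambda>n. ext m (A (E' n))) \<longlonglongrightarrow> lam" unfolding lam_def by (rule bounded_linear.tendsto[OF lim_m])
    hence "(\<lambda>n. ext m (A (E' n)) *\<^sub>C E' (Suc n)) \<longlonglongrightarrow> lam *\<^sub>C h" by (rule tendsto_scaleC[OF _ LIMSEQ_Suc[OF h]])
    thus "(\<lambda>n. A (E' n)) \<longlonglongrightarrow> lam *\<^sub>C h" by (simp flip: AE)
  qed
  have An: "(A ^^ n) h = lam ^ n *\<^sub>C h" for n
    by (induction n) (simp_all add: A_simps Ah scaleC_scaleC mult.commute)
  \<comment> \<open>Comparing an arbitrary orbit with that of \<open>h\<close> yields the eigenfunctional.\<close>
  obtain \<beta> where \<beta>: "0 < \<beta>" "\<And>x. cmod (ext m (A x)) \<le> \<beta> * norm x"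
  proof -
    have "bounded_linear (\<lambda>x. ext m (A x))" by (rule bounded_linear_compose[OF lim_m lim_A])
    then obtain b where b: "0 < b" "\<And>x. norm (ext m (A x)) \<le> norm x * b" using bounded_linear.pos_bounded by metis
    show thesis by (rule that[OF b(1)]) (use b(2) in \<open>simp add: mult.commute\<close>)
  qed
  define c where "c n x = ext m ((A ^^ n) x) / lam ^ n" for n x
  have An_lin: "(A ^^ n) (x + y) = (A ^^ n) x + (A ^^ n) y" "(A ^^ n) (x - y) = (A ^^ n) x - (A ^^ n) y"
    "(A ^^ n) (s *\<^sub>C x) = s *\<^sub>C (A ^^ n) x" for n x y s
    by (induction n) (simp_all add: A_simps)
  have c_lin: "c n (x + y) = c n x + c n y" "c n (x - y) = c n x - c n y" "c n (s *\<^sub>C x) = s * c n x" for n x y s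
    by (simp_all add: c_def An_lin cext_add cext_diff cext_scaleC add_divide_distrib diff_divide_distrib)
  have c_bounds: "cmod (ext m (A x)) / cmod lam / G \<le> cmod (c (Suc n) x) \<and> cmod (c (Suc n) x) \<le> G * (cmod (ext m (A x)) / cmod lam)"
    if x: "x \<in> Kc - {0}" for x n
  proof -
    have "ext m ((A ^^ Suc n) h) = lam ^ Suc n" by (simp only: An cext_scaleC mh mult_1_right)
    moreover have "ext m (A h) = lam" by (simp add: lam_def)
    ultimately show ?thesis using quot[OF x hK, of n] unfolding c_def norm_divide by (simp only: norm_power)
  qed
  define B1 where "B1 = G * norm h * (G * (\<beta> / cmod lam))"
  have B1: "0 \<le> B1" using G \<beta> by (simp add: B1_def)
  define R where "R n x = (A ^^ Suc n) x - (c (Suc n) x * lam ^ Suc n) *\<^sub>C h" for n x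
  have R_lin: "R n (x + y) = R n x + R n y" "R n (x - y) = R n x - R n y" for n x y
    unfolding R_def An_lin c_lin by (simp_all add: distrib_right left_diff_distrib scaleC_add_left scaleC_diff)
  have R_Kc: "norm (R n x) \<le> B1 * (contraction_rate ^ n * cmod lam ^ Suc n) * norm x" if x: "x \<in> Kc" for n x
  proof (cases "x = 0")
    case True
    thus ?thesis using An_lin(3)[of "Suc n" 0 0] c_lin(3)[of "Suc n" 0 0] by (simp add: R_def)
  next
    case False
    hence x: "x \<in> Kc - {0}" using x by simp
    have mX: "ext m ((A ^^ Suc n) x) = c (Suc n) x * lam ^ Suc n" using lam by (simp add: c_def)
    have mH: "ext m ((A ^^ Suc n) h) = lam ^ Suc n" by (simp only: An cext_scaleC mh mult_1_right)
    have "norm (R n x) \<le> G * contraction_rate ^ n * cmod (c (Suc n) x) * norm (lam ^ Suc n *\<^sub>C h)"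
      using contract[OF x hK, of n, unfolded mX mH] lam
      by (simp add: An R_def scaleC_scaleC del: funpow.simps power_Suc)
    also have "\<dots> = (G * contraction_rate ^ n * cmod lam ^ Suc n * norm h) * cmod (c (Suc n) x)"
      by (simp add: norm_scaleC norm_power norm_mult mult_ac)
    also have "\<dots> \<le> (G * contraction_rate ^ n * cmod lam ^ Suc n * norm h) * (G * (\<beta> / cmod lam) * norm x)"
    proof (rule mult_left_mono)
      have "cmod (ext m (A x)) / cmod lam \<le> \<beta> * norm x / cmod lam" by (rule divide_right_mono[OF \<beta>(2)]) simp
      hence "G * (cmod (ext m (A x)) / cmod lam) \<le> G * (\<beta> * norm x / cmod lam)"
        using G by (intro mult_left_mono) auto
      thus "cmod (c (Suc n) x) \<le> G * (\<beta> / cmod lam) * norm x" using c_bounds[OF x, of n] by simp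
      show "0 \<le> G * contraction_rate ^ n * cmod lam ^ Suc n * norm h" using G q by simp
    qed
    also have "\<dots> = B1 * (contraction_rate ^ n * cmod lam ^ Suc n) * norm x" by (simp add: B1_def mult_ac)
    finally show ?thesis .
  qed
  obtain g where g: "0 < g" "\<And>x. \<exists>a b c d. a \<in> Kc \<and> b \<in> Kc \<and> c \<in> Kc \<and> d \<in> Kc \<and> x = (a - b) + (c - d)
      \<and> norm a + norm b + norm c + norm d \<le> g * norm x" using Kc_decomposition by blast
  have R_bound: "norm (R n x) \<le> g * (B1 * (contraction_rate ^ n * cmod lam ^ Suc n)) * norm x" for n x
    by (rule additive_bound_from_Kc[OF g(2) R_lin R_Kc]) (use B1 q in auto)
  define B2 where "B2 = \<beta> * g * B1 / cmod lam"
  have B2: "0 \<le> B2" using \<beta> g B1 by (simp add: B2_def)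
  have inc: "cmod (c (Suc (Suc n)) x - c (Suc n) x) \<le> (B2 * norm x) * contraction_rate ^ n" for n x
  proof -
    have "ext m (A (R n x)) = ext m ((A ^^ Suc (Suc n)) x) - (c (Suc n) x * lam ^ Suc n) * lam"
      by (simp add: R_def A_simps Ah cext_diff cext_scaleC mh)
    also have "\<dots> = (c (Suc (Suc n)) x - c (Suc n) x) * lam ^ Suc (Suc n)"
      using lam by (simp add: c_def field_simps)
    finally have "c (Suc (Suc n)) x - c (Suc n) x = ext m (A (R n x)) / lam ^ Suc (Suc n)" using lam by simp
    hence "cmod (c (Suc (Suc n)) x - c (Suc n) x) = cmod (ext m (A (R n x))) / cmod lam ^ Suc (Suc n)"
      by (simp only: norm_divide norm_power)
    also have "\<dots> \<le> (\<beta> * (g * (B1 * (contraction_rate ^ n * cmod lam ^ Suc n)) * norm x)) / cmod lam ^ Suc (Suc n)"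
      by (intro divide_right_mono order_trans[OF \<beta>(2)] mult_left_mono R_bound) (use \<beta> in auto)
    also have "\<dots> = (B2 * norm x) * contraction_rate ^ n" using lam by (simp add: B2_def field_simps)
    finally show ?thesis .
  qed
  have "\<exists>l. (\<lambda>n. c (Suc n) x) \<longlonglongrightarrow> l \<and> (\<forall>n. cmod (c (Suc n) x - l) \<le> B2 * norm x / (1 - contraction_rate) * contraction_rate ^ n)" for x
    using geometric_increments_converge[OF inc q(1,2), of x] by metis
  then obtain \<nu> where \<nu>: "\<And>x. (\<lambda>n. c (Suc n) x) \<longlonglongrightarrow> \<nu> x"
    "\<And>x n. cmod (c (Suc n) x - \<nu> x) \<le> B2 * norm x / (1 - contraction_rate) * contraction_rate ^ n" by metis
  have \<nu>_add: "\<nu> (x + y) = \<nu> x + \<nu> y" for x y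
    using LIMSEQ_unique[OF \<nu>(1) tendsto_add[OF \<nu>(1)[of x] \<nu>(1)[of y], folded c_lin]] .
  have \<nu>_scale: "\<nu> (s *\<^sub>C x) = s * \<nu> x" for s x
    using LIMSEQ_unique[OF \<nu>(1) tendsto_mult_left[OF \<nu>(1)[of x], of s, folded c_lin]] .
  have "cmod (\<nu> x) \<le> norm x * (\<beta> / cmod lam + B2 / (1 - contraction_rate))" for x
  proof -
    have "cmod (\<nu> x) \<le> cmod (c (Suc 0) x) + cmod (c (Suc 0) x - \<nu> x)"
      using norm_triangle_ineq4[of "c (Suc 0) x" "c (Suc 0) x - \<nu> x"] by simp
    also have "\<dots> \<le> \<beta> * norm x / cmod lam + B2 * norm x / (1 - contraction_rate)"
      using \<nu>(2)[of 0 x] divide_right_mono[OF \<beta>(2), of "cmod lam" x]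
      by (intro add_mono) (simp_all add: c_def norm_divide)
    finally show ?thesis by (simp add: algebra_simps)
  qed
  hence "bounded_linear \<nu>"
    by (intro bounded_linear_intro[where K = "\<beta> / cmod lam + B2 / (1 - contraction_rate)"])
       (simp_all add: \<nu>_add \<nu>_scale scaleR_scaleC)
  hence bl: "bounded_clinear \<nu>" by (simp add: bounded_clinear_def \<nu>_scale)
  have \<nu>h: "\<nu> h = 1"
    using LIMSEQ_unique[OF \<nu>(1)[of h], of 1] lam by (simp add: c_def An cext_scaleC mh del: funpow.simps)
  have \<nu>A: "\<nu> (A x) = lam * \<nu> x" for x
  proof (rule LIMSEQ_unique[OF \<nu>(1)])
    have "c (Suc n) (A x) = lam * c (Suc (Suc n)) x" for n
      using lam by (simp add: c_def funpow_swap1)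
    thus "(\<lambda>n. c (Suc n) (A x)) \<longlonglongrightarrow> lam * \<nu> x"
      using tendsto_mult_left[OF LIMSEQ_Suc[OF \<nu>(1)[of x]], of lam] by simp
  qed
  have \<nu>0: "\<nu> x \<noteq> 0" if x: "x \<in> Kc - {0}" for x
  proof -
    define r where "r = cmod (ext m (A x)) / cmod lam / G"
    have "0 < r" using ext_A_generator_nonzero[OF x m] lam G by (simp add: r_def)
    moreover have "r \<le> cmod (\<nu> x)"
      by (rule LIMSEQ_le_const[OF tendsto_norm[OF \<nu>(1)[of x]]]) (use c_bounds[OF x] in \<open>auto simp: r_def\<close>)
    ultimately show ?thesis by auto
  qed
  define \<rho> where "\<rho> = contraction_rate * cmod lam"
  have \<rho>: "0 < \<rho>" "\<rho> < cmod lam" using q lam by (auto simp: \<rho>_def)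
  define C where "C = (g * B1 + B2 / (1 - contraction_rate) * norm h) / contraction_rate"
  have final: "norm ((A ^^ Suc n) x - (lam ^ Suc n * \<nu> x) *\<^sub>C h) \<le> C * \<rho> ^ Suc n * norm x" for n x
  proof -
    have "(A ^^ Suc n) x - (lam ^ Suc n * \<nu> x) *\<^sub>C h = R n x + (lam ^ Suc n * (c (Suc n) x - \<nu> x)) *\<^sub>C h"
      by (simp add: R_def scaleC_diff right_diff_distrib mult.commute del: funpow.simps power_Suc)
    hence "norm ((A ^^ Suc n) x - (lam ^ Suc n * \<nu> x) *\<^sub>C h) \<le> norm (R n x) + cmod lam ^ Suc n * cmod (c (Suc n) x - \<nu> x) * norm h"
      using norm_triangle_ineq[of "R n x" "(lam ^ Suc n * (c (Suc n) x - \<nu> x)) *\<^sub>C h"]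
      by (simp only: norm_scaleC norm_mult norm_power)
    also have "\<dots> \<le> g * (B1 * (contraction_rate ^ n * cmod lam ^ Suc n)) * norm x + cmod lam ^ Suc n * (B2 * norm x / (1 - contraction_rate) * contraction_rate ^ n) * norm h"
      by (intro add_mono R_bound mult_right_mono mult_left_mono \<nu>(2)) auto
    also have "\<dots> = (g * B1 + B2 / (1 - contraction_rate) * norm h) * (contraction_rate ^ n * cmod lam ^ Suc n) * norm x"
      by (simp add: algebra_simps)
    also have "\<dots> = C * \<rho> ^ Suc n * norm x"
      using q by (simp add: C_def \<rho>_def power_mult_distrib)
    finally show ?thesis .
  qed
  show ?thesis by (rule that[OF lam hK Ah bl \<nu>h \<nu>A \<nu>0 \<rho> final])
qed

text \<open>Subtracting \<open>lam\<close> times the projection \<open>x \<mapsto> \<nu> x h\<close> leaves an operator whose powers are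
  \<open>A\<^sup>n x - lam\<^sup>n \<nu> x h\<close>, of size \<open>\<rho>\<^sup>n\<close>.\<close>

theorem leading_eigendata_exists:
  assumes nontrivial: "(UNIV :: 'r set) \<noteq> {0}"
  obtains lam h \<nu> where "leading_eigendata j K A lam h \<nu>" "\<And>x. \<nu> (A x) = lam * \<nu> x"
    "\<And>x. x \<in> Kc - {0} \<Longrightarrow> \<nu> x \<noteq> 0"
proof -
  obtain lam h \<nu> C \<rho> where lam: "lam \<noteq> 0" and h: "h \<in> Kc - {0}" "A h = lam *\<^sub>C h" and \<nu>: "bounded_clinear \<nu>" "\<nu> h = 1"
    "\<And>x. \<nu> (A x) = lam * \<nu> x" "\<And>x. x \<in> Kc - {0} \<Longrightarrow> \<nu> x \<noteq> 0" and \<rho>: "0 < \<rho>" "\<rho> < cmod lam"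
    and est: "\<And>n x. norm ((A ^^ Suc n) x - (lam ^ Suc n * \<nu> x) *\<^sub>C h) \<le> C * \<rho> ^ Suc n * norm x"
    using leading_eigenvector[OF nontrivial] by metis
  note L = bounded_clinearD[OF \<nu>(1)]
  obtain b where b: "0 < b" "\<And>x. cmod (\<nu> x) \<le> norm x * b" using bounded_linear.pos_bounded[OF L(1)] by blast
  define C' where "C' = max 0 C + b * norm h"
  have bound: "norm ((A ^^ Suc n) x) \<le> C' * cmod lam ^ Suc n * norm x" for n x
  proof -
    have "norm ((A ^^ Suc n) x) \<le> norm ((A ^^ Suc n) x - (lam ^ Suc n * \<nu> x) *\<^sub>C h) + norm ((lam ^ Suc n * \<nu> x) *\<^sub>C h)"
      using norm_triangle_ineq[of "(A ^^ Suc n) x - (lam ^ Suc n * \<nu> x) *\<^sub>C h" "(lam ^ Suc n * \<nu> x) *\<^sub>C h"] by simp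
    also have "\<dots> \<le> max 0 C * cmod lam ^ Suc n * norm x + cmod lam ^ Suc n * (norm x * b) * norm h"
    proof (rule add_mono)
      have "norm ((A ^^ Suc n) x - (lam ^ Suc n * \<nu> x) *\<^sub>C h) \<le> C * \<rho> ^ Suc n * norm x" by (rule est)
      also have "\<dots> \<le> max 0 C * cmod lam ^ Suc n * norm x"
        using \<rho> by (intro mult_right_mono mult_mono power_mono) auto
      finally show "norm ((A ^^ Suc n) x - (lam ^ Suc n * \<nu> x) *\<^sub>C h) \<le> max 0 C * cmod lam ^ Suc n * norm x" .
      show "norm ((lam ^ Suc n * \<nu> x) *\<^sub>C h) \<le> cmod lam ^ Suc n * (norm x * b) * norm h"
        unfolding norm_scaleC norm_mult norm_power by (intro mult_right_mono mult_left_mono b) auto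
    qed
    also have "\<dots> = C' * cmod lam ^ Suc n * norm x" by (simp add: C'_def algebra_simps)
    finally show ?thesis .
  qed
  have h0: "h \<noteq> 0" using h by simp
  have srA: "spectral_radius_op A = cmod lam"
    by (rule spectral_radius_le(2)[OF A bound _ h(2) h0]) simp_all
  define T where "T x = A x - lam *\<^sub>C (\<nu> x *\<^sub>C h)" for x
  have "bounded_linear T"
    unfolding T_def
    by (rule bounded_linear_sub[OF bounded_clinearD(1)[OF A] bounded_linear_compose[OF bounded_linear_scaleC
          bounded_linear_compose[OF bounded_linear_scaleC_left L(1)]]])
  moreover have "T (c *\<^sub>C x) = c *\<^sub>C T x" for c x
    by (simp add: T_def A_simps L scaleC_diff scaleC_scaleC mult_ac)
  ultimately have T: "bounded_clinear T" by (simp add: bounded_clinear_def)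
  have Th: "T h = 0 *\<^sub>C h" by (simp add: T_def h \<nu>)
  have \<nu>An: "\<nu> ((A ^^ n) x) = lam ^ n * \<nu> x" for n x by (induction n) (simp_all add: \<nu>)
  have Tn: "(T ^^ Suc n) x = (A ^^ Suc n) x - (lam ^ Suc n * \<nu> x) *\<^sub>C h" for n x
  proof (induction n)
    case 0
    show ?case by (simp add: T_def scaleC_scaleC)
  next
    case (Suc n)
    have "(T ^^ Suc (Suc n)) x = T ((A ^^ Suc n) x - (lam ^ Suc n * \<nu> x) *\<^sub>C h)" using Suc by simp
    also have "\<dots> = T ((A ^^ Suc n) x) - (lam ^ Suc n * \<nu> x) *\<^sub>C T h" by (simp only: bounded_clinearD[OF T])
    also have "\<dots> = A ((A ^^ Suc n) x) - lam *\<^sub>C (\<nu> ((A ^^ Suc n) x) *\<^sub>C h)" unfolding Th by (simp add: T_def)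
    also have "\<dots> = (A ^^ Suc (Suc n)) x - (lam ^ Suc (Suc n) * \<nu> x) *\<^sub>C h"
      unfolding \<nu>An scaleC_scaleC by (simp add: mult_ac)
    finally show ?case .
  qed
  have "spectral_radius_op T \<le> \<rho>"
    by (rule spectral_radius_le(1)[OF T _ _ Th h0, where C = C]) (use est \<rho> in \<open>auto simp only: Tn\<close>)
  hence "spectral_radius_op T < cmod lam" using \<rho> by simp
  moreover have "\<nu> \<in> complexified_dual_cone j K" by (rule nonvanishing_in_dual[OF \<nu>(1,4)])
  ultimately have "leading_eigendata j K A lam h \<nu>"
    unfolding leading_eigendata_def Let_def using lam srA h \<nu>
    by (auto simp: A_simps scaleC_scaleC mult_ac T_def[abs_def])
  thus ?thesis using \<nu> that by blast
qed

end

section \<open>Quotient matrices and gauges\<close>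

lemma rank_mat2:
  shows "rank (mat2 a b c d) = (if a = 0 \<and> b = 0 \<and> c = 0 \<and> d = 0 then 0 else if a * d - b * c = 0 then 1 else 2)"
proof -
  define v w :: "complex^2" where "v = vector [a, b]" and "w = vector [c, d]"
  have comp: "v $ 1 = a" "v $ 2 = b" "w $ 1 = c" "w $ 2 = d" by (simp_all add: v_def w_def)
  have "rows (mat2 a b c d) = {row 1 (mat2 a b c d), row 2 (mat2 a b c d)}"
  proof -
    have "rows (mat2 a b c d) = (\<lambda>i. row i (mat2 a b c d)) ` UNIV" by (auto simp: rows_def)
    thus ?thesis unfolding UNIV_2 by simp
  qed
  moreover have "row 1 (mat2 a b c d) = v" "row 2 (mat2 a b c d) = w"
    by (simp_all add: row_def mat2_def vec_eq_iff v_def w_def)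
  ultimately have "rank (mat2 a b c d) = vec.dim {v, w}" by (simp add: row_rank_def_gen)
  also have "\<dots> = (if v \<in> vec.span {w} then vec.dim {w} else vec.dim {w} + 1)" by (rule vec.dim_insert)
  also have "vec.dim {w} = (if w = 0 then 0 else 1)" using vec.dim_insert[of w "{}"] by simp
  also have "v \<in> vec.span {w} \<longleftrightarrow> (if w = 0 then v = 0 else a * d - b * c = 0)"
  proof (cases "w = 0")
    case False
    hence cd: "c \<noteq> 0 \<or> d \<noteq> 0" by (auto simp: vec_eq_iff forall_2 comp)
    have "v \<in> vec.span {w} \<longleftrightarrow> (\<exists>k. a = k * c \<and> b = k * d)"
      unfolding vec.span_singleton by (auto simp: vec_eq_iff forall_2 comp)
    also have "\<dots> \<longleftrightarrow> a * d - b * c = 0"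
    proof
      assume D: "a * d - b * c = 0"
      show "\<exists>k. a = k * c \<and> b = k * d"
      proof (cases "c = 0")
        case True
        thus ?thesis using D cd by (intro exI[of _ "b / d"]) auto
      next
        case False
        thus ?thesis using D by (intro exI[of _ "a / c"]) (auto simp: field_simps)
      qed
    qed auto
    finally show ?thesis using False by simp
  qed simp
  also have "w = 0 \<longleftrightarrow> c = 0 \<and> d = 0" by (auto simp: vec_eq_iff forall_2 comp)
  also have "v = 0 \<longleftrightarrow> a = 0 \<and> b = 0" by (auto simp: vec_eq_iff forall_2 comp)
  finally show ?thesis by auto
qed

lemma phi_mat2_nondegenerate:
  assumes "a * d - b * c \<noteq> 0"
  shows "phi (mat2 a b c d) = ennreal (2 * Re (a * cnj b)) / ennreal (cmod (a * cnj d + b * cnj c) + cmod (a * d - b * c))"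
    "Phi (mat2 a b c d) = ennreal (cmod (a * cnj d + b * cnj c) + cmod (a * d - b * c)) / ennreal (2 * Re (c * cnj d))"
  using assms rank_mat2[of a b c d] by (auto simp: phi_def Phi_def Let_def mat2_def)

lemma phi_mat2_eigen:
  "phi (mat2 (l * c) (l * d) c d) = (if c = 0 \<and> d = 0 then \<infinity> else ennreal (cmod l))"
  "Phi (mat2 (l * c) (l * d) c d) = (if c = 0 \<and> d = 0 then 0 else ennreal (cmod l))"
  using rank_mat2[of "l * c" "l * d" c d]
  by (auto simp: phi_def Phi_def Let_def mat2_def divide_ennreal norm_mult)

text \<open>The roots of \<open>P - s W + s\<^sup>2 Q\<close> are \<open>2 P / (W + D)\<close> and \<open>(W + D) / (2 Q)\<close>, the values of \<open>phi\<close> and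
  \<open>Phi\<close>. This form of the first root remains meaningful for \<open>Q = 0\<close>.\<close>

lemma quadratic_nonneg_outside_roots:
  fixes P Q W D s :: real
  assumes disc: "W\<^sup>2 = D\<^sup>2 + 4 * P * Q" and nn: "0 \<le> P" "0 \<le> Q" "0 \<le> W" "0 \<le> D" "0 \<le> s"
    and out: "D = 0 \<or> s * (W + D) \<le> 2 * P \<or> 0 < Q \<and> W + D \<le> 2 * Q * s"
  shows "0 \<le> P + s\<^sup>2 * Q - s * W"
proof (cases "D = 0")
  case True
  have "(s * W)\<^sup>2 = 4 * P * (s\<^sup>2 * Q)" using disc True by (simp add: power_mult_distrib)
  also have "\<dots> \<le> (P + s\<^sup>2 * Q)\<^sup>2" using zero_le_power2[of "P - s\<^sup>2 * Q"] by (simp add: power2_eq_square algebra_simps)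
  finally have "s * W \<le> P + s\<^sup>2 * Q" by (rule power2_le_imp_le) (use nn in simp)
  thus ?thesis by simp
next
  case False
  define N x where "N = W + D" and "x = 2 * P - s * N"
  have N: "0 < N" using False nn by (simp add: N_def)
  have NN: "4 * P * Q = N * (W - D)" using disc by (simp add: N_def algebra_simps power2_eq_square)
  have "2 * N * (P + s\<^sup>2 * Q - s * W) = N * x - s * (N * (W - D)) + 2 * N * s\<^sup>2 * Q"
    by (simp add: x_def N_def algebra_simps power2_eq_square)
  also have "\<dots> = x * (N - 2 * s * Q)"
    unfolding NN[symmetric] by (simp add: x_def algebra_simps power2_eq_square)
  also have "0 \<le> \<dots>"
  proof (cases "s * N \<le> 2 * P")
    case True
    have "s * N * (2 * Q) \<le> 2 * P * (2 * Q)" using True nn by (intro mult_right_mono) auto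
    also have "\<dots> = N * (W - D)" using NN by simp
    finally have "N * (2 * s * Q) \<le> N * (W - D)" by (simp add: mult_ac)
    hence "2 * s * Q \<le> W - D" using N by (rule mult_left_le_imp_le)
    hence "2 * s * Q \<le> N" using nn by (simp add: N_def)
    thus ?thesis using True by (intro mult_nonneg_nonneg) (auto simp: x_def)
  next
    case F: False
    with out False have "N \<le> 2 * Q * s" by (simp add: N_def)
    thus ?thesis using F by (intro mult_nonpos_nonpos) (auto simp: x_def mult_ac)
  qed
  finally show ?thesis using N by (simp add: zero_le_mult_iff)
qed

context cone_contraction
begin

text \<open>For each pair \<open>m1\<close>, \<open>m2\<close> the real part that decides membership of \<open>A x - z x\<close> is at least a quadratic
  polynomial in \<open>\<bar>z\<bar>\<close>, whose roots are \<open>phi\<close> and \<open>Phi\<close> of the quotient matrix. A matrix of rank at most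
  one has a double root and imposes no restriction on \<open>z\<close>.\<close>

lemma pencil_by_quotient_matrices:
  assumes x: "x \<in> Kc"
    and out: "(\<forall>m1\<in>M. \<forall>m2\<in>M. ennreal (cmod z) \<le> phi (quotient_matrix j A m1 m2 x))
      \<or> (\<forall>m1\<in>M. \<forall>m2\<in>M. Phi (quotient_matrix j A m1 m2 x) \<le> ennreal (cmod z))"
  shows "A x - z *\<^sub>C x \<in> Kc"
proof (rule Kc_by_generators[OF M])
  fix m1 m2 assume m: "m1 \<in> M" "m2 \<in> M"
  define a b c d where "a = ext m1 (A x)" and "b = ext m2 (A x)" and "c = ext m1 x" and "d = ext m2 x"
  note abcd = a_def b_def c_def d_def
  define P Q w D where "P = Re (a * cnj b)" and "Q = Re (c * cnj d)" and "w = a * cnj d + b * cnj c"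
    and "D = a * d - b * c"
  have PQ: "0 \<le> P" "0 \<le> Q"
    using KcD[OF A_Kc[OF x]] KcD[OF x] m M_subset by (auto simp: P_def Q_def abcd)
  have qm: "quotient_matrix j A m1 m2 x = mat2 a b c d" by (simp add: quotient_matrix_def abcd)
  have "cmod D = 0 \<or> cmod z * (cmod w + cmod D) \<le> 2 * P \<or> 0 < Q \<and> cmod w + cmod D \<le> 2 * Q * cmod z"
  proof (cases "D = 0")
    case False
    define N where "N = cmod w + cmod D"
    from False have D: "a * d - b * c \<noteq> 0" and N: "0 < N" by (simp_all add: D_def N_def add_nonneg_pos)
    note ph = phi_mat2_nondegenerate[OF D, folded w_def D_def P_def Q_def, folded N_def]
    from out m have "ennreal (cmod z) \<le> phi (mat2 a b c d) \<or> Phi (mat2 a b c d) \<le> ennreal (cmod z)"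
      unfolding qm[symmetric] by blast
    thus ?thesis
    proof
      assume "ennreal (cmod z) \<le> phi (mat2 a b c d)"
      hence "ennreal (cmod z) \<le> ennreal (2 * P / N)"
        using PQ N by (simp add: ph divide_ennreal)
      hence "cmod z \<le> 2 * P / N" using PQ N ennreal_le_iff[of "2 * P / N" "cmod z"] by simp
      thus ?thesis using N by (simp add: N_def field_simps)
    next
      assume le: "Phi (mat2 a b c d) \<le> ennreal (cmod z)"
      have Q: "0 < Q"
      proof (rule ccontr)
        assume "\<not> 0 < Q"
        hence "Q = 0" using PQ by simp
        hence "Phi (mat2 a b c d) = top" using N by (simp add: ph ennreal_divide_eq_top_iff)
        thus False using le by (simp add: top_unique)
      qed
      hence "ennreal (N / (2 * Q)) \<le> ennreal (cmod z)"
        using le N by (simp add: ph divide_ennreal)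
      hence "N / (2 * Q) \<le> cmod z" by (simp add: ennreal_le_iff)
      thus ?thesis using Q by (simp add: N_def field_simps)
    qed
  qed simp
  hence "0 \<le> P + (cmod z)\<^sup>2 * Q - cmod z * cmod w"
    using PQ pencil_discriminant[of a d b c] by (intro quadratic_nonneg_outside_roots[where D = "cmod D"]) (auto simp: P_def Q_def w_def D_def)
  moreover have "Re (cnj z * w) \<le> cmod z * cmod w"
    using complex_Re_le_cmod[of "cnj z * w"] by (simp add: norm_mult)
  ultimately have "0 \<le> P + (cmod z)\<^sup>2 * Q - Re (cnj z * w)" by simp
  also have "\<dots> = Re ((a - z * c) * cnj (b - z * d))" unfolding P_def Q_def w_def by (rule Re_pencil[symmetric])
  finally show "0 \<le> Re (ext m1 (A x - z *\<^sub>C x) * cnj (ext m2 (A x - z *\<^sub>C x)))"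
    by (simp only: abcd cext_diff cext_scaleC)
qed

lemma quotients_at_eigenvector:
  assumes x: "x \<noteq> 0" "A x = l *\<^sub>C x"
  shows "(INF (m1, m2)\<in>M \<times> M. phi (quotient_matrix j A m1 m2 x)) = ennreal (cmod l)"
    "(SUP (m1, m2)\<in>M \<times> M. Phi (quotient_matrix j A m1 m2 x)) = ennreal (cmod l)"
proof -
  have qm: "quotient_matrix j A m1 m2 x = mat2 (l * ext m1 x) (l * ext m2 x) (ext m1 x) (ext m2 x)" for m1 m2
    by (simp add: quotient_matrix_def x cext_scaleC)
  obtain m where m: "m \<in> M" "ext m x \<noteq> 0" using ext_nonzero_generator[OF M x(1)] .
  show "(INF (m1, m2)\<in>M \<times> M. phi (quotient_matrix j A m1 m2 x)) = ennreal (cmod l)"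
  proof (rule antisym)
    show "(INF (m1, m2)\<in>M \<times> M. phi (quotient_matrix j A m1 m2 x)) \<le> ennreal (cmod l)"
      by (rule INF_lower2[of "(m, m)"]) (use m in \<open>auto simp: qm phi_mat2_eigen\<close>)
    show "ennreal (cmod l) \<le> (INF (m1, m2)\<in>M \<times> M. phi (quotient_matrix j A m1 m2 x))"
      by (rule INF_greatest) (auto simp: qm phi_mat2_eigen)
  qed
  show "(SUP (m1, m2)\<in>M \<times> M. Phi (quotient_matrix j A m1 m2 x)) = ennreal (cmod l)"
  proof (rule antisym)
    show "ennreal (cmod l) \<le> (SUP (m1, m2)\<in>M \<times> M. Phi (quotient_matrix j A m1 m2 x))"
      by (rule SUP_upper2[of "(m, m)"]) (use m in \<open>auto simp: qm phi_mat2_eigen\<close>)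
    show "(SUP (m1, m2)\<in>M \<times> M. Phi (quotient_matrix j A m1 m2 x)) \<le> ennreal (cmod l)"
      by (rule SUP_least) (auto simp: qm phi_mat2_eigen)
  qed
qed

end

text \<open>Domination implies \<open>t \<bar>\<nu> x\<bar> \<le> \<bar>\<nu> (A x)\<bar> = \<bar>l\<bar> \<bar>\<nu> x\<bar>\<close>, or the reverse inequality.\<close>

lemma gauges_against_eigenfunctional:
  fixes x :: "'x::complex_banach"
  assumes \<nu>: "\<nu> \<in> complexified_dual_cone j K" "\<nu> (A x) = l * \<nu> x" "\<nu> x \<noteq> 0"
  shows "alpha j K (A x) x \<le> ennreal (cmod l)" "ennreal (cmod l) \<le> beta j K (A x) x"
proof -
  have sc: "cmod (\<nu> (t *\<^sub>R x)) = t * cmod (\<nu> x)" if "0 \<le> t" for t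
    using \<nu>(1) that by (simp add: complexified_dual_cone_def scaleR_scaleC bounded_clinearD(4) norm_mult)
  have "t \<le> cmod l" if "0 \<le> t" "dominates j K (A x) (t *\<^sub>R x)" for t
  proof -
    have "t * cmod (\<nu> x) \<le> cmod l * cmod (\<nu> x)"
      using that(2) \<nu>(1) sc[OF that(1)] by (auto simp: dominates_def \<nu>(2) norm_mult)
    thus ?thesis using \<nu>(3) by simp
  qed
  thus "alpha j K (A x) x \<le> ennreal (cmod l)" unfolding alpha_def by (auto intro!: Sup_least ennreal_leI)
  have "cmod l \<le> t" if "0 \<le> t" "dominates j K (t *\<^sub>R x) (A x)" for t
  proof -
    have "cmod l * cmod (\<nu> x) \<le> t * cmod (\<nu> x)"
      using that(2) \<nu>(1) sc[OF that(1)] by (auto simp: dominates_def \<nu>(2) norm_mult)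
    thus ?thesis using \<nu>(3) by simp
  qed
  thus "ennreal (cmod l) \<le> beta j K (A x) x" unfolding beta_def by (auto intro!: Inf_greatest ennreal_leI)
qed

lemma gauges_at_eigenvector:
  fixes x :: "'x::complex_banach"
  assumes \<nu>: "\<nu> \<in> complexified_dual_cone j K" "\<nu> x \<noteq> 0" and x: "A x = l *\<^sub>C x"
  shows "alpha j K (A x) x = ennreal (cmod l)" "beta j K (A x) x = ennreal (cmod l)"
proof -
  have lin: "\<mu> (c *\<^sub>C x) = c * \<mu> x" if "\<mu> \<in> complexified_dual_cone j K" for \<mu> c
    using that by (simp add: complexified_dual_cone_def bounded_clinearD(4))
  have "\<nu> (A x) = l * \<nu> x" using lin[OF \<nu>(1)] x by simp
  note le = gauges_against_eigenfunctional[where A = A and l = l, OF \<nu>(1) this \<nu>(2)]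
  have dom: "dominates j K (A x) (cmod l *\<^sub>R x)" "dominates j K (cmod l *\<^sub>R x) (A x)"
    unfolding dominates_def x scaleR_scaleC by (simp_all add: lin norm_mult)
  have "ennreal (cmod l) \<le> alpha j K (A x) x" unfolding alpha_def using dom(1) by (intro Sup_upper) auto
  with le(1) show "alpha j K (A x) x = ennreal (cmod l)" by simp
  have "beta j K (A x) x \<le> ennreal (cmod l)" unfolding beta_def using dom(2) by (intro Inf_lower) auto
  with le(2) show "beta j K (A x) x = ennreal (cmod l)" by simp
qed

theorem theorem4p3:
  fixes j :: "'r::banach \<Rightarrow> 'x::complex_banach"
    and K E :: "'r set"
    and M :: "('r \<Rightarrow>\<^sub>L real) set"
    and A :: "'x \<Rightarrow> 'x"
    and \<kappa> \<theta> :: real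
  assumes "(UNIV :: 'r set) \<noteq> {0}"
    and "complexification j"
    and "real_cone K"
    and "bounded_clinear A"
    and "archimedean_generating_set K E"
    and "weak_star_generating_set j K M"
    and "0 < \<kappa>" and "bounded_sectional_aperture \<kappa> K"
    and "reproducing K"
    and "0 \<le> \<theta>" and "\<theta> < 1" and "T_matrices j E M A \<subseteq> Gamma_plus \<theta>"
  shows "ennreal (spectral_radius_op A) = (SUP x\<in>complexified_cone j K - {0}. alpha j K (A x) x)
    \<and> ennreal (spectral_radius_op A) =
        (SUP x\<in>complexified_cone j K - {0}. INF (m1, m2)\<in>M \<times> M. phi (quotient_matrix j A m1 m2 x))
    \<and> ennreal (spectral_radius_op A) = (INF x\<in>complexified_cone j K - {0}. beta j K (A x) x)
    \<and> ennreal (spectral_radius_op A) =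
        (INF x\<in>complexified_cone j K - {0}. SUP (m1, m2)\<in>M \<times> M. Phi (quotient_matrix j A m1 m2 x))
    \<and> (\<exists>lam h \<nu>. leading_eigendata j K A lam h \<nu>)
    \<and> (\<forall>lam h \<nu>. leading_eigendata j K A lam h \<nu> \<longrightarrow>
          alpha j K (A h) h = ennreal (spectral_radius_op A)
        \<and> (INF (m1, m2)\<in>M \<times> M. phi (quotient_matrix j A m1 m2 h)) = ennreal (spectral_radius_op A)
        \<and> beta j K (A h) h = ennreal (spectral_radius_op A)
        \<and> (SUP (m1, m2)\<in>M \<times> M. Phi (quotient_matrix j A m1 m2 h)) = ennreal (spectral_radius_op A))"
proof -
  interpret cone_contraction j K \<kappa> A E M \<theta>
    using assms by unfold_locales
  define \<phi> \<Phi> where "\<phi> x = (INF (m1, m2)\<in>M \<times> M. phi (quotient_matrix j A m1 m2 x))"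
    and "\<Phi> x = (SUP (m1, m2)\<in>M \<times> M. Phi (quotient_matrix j A m1 m2 x))" for x
  have at: "alpha j K (A h) h = ennreal (spectral_radius_op A) \<and> \<phi> h = ennreal (spectral_radius_op A)
    \<and> beta j K (A h) h = ennreal (spectral_radius_op A) \<and> \<Phi> h = ennreal (spectral_radius_op A)"
    if "leading_eigendata j K A lam h \<nu>" for lam h \<nu>
  proof -
    from that have h: "h \<noteq> 0" "A h = lam *\<^sub>C h" and \<nu>: "\<nu> \<in> complexified_dual_cone j K" "\<nu> h \<noteq> 0"
      and r: "cmod lam = spectral_radius_op A"
      by (auto simp: leading_eigendata_def)
    show ?thesis
      using gauges_at_eigenvector[where A = A, OF \<nu> h(2)] quotients_at_eigenvector[OF h] r by (simp add: \<phi>_def \<Phi>_def)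
  qed
  obtain lam h \<nu> where data: "leading_eigendata j K A lam h \<nu>" and \<nu>A: "\<And>x. \<nu> (A x) = lam * \<nu> x"
    and \<nu>0: "\<And>x. x \<in> Kc - {0} \<Longrightarrow> \<nu> x \<noteq> 0"
    using leading_eigendata_exists[OF assms(1)] by metis
  have h: "h \<in> Kc - {0}" and \<nu>: "\<nu> \<in> complexified_dual_cone j K" and r: "spectral_radius_op A = cmod lam"
    using data by (auto simp: leading_eigendata_def)
  have \<nu>L: "\<nu> (x - y) = \<nu> x - \<nu> y" "\<nu> (c *\<^sub>C x) = c * \<nu> x" for x y c
    using \<nu> by (simp_all add: complexified_dual_cone_def bounded_clinearD(3,4))
  have \<alpha>\<beta>: "alpha j K (A x) x \<le> ennreal (spectral_radius_op A)" "ennreal (spectral_radius_op A) \<le> beta j K (A x) x"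
    if "x \<in> Kc - {0}" for x
    using gauges_against_eigenfunctional[where A = A, OF \<nu> \<nu>A \<nu>0[OF that]] by (simp_all add: r)
  \<comment> \<open>\<open>\<nu>\<close> annihilates \<open>A x - lam x\<close> and has no zero on the punctured cone.\<close>
  have eig: "A x = lam *\<^sub>C x" if "x \<in> Kc - {0}" "A x - lam *\<^sub>C x \<in> Kc" for x
    using \<nu>0[of "A x - lam *\<^sub>C x"] that by (auto simp: \<nu>L \<nu>A)
  have \<phi>_le: "\<phi> x \<le> ennreal (spectral_radius_op A)" if x: "x \<in> Kc - {0}" for x
  proof (cases "ennreal (cmod lam) \<le> \<phi> x")
    case True
    have "ennreal (cmod lam) \<le> phi (quotient_matrix j A m1 m2 x)" if "m1 \<in> M" "m2 \<in> M" for m1 m2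
      using True that by (auto simp: \<phi>_def le_INF_iff)
    hence "A x = lam *\<^sub>C x" using x by (intro eig pencil_by_quotient_matrices) auto
    thus ?thesis using quotients_at_eigenvector(1)[of x lam] x by (simp add: \<phi>_def r)
  qed (simp add: r)
  have \<Phi>_ge: "ennreal (spectral_radius_op A) \<le> \<Phi> x" if x: "x \<in> Kc - {0}" for x
  proof (cases "\<Phi> x \<le> ennreal (cmod lam)")
    case True
    have "Phi (quotient_matrix j A m1 m2 x) \<le> ennreal (cmod lam)" if "m1 \<in> M" "m2 \<in> M" for m1 m2
      using True that by (auto simp: \<Phi>_def SUP_le_iff)
    hence "A x = lam *\<^sub>C x" using x by (intro eig pencil_by_quotient_matrices) auto
    thus ?thesis using quotients_at_eigenvector(2)[of x lam] x by (simp add: \<Phi>_def r)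
  qed (simp add: r)
  have sup: "c = (SUP x\<in>Kc - {0}. f x)" if "\<And>x. x \<in> Kc - {0} \<Longrightarrow> f x \<le> c" "f h = c" for f and c :: ennreal
    using that h by (metis (no_types, lifting) SUP_least SUP_upper antisym)
  have inf: "c = (INF x\<in>Kc - {0}. f x)" if "\<And>x. x \<in> Kc - {0} \<Longrightarrow> c \<le> f x" "f h = c" for f and c :: ennreal
    using that h by (metis (no_types, lifting) INF_greatest INF_lower antisym)
  have "ennreal (spectral_radius_op A) = (SUP x\<in>Kc - {0}. alpha j K (A x) x)"
    "ennreal (spectral_radius_op A) = (SUP x\<in>Kc - {0}. \<phi> x)"
    "ennreal (spectral_radius_op A) = (INF x\<in>Kc - {0}. beta j K (A x) x)"
    "ennreal (spectral_radius_op A) = (INF x\<in>Kc - {0}. \<Phi> x)"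
    using at[OF data] \<alpha>\<beta> \<phi>_le \<Phi>_ge by (intro sup inf; simp)+
  thus ?thesis using data at unfolding \<phi>_def \<Phi>_def by blast
qed

end
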